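(* Let $n\ge 1$ and let $\Theta$ be the map $d\mapsto(\lambda\setminus\mu,\omega)$ from $n$-diagrams to labeled skew shapes given by the compass-direction algorithm described in the context. Then: (a) $\Theta$ induces a bijection between the set of $n$-diagrams and the set of BJS-equivalence classes of labeled skew shapes all of whose labels are positive integers less than $n$. (b) For any $n$-diagram $d$, the row reading word of $\Theta(d)$ is the Jones normal form of $d$, and the column reading word of $\Theta(d)$ is the dual Jones normal form of $d$.
   Context: **Diagrams.** An $n$-diagram is a planar perfect matching: a set partition of $\{1,\dots,n\}\sqcup\{1',\dots,n'\}$ into $2$-element blocks (edges) such that, with $1,\dots,n$ placed left to right on a (northern) line and $1',\dots,n'$ placed left to right directly below on a parallel (southern) line ($k'$ directly below $k$), the edges can be drawn as pairwise non-intersecting arcs between the two lines. For a commutative ring $\Bbbk$ and $\delta\in\Bbbk$, the product of $n$-diagrams is $D_1D_2=\delta^L D_3$, where $D_1$ is stacked on top of $D_2$, the middle vertices are identified, $L$ is the number of closed loops formed and $D_3$ is the $n$-diagram obtained by removing loops and middle vertices. The span of the $n$-diagrams is the Temperley--Lieb algebra $\mathrm{TL}_n(\delta)$; $e_i$ ($1\le i\le n-1$) is the $n$-diagram with edges $\{i,i+1\}$, $\{i',(i+1)'\}$ and $\{j,j'\}$ for $j\ne i,i+1$. The empty product is the identity diagram with edges $\{j,j'\}$, $1 \le j\le n$. **Normal forms.** A word is in Jones normal form if it is $(e_{j_1}e_{j_1-1}\cdots e_{k_1})(e_{j_2}e_{j_2-1}\cdots e_{k_2})\cdots(e_{j_r}e_{j_r-1}\cdots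 e_{k_r})$ with $r\ge0$, $0<j_1<\cdots<j_r<n$, $0<k_1<\cdots<k_r<n$ and $j_i\ge k_i$ for all $i$. Every $n$-diagram equals exactly one word in Jones normal form; this is the Jones normal form of $d$. The dual version, obtained by interchanging left and right, is $(e_{a_1}e_{a_1+1}\cdots e_{b_1})(e_{a_2}e_{a_2+1}\cdots e_{b_2})\cdots(e_{a_r}e_{a_r+1}\cdots e_{b_r})$ with $n>a_1>\cdots>a_r>0$, $n>b_1>\cdots>b_r>0$ and $a_i\le b_i$ for all $i$; the dual Jones normal form of $d$ is the unique word of this form equal to $d$. **Labeled skew shapes.** Use coordinates on $\mathbb{R}^2$ in which $(x,y)$ is $x$ units south and $y$ units east of the origin. A skew shape $\lambda\setminus\mu$ (the set difference of Young diagrams of partitions $\mu\subset\lambda$, in English notation, possibly empty) is embedded in the plane with corners of boxes in $\mathbb{Z}\times\mathbb{Z}$ (any integral translate is allowed), and each unit box is identified with its southeastern corner $(i,j)\in\mathbb{Z}\times\mathbb{Z}$. The label of box $(i,j)$ is $\omega(i,j)=i-j$; a skew shape with this labeling is a labeled skew shape $(\lambda\setminus\mu,\omega)$. Two labeled skew shapes $(\lambda\setminus\mu,\omega)$, $(\alpha\setminus\beta,\omega)$ are BJS-equivalent if there is an order-preserving bijection $f:\lambda\setminus\mu\to\alpha\setminus\beta$ (for the product order on $\mathbb{Z}\times\mathbb{Z}$) that preserves labels: $f(i,j)=(h,k)$ implies $i-j=h-k$. The row (resp. column) reading sequence $(i_1,\dots,i_l)$ lists the labels across rows left to right, rows taken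 from top to bottom (resp. down columns top to bottom, columns taken from left to right); the row (resp. column) reading word is $e_{i_1}e_{i_2}\cdots e_{i_l}$. **The map $\Theta$.** Given an $n$-diagram $d$, for $k\in\{1,\dots,n\}$ set $\xi(k)=W$ if the vertex $k$ is connected to a vertex strictly to its right, and $\xi(k)=S$ otherwise; set $\xi(k')=N$ if $k'$ is connected to a vertex weakly to its right, and $\xi(k')=E$ otherwise. Let $\xi(d)=(\xi(1),\dots,\xi(n),\xi(n'),\dots,\xi(1'))$. Starting at $(0,0)$, move one unit in each successive compass direction of $\xi(d)$; this gives a closed polygonal path of $2n$ unit segments. Discard all unit segments that are traversed twice; what remains bounds a skew shape $\lambda\setminus\mu$ embedded in the plane, whose boxes are labeled by $\omega(i,j)=i-j$. Then $\Theta(d)=(\lambda\setminus\mu,\omega)$. *)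

theory Defs
  imports "HOL-Analysis.Analysis" "HOL-Library.Product_Order" "HOL-Library.Disjoint_Sets"
begin

section \<open>Diagrams\<close>

text \<open>Vertices \<open>k\<close> and \<open>k'\<close> are \<open>Northern k\<close> and \<open>Southern k\<close>; positions start at 1.\<close>

datatype vertex = Northern (position: nat) | Southern (position: nat)

definition vertices :: "nat \<Rightarrow> vertex set" where
  "vertices n = Northern ` {1..n} \<union> Southern ` {1..n}"

text \<open>The northern line is \<open>Im z = 1\<close> and the southern line is \<open>Im z = 0\<close>.\<close>

fun vertex_point :: "vertex \<Rightarrow> complex" where
  "vertex_point (Northern k) = Complex (real k) 1"
| "vertex_point (Southern k) = Complex (real k) 0"

definition planar :: "vertex set set \<Rightarrow> bool" where
  "planar d \<longleftrightarrow> (\<exists>\<gamma> :: vertex set \<Rightarrow> real \<Rightarrow> complex.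
     (\<forall>e\<in>d. arc (\<gamma> e) \<and> {pathstart (\<gamma> e), pathfinish (\<gamma> e)} = vertex_point ` e \<and>
            path_image (\<gamma> e) \<subseteq> {z. 0 \<le> Im z \<and> Im z \<le> 1}) \<and>
     (\<forall>e\<in>d. \<forall>e'\<in>d. e \<noteq> e' \<longrightarrow> path_image (\<gamma> e) \<inter> path_image (\<gamma> e') = {}))"

definition diagrams :: "nat \<Rightarrow> vertex set set set" where
  "diagrams n = {d. partition_on (vertices n) d \<and> (\<forall>e\<in>d. card e = 2) \<and> planar d}"


section \<open>The Temperley--Lieb algebra\<close>

datatype stacked_vertex = Upper nat | Middle nat | Lower nat

fun upper_copy :: "vertex \<Rightarrow> stacked_vertex" where
  "upper_copy (Northern k) = Upper k"
| "upper_copy (Southern k) = Middle k"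

fun lower_copy :: "vertex \<Rightarrow> stacked_vertex" where
  "lower_copy (Northern k) = Middle k"
| "lower_copy (Southern k) = Lower k"

fun outer :: "vertex \<Rightarrow> stacked_vertex" where
  "outer (Northern k) = Upper k"
| "outer (Southern k) = Lower k"

definition stacked_edges :: "vertex set set \<Rightarrow> vertex set set \<Rightarrow> stacked_vertex set set" where
  "stacked_edges D1 D2 = image upper_copy ` D1 \<union> image lower_copy ` D2"

text \<open>The vertex sets of the connected components of \<open>D1\<close> stacked on top of \<open>D2\<close>.\<close>

definition stacked_components ::
    "nat \<Rightarrow> vertex set set \<Rightarrow> vertex set set \<Rightarrow> stacked_vertex set set" where
  "stacked_components n D1 D2 =
     (upper_copy ` vertices n \<union> lower_copy ` vertices n) //
     {(u, v). {u, v} \<in> stacked_edges D1 D2}\<^sup>*"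

text \<open>The closed loops are the components having no vertex on the two outer lines; every other
  component becomes an edge of the product diagram.\<close>

definition loops :: "nat \<Rightarrow> vertex set set \<Rightarrow> vertex set set \<Rightarrow> nat" where
  "loops n D1 D2 = card {C \<in> stacked_components n D1 D2. C \<subseteq> range Middle}"

definition stack :: "nat \<Rightarrow> vertex set set \<Rightarrow> vertex set set \<Rightarrow> vertex set set" where
  "stack n D1 D2 =
     (\<lambda>C. outer -` C) ` {C \<in> stacked_components n D1 D2. \<not> C \<subseteq> range Middle}"

text \<open>An element of the algebra is represented by its coefficient function.\<close>

definition tl_basis :: "vertex set set \<Rightarrow> vertex set set \<Rightarrow> 'k::comm_ring_1" where
  "tl_basis d = (\<lambda>D. if D = d then 1 else 0)"

definition tl_mult :: "nat \<Rightarrow> 'k::comm_ring_1 \<Rightarrow> (vertex set set \<Rightarrow> 'k) \<Rightarrow>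
    (vertex set set \<Rightarrow> 'k) \<Rightarrow> vertex set set \<Rightarrow> 'k" where
  "tl_mult n \<delta> f g = (\<lambda>D. \<Sum>D1\<in>diagrams n. \<Sum>D2\<in>diagrams n.
     f D1 * g D2 * (\<delta> ^ loops n D1 D2 * tl_basis (stack n D1 D2) D))"

definition identity_diagram :: "nat \<Rightarrow> vertex set set" where
  "identity_diagram n = {{Northern j, Southern j} | j. j \<in> {1..n}}"

definition generator :: "nat \<Rightarrow> nat \<Rightarrow> vertex set set" where
  "generator n i =
     {{Northern i, Northern (i + 1)}, {Southern i, Southern (i + 1)}} \<union>
     {{Northern j, Southern j} | j. j \<in> {1..n} \<and> j \<noteq> i \<and> j \<noteq> i + 1}"

text \<open>The word \<open>e\<^sub>i\<^sub>1 \<dots> e\<^sub>i\<^sub>l\<close> is the list \<open>[i1, \<dots>, il]\<close>.\<close>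

definition word_value :: "nat \<Rightarrow> 'k::comm_ring_1 \<Rightarrow> nat list \<Rightarrow> vertex set set \<Rightarrow> 'k" where
  "word_value n \<delta> w =
     foldr (\<lambda>i. tl_mult n \<delta> (tl_basis (generator n i))) w (tl_basis (identity_diagram n))"


section \<open>Normal forms\<close>

definition jones_form :: "nat \<Rightarrow> nat list \<Rightarrow> bool" where
  "jones_form n w \<longleftrightarrow> (\<exists>js ks.
     set js \<subseteq> {0<..<n} \<and> set ks \<subseteq> {0<..<n} \<and>
     sorted_wrt (<) js \<and> sorted_wrt (<) ks \<and> list_all2 (\<ge>) js ks \<and>
     w = concat (map2 (\<lambda>j k. rev [k..<Suc j]) js ks))"

definition dual_jones_form :: "nat \<Rightarrow> nat list \<Rightarrow> bool" where
  "dual_jones_form n w \<longleftrightarrow> (\<exists>as bs.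
     set as \<subseteq> {0<..<n} \<and> set bs \<subseteq> {0<..<n} \<and>
     sorted_wrt (>) as \<and> sorted_wrt (>) bs \<and> list_all2 (\<le>) as bs \<and>
     w = concat (map2 (\<lambda>a b. [a..<Suc b]) as bs))"

text \<open>\<open>w\<close> is the one and only word of the respective form that equals \<open>d\<close> in the algebra.\<close>

definition is_jones_normal_form_of ::
    "nat \<Rightarrow> 'k::comm_ring_1 \<Rightarrow> nat list \<Rightarrow> vertex set set \<Rightarrow> bool" where
  "is_jones_normal_form_of n \<delta> w d \<longleftrightarrow>
     (\<forall>v. jones_form n v \<and> word_value n \<delta> v = tl_basis d \<longleftrightarrow> v = w)"

definition is_dual_jones_normal_form_of ::
    "nat \<Rightarrow> 'k::comm_ring_1 \<Rightarrow> nat list \<Rightarrow> vertex set set \<Rightarrow> bool" where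
  "is_dual_jones_normal_form_of n \<delta> w d \<longleftrightarrow>
     (\<forall>v. dual_jones_form n v \<and> word_value n \<delta> v = tl_basis d \<longleftrightarrow> v = w)"


section \<open>Labeled skew shapes\<close>

text \<open>A point \<open>(x, y)\<close> lies \<open>x\<close> units south and \<open>y\<close> units east of the origin. A box is the pair
  of coordinates of its southeastern corner. Since the labeling is determined by the position of
  the boxes, a labeled skew shape is represented by its set of boxes. A partition is a weakly
  decreasing list, in which trailing zeros are allowed.\<close>

definition young_diagram :: "nat list \<Rightarrow> (int \<times> int) set" where
  "young_diagram p = {(int i + 1, int j + 1) | i j. i < length p \<and> j < p ! i}"

definition skew_shape :: "(int \<times> int) set \<Rightarrow> bool" where
  "skew_shape B \<longleftrightarrow> (\<exists>lam mu s t. sorted_wrt (\<ge>) lam \<and> sorted_wrt (\<ge>) mu \<and>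
     young_diagram mu \<subseteq> young_diagram lam \<and>
     B = (\<lambda>(i, j). (i + s, j + t)) ` (young_diagram lam - young_diagram mu))"

definition label :: "int \<times> int \<Rightarrow> int" where
  "label = (\<lambda>(i, j). i - j)"

text \<open>In \<open>mono_on\<close>, the order on pairs is the product order from \<open>Product_Order\<close>.\<close>

definition BJS :: "((int \<times> int) set \<times> (int \<times> int) set) set" where
  "BJS = {(A, B). skew_shape A \<and> skew_shape B \<and>
     (\<exists>f. bij_betw f A B \<and> mono_on A f \<and> (\<forall>b\<in>A. label (f b) = label b))}"

definition row_reading_sequence :: "(int \<times> int) set \<Rightarrow> int list" where
  "row_reading_sequence B =
     concat (map (\<lambda>i. map (\<lambda>j. label (i, j)) (sorted_list_of_set {j. (i, j) \<in> B}))
       (sorted_list_of_set (fst ` B)))"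

definition column_reading_sequence :: "(int \<times> int) set \<Rightarrow> int list" where
  "column_reading_sequence B =
     concat (map (\<lambda>j. map (\<lambda>i. label (i, j)) (sorted_list_of_set {i. (i, j) \<in> B}))
       (sorted_list_of_set (snd ` B)))"

text \<open>The reading words are only meaningful for shapes with positive labels, on which \<open>nat\<close> is
  faithful.\<close>

definition row_reading_word :: "(int \<times> int) set \<Rightarrow> nat list" where
  "row_reading_word B = map nat (row_reading_sequence B)"

definition column_reading_word :: "(int \<times> int) set \<Rightarrow> nat list" where
  "column_reading_word B = map nat (column_reading_sequence B)"


section \<open>The map \<open>\<Theta>\<close>\<close>

datatype compass = North | South | East | West

fun move :: "compass \<Rightarrow> int \<times> int \<Rightarrow> int \<times> int" where
  "move North (x, y) = (x - 1, y)"
| "move South (x, y) = (x + 1, y)"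
| "move East (x, y) = (x, y + 1)"
| "move West (x, y) = (x, y - 1)"

fun \<xi> :: "vertex set set \<Rightarrow> vertex \<Rightarrow> compass" where
  "\<xi> d (Northern k) = (if \<exists>v. {Northern k, v} \<in> d \<and> position v > k then West else South)"
| "\<xi> d (Southern k) = (if \<exists>v. {Southern k, v} \<in> d \<and> position v \<ge> k then North else East)"

definition directions :: "nat \<Rightarrow> vertex set set \<Rightarrow> compass list" where
  "directions n d = map (\<xi> d) (map Northern [1..<Suc n] @ map Southern (rev [1..<Suc n]))"

text \<open>A unit segment is the set of its two endpoints, so it carries no orientation.\<close>

fun segments :: "int \<times> int \<Rightarrow> compass list \<Rightarrow> (int \<times> int) set list" where
  "segments p [] = []"
| "segments p (c # cs) = {p, move c p} # segments (move c p) cs"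

definition remaining_segments :: "nat \<Rightarrow> vertex set set \<Rightarrow> (int \<times> int) set set" where
  "remaining_segments n d =
     (let ss = segments (0, 0) (directions n d) in {s \<in> set ss. count_list ss s \<noteq> 2})"

fun sides :: "int \<times> int \<Rightarrow> (int \<times> int) set set" where
  "sides (i, j) =
     {{(i - 1, j - 1), (i - 1, j)}, {(i, j - 1), (i, j)},
      {(i - 1, j - 1), (i, j - 1)}, {(i - 1, j), (i, j)}}"

text \<open>The boundary of a union of boxes consists of the unit segments that are a side of exactly
  one of the boxes.\<close>

definition boundary :: "(int \<times> int) set \<Rightarrow> (int \<times> int) set set" where
  "boundary B = {s. \<exists>!b. b \<in> B \<and> s \<in> sides b}"

definition bounded_shape :: "nat \<Rightarrow> vertex set set \<Rightarrow> (int \<times> int) set \<Rightarrow> bool" where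
  "bounded_shape n d B \<longleftrightarrow> skew_shape B \<and> boundary B = remaining_segments n d"

definition \<Theta> :: "nat \<Rightarrow> vertex set set \<Rightarrow> (int \<times> int) set" where
  "\<Theta> n d = (THE B. bounded_shape n d B)"

end

theory Submission
  imports Defs
begin

text \<open>Write \<open>a k\<close> for the number of northern vertices at positions \<open>1, \<dots>, k\<close> that are left endpoints and
  \<open>b k\<close> for the number of southern vertices there that are right endpoints. The two boundary paths of
  \<open>\<Theta> d\<close> are \<open>(k - a k, - a k)\<close> and \<open>(k - b k, - b k)\<close>, and \<open>2 * (a k - b k)\<close> is the number of edges crossing
  the vertical line at \<open>k + 1/2\<close>, so \<open>\<Theta> d\<close> has exactly \<open>a k - b k\<close> boxes of label \<open>k\<close>. The labels of the
  row ends of \<open>\<Theta> d\<close> encode the northern right and the southern left endpoints, those of the column ends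
  the northern left and the southern right endpoints, and either pair of sets determines a planar
  diagram.

  A skew shape is the same as a finite order-convex set of boxes. Boxes whose labels differ by at most
  one are comparable, so the set of labels of boxes without a neighbour in a given direction is invariant
  under BJS-equivalence; conversely the western and eastern ends determine the class, because they list
  the label intervals of the successive rows. These intervals are also the factors of the row reading
  word, a word in Jones normal form. Multiplying such a word out from the right, each generator
  \<open>e\<^sub>i\<close> only joins \<open>i\<close> to \<open>i + 1\<close> and the two former partners to each other, without creating a loop,
  and this changes the endpoint sets in step with the normal form.

  Planarity is turned into a non-interlacing condition by \<open>z \<mapsto> exp (\<pi> z)\<close>, which maps the strip
  into the closed upper half plane and all vertices to the real axis.\<close>

section \<open>Matchings and surgery\<close>

text \<open>Three notions resist direct computation: planarity quantifies over arbitrary arcs,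
  products use connected components of a stacked graph, and BJS-equivalence quantifies over
  bijections. Each is replaced once by a finite criterion, on partner functions or on sets of end
  labels. Partner functions are preferred to sets of blocks because multiplication by a generator
  becomes an update at four points. The exponential is used because \<open>fashoda_interlace\<close>
  asks for four interlaced endpoints on one side of a box, whereas the edges of a diagram end on two
  lines. Two pairs of endpoint sets occur because a factor of a Jones word changes the northern
  right and southern left endpoints predictably, but may also turn a vertical edge into a southern
  right endpoint; for dual words the mirror image holds. No inverse of \<open>\<Theta>\<close> is
  constructed. A diagram for a given class is the value of the row reading word of a shape in it,
  and normal forms are unique because the value of a Jones word reveals the first and last letters
  of its factors.\<close>

definition matchings :: "nat \<Rightarrow> vertex set set set" where
  "matchings n = {d. partition_on (vertices n) d \<and> (\<forall>e\<in>d. card e = 2)}"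

definition partner :: "vertex set set \<Rightarrow> vertex \<Rightarrow> vertex" where
  "partner d v = (THE u. {v, u} \<in> d)"

lemma finite_vertices [simp]: "finite (vertices n)"
  by (simp add: vertices_def)

lemma Northern_in_vertices [simp]: "Northern k \<in> vertices n \<longleftrightarrow> 1 \<le> k \<and> k \<le> n"
  and Southern_in_vertices [simp]: "Southern k \<in> vertices n \<longleftrightarrow> 1 \<le> k \<and> k \<le> n"
  by (auto simp: vertices_def)

lemma position_in_vertices: "v \<in> vertices n \<Longrightarrow> 1 \<le> position v \<and> position v \<le> n"
  by (auto simp: vertices_def)

lemma matchings_edge:
  assumes "d \<in> matchings n" "e \<in> d" "x \<in> e"
  obtains y where "e = {x, y}" "x \<noteq> y" "y \<in> vertices n" "x \<in> vertices n"
proof -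
  have "card e = 2" "\<Union>d = vertices n"
    using assms by (auto simp: matchings_def partition_on_def)
  then obtain a b where "e = {a, b}" "a \<noteq> b" by (meson card_2_iff)
  then show ?thesis using that assms \<open>\<Union>d = vertices n\<close> by (cases "x = a") auto
qed

lemma matchings_ex1:
  assumes "d \<in> matchings n" "v \<in> vertices n"
  shows "\<exists>!u. {v, u} \<in> d"
proof -
  have part: "partition_on (vertices n) d" using assms by (simp add: matchings_def)
  then obtain e where e: "e \<in> d" "v \<in> e"
    using assms(2) by (auto simp: partition_on_def)
  then obtain y where y: "e = {v, y}" using matchings_edge assms(1) by metis
  show ?thesis
  proof (rule ex1I)
    show "{v, y} \<in> d" using e y by simp
  next
    fix u assume u: "{v, u} \<in> d"
    then have "{v, u} = e"
      using part e by (metis disjoint_iff disjointD insertI1 partition_onD2)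
    then show "u = y" using y by (metis doubleton_eq_iff)
  qed
qed

lemma partner_edge:
  assumes "d \<in> matchings n" "v \<in> vertices n"
  shows "{v, partner d v} \<in> d"
  unfolding partner_def using theI'[OF matchings_ex1[OF assms]] .

lemma edge_iff_partner:
  assumes "d \<in> matchings n"
  shows "{v, u} \<in> d \<longleftrightarrow> v \<in> vertices n \<and> u = partner d v"
  using assms matchings_ex1 partner_edge
  by (metis insertI1 matchings_edge)

lemma partner_in_vertices:
  assumes "d \<in> matchings n" "v \<in> vertices n"
  shows "partner d v \<in> vertices n"
  by (metis assms edge_iff_partner insert_commute)

lemma partner_partner:
  assumes "d \<in> matchings n" "v \<in> vertices n"
  shows "partner d (partner d v) = v"
  by (metis assms edge_iff_partner insert_commute)

lemma partner_neq:
  assumes "d \<in> matchings n" "v \<in> vertices n"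
  shows "partner d v \<noteq> v"
  using partner_edge[OF assms] assms(1) by (force simp: matchings_def)

definition matching_of :: "nat \<Rightarrow> (vertex \<Rightarrow> vertex) \<Rightarrow> vertex set set" where
  "matching_of n p = (\<lambda>v. {v, p v}) ` vertices n"

lemma matching_of_partner:
  assumes "d \<in> matchings n"
  shows "matching_of n (partner d) = d"
proof
  show "matching_of n (partner d) \<subseteq> d"
    using partner_edge[OF assms] by (auto simp: matching_of_def)
  show "d \<subseteq> matching_of n (partner d)"
  proof
    fix e assume e: "e \<in> d"
    then have "e \<noteq> {}" using assms by (auto simp: matchings_def)
    then obtain x where "x \<in> e" by auto
    then obtain y where "e = {x, y}" using matchings_edge[OF assms e] by metis
    then show "e \<in> matching_of n (partner d)"
      using e edge_iff_partner[OF assms] by (auto simp: matching_of_def)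
  qed
qed

lemma matching_eqI:
  assumes "d \<in> matchings n" "d' \<in> matchings n"
    and "\<And>v. v \<in> vertices n \<Longrightarrow> partner d v = partner d' v"
  shows "d = d'"
proof -
  have "matching_of n (partner d) = matching_of n (partner d')"
    using assms(3) by (auto simp: matching_of_def)
  then show ?thesis using assms matching_of_partner by metis
qed

text \<open>Values of \<open>p\<close> outside \<open>vertices n\<close> are unconstrained, so two
  functions describing the same matching are only known to agree on \<open>vertices n\<close>.
  Equalities of pairings are therefore stated pointwise there.\<close>

locale pairing =
  fixes n :: nat and p :: "vertex \<Rightarrow> vertex"
  assumes p_in: "v \<in> vertices n \<Longrightarrow> p v \<in> vertices n"
    and p_p: "v \<in> vertices n \<Longrightarrow> p (p v) = v"
    and p_neq: "v \<in> vertices n \<Longrightarrow> p v \<noteq> v"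
begin

lemma matching_of_in: "matching_of n p \<in> matchings n"
proof -
  have "partition_on (vertices n) (matching_of n p)"
    unfolding partition_on_def matching_of_def disjoint_def
    using p_in p_p by (auto; metis)
  moreover have "\<forall>e\<in>matching_of n p. card e = 2"
    using p_neq by (auto simp: matching_of_def card_2_iff)
  ultimately show ?thesis by (simp add: matchings_def)
qed

lemma partner_matching_of:
  assumes "v \<in> vertices n"
  shows "partner (matching_of n p) v = p v"
proof -
  have "{v, p v} \<in> matching_of n p"
    using assms by (simp add: matching_of_def)
  then show ?thesis using edge_iff_partner[OF matching_of_in] by simp
qed

end

lemma pairing_partner: "d \<in> matchings n \<Longrightarrow> pairing n (partner d)"
  by (simp add: pairing.intro partner_in_vertices partner_partner partner_neq)

text \<open>The cyclic order of the vertices along the boundary of the strip, cut open at its right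
  end: the northern vertices from right to left, then the southern ones from left to right. The
  absolute value recovers the position.\<close>

fun line :: "vertex \<Rightarrow> int" where
  "line (Northern k) = - int k"
| "line (Southern k) = int k"

lemma line_inj: "x \<in> vertices n \<Longrightarrow> y \<in> vertices n \<Longrightarrow> line x = line y \<longleftrightarrow> x = y"
  by (auto simp: vertices_def)

definition separates :: "'a::linorder \<Rightarrow> 'a \<Rightarrow> 'a \<Rightarrow> bool" where
  "separates a b c \<longleftrightarrow> min a b < c \<and> c < max a b"

text \<open>Symmetry of the crossing relation of two chords: either of them may be tested against
  the two ends of the other.\<close>

lemma separates_sym:
  assumes "a \<noteq> c" "a \<noteq> d" "b \<noteq> c" "b \<noteq> d"
  shows "(separates a b c = separates a b d) = (separates c d a = separates c d b)"
  using assms unfolding separates_def min_def max_def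
  by (smt (verit) linorder_less_linear order.asym order.strict_trans leD leI)

definition noncrossing :: "nat \<Rightarrow> (vertex \<Rightarrow> vertex) \<Rightarrow> bool" where
  "noncrossing n p \<longleftrightarrow> (\<forall>x\<in>vertices n. \<forall>y\<in>vertices n. y \<noteq> x \<longrightarrow> y \<noteq> p x \<longrightarrow>
     separates (line x) (line (p x)) (line y) = separates (line x) (line (p x)) (line (p y)))"

text \<open>The effect of left multiplication by \<open>e\<^sub>i\<close> on the partner function.\<close>

definition surgery :: "nat \<Rightarrow> (vertex \<Rightarrow> vertex) \<Rightarrow> vertex \<Rightarrow> vertex" where
  "surgery i p = p (Northern i := Northern (Suc i), Northern (Suc i) := Northern i,
     p (Northern i) := p (Northern (Suc i)), p (Northern (Suc i)) := p (Northern i))"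

text \<open>\<open>unjoined\<close> excludes exactly the situation in which the lower arc of
  \<open>e\<^sub>i\<close> would close up to a loop. It also makes the four updated points
  distinct.\<close>

locale surgery_site = pairing +
  fixes i :: nat
  assumes i: "1 \<le> i" "i < n" and unjoined: "p (Northern i) \<noteq> Northern (Suc i)"
begin

abbreviation "u \<equiv> p (Northern i)"
abbreviation "v \<equiv> p (Northern (Suc i))"

lemma site: "Northern i \<in> vertices n" "Northern (Suc i) \<in> vertices n" "u \<in> vertices n" "v \<in> vertices n"
  using i by (auto intro!: p_in)

lemma site_distinct: "u \<noteq> v" "u \<noteq> Northern i" "v \<noteq> Northern i" "u \<noteq> Northern (Suc i)" "v \<noteq> Northern (Suc i)"
  "p u = Northern i" "p v = Northern (Suc i)"
  using site unjoined p_p p_neq by (metis vertex.inject(1) n_not_Suc_n)+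

lemma surgery_simps:
  "surgery i p (Northern i) = Northern (Suc i)"
  "surgery i p (Northern (Suc i)) = Northern i"
  "surgery i p u = v" "surgery i p v = u"
  "x \<noteq> Northern i \<Longrightarrow> x \<noteq> Northern (Suc i) \<Longrightarrow> x \<noteq> u \<Longrightarrow> x \<noteq> v \<Longrightarrow> surgery i p x = p x"
  using site_distinct by (auto simp: surgery_def)

lemma p_avoids:
  assumes "x \<in> vertices n" "x \<noteq> Northern i" "x \<noteq> Northern (Suc i)" "x \<noteq> u" "x \<noteq> v"
  shows "p x \<noteq> Northern i" "p x \<noteq> Northern (Suc i)" "p x \<noteq> u" "p x \<noteq> v"
  using assms p_p site by metis+

lemma surgery_cases:
  obtains "x = Northern i" | "x = Northern (Suc i)" | "x = u" | "x = v"
    | "x \<noteq> Northern i" "x \<noteq> Northern (Suc i)" "x \<noteq> u" "x \<noteq> v"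
  by blast

lemma pairing_surgery: "pairing n (surgery i p)"
proof
  fix x assume x: "x \<in> vertices n"
  show "surgery i p x \<in> vertices n"
    by (rule surgery_cases[of x]) (use x site p_in surgery_simps in auto)
  show "surgery i p (surgery i p x) = x"
    by (rule surgery_cases[of x]) (use x p_p surgery_simps p_avoids in auto)
  show "surgery i p x \<noteq> x"
    by (rule surgery_cases[of x]) (use x p_neq surgery_simps site_distinct in auto)
qed

text \<open>The vertices \<open>Northern i\<close> and \<open>Northern (Suc i)\<close> are
  neighbours on \<open>line\<close>, so no other edge separates them and nothing lies between them.
  The only new edge that could cross something joins \<open>u\<close> and \<open>v\<close>.\<close>

lemma noncrossing_surgery:
  assumes nc: "noncrossing n p"
  shows "noncrossing n (surgery i p)"
proof -
  have cup: "separates a b (line (Northern i)) = separates a b (line (Northern (Suc i)))"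
    if "a \<noteq> line (Northern i)" "a \<noteq> line (Northern (Suc i))"
       "b \<noteq> line (Northern i)" "b \<noteq> line (Northern (Suc i))" for a b
    using that by (auto simp: separates_def min_def max_def)
  \<comment> \<open>The edge of \<open>z\<close> has \<open>u\<close> on the side of
    \<open>Northern i\<close> and \<open>v\<close> on the side of \<open>Northern (Suc i)\<close>,
    since these were edges of the noncrossing \<open>p\<close>; the two sides agree by
    \<open>cup\<close>.\<close>
  have other: "separates (line z) (line (p z)) (line u) = separates (line z) (line (p z)) (line v)"
    if z: "z \<in> vertices n" "z \<noteq> Northern i" "z \<noteq> Northern (Suc i)" "z \<noteq> u" "z \<noteq> v" for z
  proof -
    note av = p_avoids[OF z]
    have "separates (line z) (line (p z)) (line (Northern i)) = separates (line z) (line (p z)) (line u)"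
      "separates (line z) (line (p z)) (line (Northern (Suc i))) = separates (line z) (line (p z)) (line v)"
      using nc z av site unfolding noncrossing_def by metis+
    moreover have "separates (line z) (line (p z)) (line (Northern i)) = separates (line z) (line (p z)) (line (Northern (Suc i)))"
      by (rule cup) (use z av site p_in line_inj in metis)+
    ultimately show ?thesis by simp
  qed
  have other': "separates (line u) (line v) (line z) = separates (line u) (line v) (line (p z))"
    if z: "z \<in> vertices n" "z \<noteq> Northern i" "z \<noteq> Northern (Suc i)" "z \<noteq> u" "z \<noteq> v" for z
    using other[OF z] by (subst separates_sym) (use z p_avoids[OF z] site p_in line_inj in metis)+
  have empty: "\<not> separates (line (Northern i)) (line (Northern (Suc i))) c" "\<not> separates (line (Northern (Suc i))) (line (Northern i)) c" for c
    by (auto simp: separates_def)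
  have comm: "separates a b c = separates b a c" for a b c :: int
    by (auto simp: separates_def min_def max_def)
  show ?thesis
    unfolding noncrossing_def
  proof (intro ballI impI)
    fix x y assume x: "x \<in> vertices n" and y: "y \<in> vertices n" and "y \<noteq> x" and yx: "y \<noteq> surgery i p x"
    have cup': "separates (line z) (line w) (line (Northern i)) = separates (line z) (line w) (line (Northern (Suc i)))"
      if "z \<in> vertices n" "w \<in> vertices n" "z \<noteq> Northern i" "z \<noteq> Northern (Suc i)" "w \<noteq> Northern i" "w \<noteq> Northern (Suc i)" for z w
      by (rule cup) (use that site line_inj in metis)+
    show "separates (line x) (line (surgery i p x)) (line y) =
          separates (line x) (line (surgery i p x)) (line (surgery i p y))"
    proof (rule surgery_cases[of x])
      assume "x = Northern i" then show ?thesis using empty surgery_simps by simp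
    next
      assume "x = Northern (Suc i)" then show ?thesis using empty surgery_simps by simp
    next
      assume xu: "x = u"
      show ?thesis
        by (rule surgery_cases[of y])
          (use xu yx \<open>y \<noteq> x\<close> y surgery_simps site site_distinct cup'[of u v] other' in auto)
    next
      assume xu: "x = v"
      show ?thesis
        by (rule surgery_cases[of y])
          (use xu yx \<open>y \<noteq> x\<close> y surgery_simps site site_distinct cup'[of v u] other' comm[of "line v" "line u"] in auto)
    next
      assume o: "x \<noteq> Northern i" "x \<noteq> Northern (Suc i)" "x \<noteq> u" "x \<noteq> v"
      note av = p_avoids[OF x o]
      show ?thesis
      proof (rule surgery_cases[of y])
        assume "y \<noteq> Northern i" "y \<noteq> Northern (Suc i)" "y \<noteq> u" "y \<noteq> v"
        then show ?thesis using o nc x y yx \<open>y \<noteq> x\<close> surgery_simps(5) unfolding noncrossing_def by metis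
      qed (use o av x surgery_simps(1-4) surgery_simps(5)[OF o] other[OF x o] cup'[of x "p x"] p_in in auto)
    qed
  qed
qed

end

section \<open>Types of endpoints\<close>

definition northern_left :: "nat \<Rightarrow> (vertex \<Rightarrow> vertex) \<Rightarrow> nat set" where
  "northern_left n p = {k \<in> {1..n}. k < position (p (Northern k))}"

definition northern_right :: "nat \<Rightarrow> (vertex \<Rightarrow> vertex) \<Rightarrow> nat set" where
  "northern_right n p = {k \<in> {1..n}. position (p (Northern k)) < k}"

definition southern_left :: "nat \<Rightarrow> (vertex \<Rightarrow> vertex) \<Rightarrow> nat set" where
  "southern_left n p = {k \<in> {1..n}. k < position (p (Southern k))}"

definition southern_right :: "nat \<Rightarrow> (vertex \<Rightarrow> vertex) \<Rightarrow> nat set" where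
  "southern_right n p = {k \<in> {1..n}. position (p (Southern k)) < k}"

text \<open>The argument is an integer so that \<open>k - 1\<close> and negative labels need no case
  distinction.\<close>

definition count_upto :: "nat set \<Rightarrow> int \<Rightarrow> int" where
  "count_upto A k = int (card {l \<in> A. int l \<le> k})"

lemma count_upto_pred:
  assumes "finite A"
  shows "count_upto A k = count_upto A (k - 1) + (if k \<in> int ` A then 1 else 0)"
proof (cases "k \<in> int ` A")
  case True
  then obtain m where m: "m \<in> A" "k = int m" by auto
  then have "{l \<in> A. int l \<le> k} = insert m {l \<in> A. int l \<le> k - 1}" by auto
  moreover have "m \<notin> {l \<in> A. int l \<le> k - 1}" using m by auto
  ultimately show ?thesis using assms True by (simp add: count_upto_def)
next
  case False
  then have "{l \<in> A. int l \<le> k} = {l \<in> A. int l \<le> k - 1}"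
    by (auto simp: image_iff)
  then show ?thesis using False by (simp add: count_upto_def)
qed

lemma position_eq_iff_vertex:
  "position x = position y \<longleftrightarrow> x = y \<or> x = (case y of Northern k \<Rightarrow> Southern k | Southern k \<Rightarrow> Northern k)"
  by (cases x; cases y) auto

context pairing
begin

lemma position_p: 
  assumes "x \<in> vertices n" shows "1 \<le> position (p x)" "position (p x) \<le> n"
  using position_in_vertices[OF p_in[OF assms]] by auto

lemma vertical_iff:
  assumes "k \<in> {1..n}"
  shows "position (p (Northern k)) = k \<longleftrightarrow> p (Northern k) = Southern k"
    and "position (p (Southern k)) = k \<longleftrightarrow> p (Northern k) = Southern k"
proof -
  have v: "Northern k \<in> vertices n" "Southern k \<in> vertices n" using assms by auto
  show "position (p (Northern k)) = k \<longleftrightarrow> p (Northern k) = Southern k"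
    using p_neq[OF v(1)] by (cases "p (Northern k)") auto
  have "position (p (Southern k)) = k \<longleftrightarrow> p (Southern k) = Northern k"
    using p_neq[OF v(2)] by (cases "p (Southern k)") auto
  then show "position (p (Southern k)) = k \<longleftrightarrow> p (Northern k) = Southern k"
    using p_p v by metis
qed

definition crossing :: "int \<Rightarrow> vertex set" where
  "crossing k = {x \<in> vertices n. int (position x) \<le> k \<and> k < int (position (p x))}"

text \<open>Up to position \<open>k\<close> both lines contain equally many vertices and equally
  many ends of vertical edges, so left plus right endpoints number the same in the north and in the
  south. Moreover the left endpoints up to \<open>k\<close> are the partners of the right endpoints
  up to \<open>k\<close>, together with the starts of the crossing edges. Adding the two relations
  gives the factor 2. Planarity does not enter.\<close>

lemma count_crossing:
  "2 * (count_upto (northern_left n p) k - count_upto (southern_right n p) k) = int (card (crossing k))"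
proof -
  let ?le = "\<lambda>A. {l \<in> A. int l \<le> k}"
  let ?V = "{l \<in> {1..n}. p (Northern l) = Southern l}"
  define R where "R = {x \<in> vertices n. int (position x) \<le> k \<and> position (p x) < position x}"
  define L where "L = {x \<in> vertices n. int (position x) \<le> k \<and> position x < position (p x)}"
  have fin: "finite (northern_left n p)" "finite (southern_right n p)" "finite (northern_right n p)" "finite (southern_left n p)"
    by (auto simp: northern_left_def southern_right_def northern_right_def southern_left_def)
  have finR: "finite R" "finite L" "finite (crossing k)"
    by (auto simp: R_def L_def crossing_def)
  have "?le {1..n} = ?le (northern_left n p) \<union> (?le (northern_right n p) \<union> ?le ?V)"
    using vertical_iff(1) by (auto simp: northern_left_def northern_right_def) (metis nat_neq_iff)
  moreover have "card (?le (northern_left n p) \<union> (?le (northern_right n p) \<union> ?le ?V)) =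
      card (?le (northern_left n p)) + (card (?le (northern_right n p)) + card (?le ?V))"
    by (subst card_Un_disjoint; (subst card_Un_disjoint)?)
      (auto simp: northern_left_def northern_right_def)
  ultimately have north: "card (?le {1..n}) = 
      card (?le (northern_left n p)) + (card (?le (northern_right n p)) + card (?le ?V))" by simp
  have "?le {1..n} = ?le (southern_left n p) \<union> (?le (southern_right n p) \<union> ?le ?V)"
    using vertical_iff(2) by (auto simp: southern_left_def southern_right_def) (metis nat_neq_iff)
  moreover have "card (?le (southern_left n p) \<union> (?le (southern_right n p) \<union> ?le ?V)) =
      card (?le (southern_left n p)) + (card (?le (southern_right n p)) + card (?le ?V))"
    by (subst card_Un_disjoint; (subst card_Un_disjoint)?)
      (auto simp: southern_left_def southern_right_def dest!: vertical_iff(2)[THEN iffD2, rotated])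
  ultimately have south: "card (?le {1..n}) = 
      card (?le (southern_left n p)) + (card (?le (southern_right n p)) + card (?le ?V))" by simp
  have "L = Northern ` ?le (northern_left n p) \<union> Southern ` ?le (southern_left n p)"
    by (auto simp: L_def northern_left_def southern_left_def vertices_def)
  moreover have "card (Northern ` ?le (northern_left n p) \<union> Southern ` ?le (southern_left n p)) =
     card (?le (northern_left n p)) + card (?le (southern_left n p))"
    by (subst card_Un_disjoint) (use fin in \<open>auto simp: card_image inj_on_def\<close>)
  ultimately have L: "card L = card (?le (northern_left n p)) + card (?le (southern_left n p))" by simp
  have "R = Northern ` ?le (northern_right n p) \<union> Southern ` ?le (southern_right n p)"
    by (auto simp: R_def northern_right_def southern_right_def vertices_def)
  moreover have "card (Northern ` ?le (northern_right n p) \<union> Southern ` ?le (southern_right n p)) =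
     card (?le (northern_right n p)) + card (?le (southern_right n p))"
    by (subst card_Un_disjoint) (use fin in \<open>auto simp: card_image inj_on_def\<close>)
  ultimately have R: "card R = card (?le (northern_right n p)) + card (?le (southern_right n p))" by simp
  have "L = p ` R \<union> crossing k"
  proof
    show "L \<subseteq> p ` R \<union> crossing k"
    proof
      fix x assume x: "x \<in> L"
      then have "x = p (p x)" "p x \<in> vertices n" using p_p p_in by (auto simp: L_def)
      then show "x \<in> p ` R \<union> crossing k"
        using x by (cases "int (position (p x)) \<le> k") (auto simp: L_def R_def crossing_def image_iff)
    qed
    show "p ` R \<union> crossing k \<subseteq> L"
      using p_p p_in by (auto simp: L_def R_def crossing_def)
  qed
  moreover have "card (p ` R \<union> crossing k) = card (p ` R) + card (crossing k)"
    by (subst card_Un_disjoint) (use finR p_p in \<open>auto simp: R_def crossing_def\<close>)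
  moreover have "inj_on p R" by (rule inj_on_inverseI[of _ p]) (simp add: R_def p_p)
  ultimately have "card L = card R + card (crossing k)" by (simp add: card_image)
  then show ?thesis using north south L R by (simp add: count_upto_def)
qed

abbreviation "ca \<equiv> count_upto (northern_left n p)"
abbreviation "cb \<equiv> count_upto (southern_right n p)"

lemma finite_types [simp]: "finite (northern_left n p)" "finite (southern_right n p)" "finite (northern_right n p)" "finite (southern_left n p)"
    by (auto simp: northern_left_def southern_right_def northern_right_def southern_left_def)

lemma cb_le_ca: "cb k \<le> ca k"
  using count_crossing[of k] by (smt (verit) of_nat_0_le_iff)

lemma cb_less_ca_iff: "cb k < ca k \<longleftrightarrow> crossing k \<noteq> {}"
proof -
  have "finite (crossing k)" by (simp add: crossing_def)
  then have "0 < int (card (crossing k)) \<longleftrightarrow> crossing k \<noteq> {}" by (simp add: card_gt_0_iff)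
  moreover have "cb k < ca k \<longleftrightarrow> 0 < 2 * (ca k - cb k)" by simp
  ultimately show ?thesis using count_crossing[of k] by metis
qed

lemma cb_less_ca_range: "cb k < ca k \<Longrightarrow> 0 < k \<and> k < int n"
  unfolding cb_less_ca_iff crossing_def using position_in_vertices position_p by force

lemma northern_left_less: "k \<in> northern_left n p \<Longrightarrow> cb (int k) < ca (int k)"
  unfolding cb_less_ca_iff by (auto simp: crossing_def northern_left_def intro!: exI[of _ "Northern k"])

lemma southern_left_less: "k \<in> southern_left n p \<Longrightarrow> cb (int k) < ca (int k)"
  unfolding cb_less_ca_iff by (auto simp: crossing_def southern_left_def intro!: exI[of _ "Southern k"])

lemma northern_right_less: "k \<in> northern_right n p \<Longrightarrow> cb (int k - 1) < ca (int k - 1)"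
  unfolding cb_less_ca_iff
  by (auto simp: crossing_def northern_right_def p_in p_p intro!: exI[of _ "p (Northern k)"])

lemma southern_right_less: "k \<in> southern_right n p \<Longrightarrow> cb (int k - 1) < ca (int k - 1)"
  unfolding cb_less_ca_iff
  by (auto simp: crossing_def southern_right_def p_in p_p intro!: exI[of _ "p (Southern k)"])

lemma abs_line: "\<bar>line x\<bar> = int (position x)"
  by (cases x) auto

text \<open>On \<open>line\<close> a vertical edge occupies \<open>- k\<close> and \<open>k\<close>,
  so it separates all positions below \<open>k\<close> from all positions above. A crossing edge
  would thus cross it. The count at \<open>k - 1\<close> agrees as well because position
  \<open>k\<close> contributes to neither set.\<close>

lemma vertical_crossing:
  assumes nc: "noncrossing n p" and k: "k \<in> {1..n}" "p (Northern k) = Southern k"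
  shows "ca (int k) = cb (int k)" "ca (int k - 1) = cb (int k - 1)"
proof -
  have "crossing (int k) = {}"
  proof (rule ccontr)
    assume "crossing (int k) \<noteq> {}"
    then obtain x where x: "x \<in> vertices n" "position x \<le> k" "k < position (p x)"
      by (auto simp: crossing_def)
    have "p (Southern k) = Northern k" using k p_p by (metis Northern_in_vertices atLeastAtMost_iff)
    then have "x \<noteq> Northern k" "x \<noteq> Southern k" using x k by auto
    then have "separates (line (Northern k)) (line (Southern k)) (line x) =
       separates (line (Northern k)) (line (Southern k)) (line (p x))"
      using nc k x unfolding noncrossing_def by (metis Northern_in_vertices atLeastAtMost_iff)
    moreover have "line x \<noteq> line (Northern k)" "line x \<noteq> line (Southern k)"
      using x k \<open>x \<noteq> Northern k\<close> \<open>x \<noteq> Southern k\<close> line_inj[OF x(1), of "Northern k"]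
        line_inj[OF x(1), of "Southern k"] by auto
    ultimately show False
      using abs_line[of x] abs_line[of "p x"] x by (auto simp: separates_def)
  qed
  then show "ca (int k) = cb (int k)" using cb_less_ca_iff cb_le_ca by (metis order_le_less)
  moreover have "k \<notin> northern_left n p" "k \<notin> southern_right n p"
    using k vertical_iff[OF k(1)] by (auto simp: northern_left_def southern_right_def)
  ultimately show "ca (int k - 1) = cb (int k - 1)"
    using count_upto_pred[of "northern_left n p" "int k"] count_upto_pred[of "southern_right n p" "int k"]
    by (auto split: if_splits)
qed

text \<open>Vertical edges are visible in the two sets alone. Hence so is the kind of every vertex,
  which \<open>right_iff\<close> and \<open>left_iff\<close> spell out.\<close>

lemma vertical_iff_counts:
  assumes nc: "noncrossing n p" and k: "k \<in> {1..n}"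
  shows "p (Northern k) = Southern k \<longleftrightarrow>
    k \<notin> northern_left n p \<and> k \<notin> southern_right n p \<and> ca (int k) = cb (int k)"
proof
  assume v: "p (Northern k) = Southern k"
  then show "k \<notin> northern_left n p \<and> k \<notin> southern_right n p \<and> ca (int k) = cb (int k)"
    using vertical_iff[OF k] vertical_crossing[OF nc k]
    by (auto simp: northern_left_def southern_right_def)
next
  assume a: "k \<notin> northern_left n p \<and> k \<notin> southern_right n p \<and> ca (int k) = cb (int k)"
  then have "k \<notin> southern_left n p" using southern_left_less by force
  then show "p (Northern k) = Southern k"
    using a k vertical_iff(2)[OF k] by (auto simp: southern_left_def southern_right_def)
qed

lemma right_iff:
  assumes "noncrossing n p" "x \<in> vertices n"
  shows "position (p x) < position x \<longleftrightarrow> (case x of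
      Northern k \<Rightarrow> k \<notin> northern_left n p \<and> \<not> (k \<notin> southern_right n p \<and> ca (int k) = cb (int k))
    | Southern k \<Rightarrow> k \<in> southern_right n p)"
proof (cases x)
  case (Northern k)
  then have k: "k \<in> {1..n}" using assms by auto
  show ?thesis using Northern vertical_iff_counts[OF assms(1) k] vertical_iff[OF k] k
    by (auto simp: northern_left_def)
next
  case (Southern k)
  then show ?thesis using assms by (auto simp: southern_right_def)
qed

lemma left_iff:
  assumes "noncrossing n p" "x \<in> vertices n"
  shows "position x < position (p x) \<longleftrightarrow> (case x of
      Southern k \<Rightarrow> k \<notin> southern_right n p \<and> \<not> (k \<notin> northern_left n p \<and> ca (int k) = cb (int k))
    | Northern k \<Rightarrow> k \<in> northern_left n p)"
proof (cases x)
  case (Southern k)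
  then have k: "k \<in> {1..n}" using assms by auto
  show ?thesis using Southern vertical_iff_counts[OF assms(1) k] vertical_iff[OF k] k
    by (auto simp: southern_right_def)
next
  case (Northern k)
  then show ?thesis using assms by (auto simp: northern_left_def)
qed

end

text \<open>Both pairings have the same right endpoints. Taking these from left to right, each must
  be joined to the nearest left endpoint still free, nearness being measured along the boundary of
  the part of the strip to its left. Left endpoints then follow through their partners, and vertical
  edges from the positions.\<close>

lemma noncrossing_unique:
  assumes "pairing n p" "pairing n q" and nc: "noncrossing n p" "noncrossing n q"
    and eq: "northern_left n p = northern_left n q" "southern_right n p = southern_right n q"
    and x: "x \<in> vertices n"
  shows "p x = q x"
proof -
  interpret p: pairing n p by fact
  interpret q: pairing n q by fact
  have right: "position (p x) < position x \<longleftrightarrow> position (q x) < position x" if "x \<in> vertices n" for x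
    unfolding p.right_iff[OF nc(1) that] q.right_iff[OF nc(2) that] eq ..
  have left: "position x < position (p x) \<longleftrightarrow> position x < position (q x)" if "x \<in> vertices n" for x
    unfolding p.left_iff[OF nc(1) that] q.left_iff[OF nc(2) that] eq ..
  have *: "p v = q v" if "v \<in> vertices n" "position (p v) < position v" for v
    using that
  proof (induction "position v" arbitrary: v rule: less_induct)
    case less
    note v = less.prems
    show ?case
    proof (rule ccontr)
      assume neq: "p v \<noteq> q v"
      have qv: "position (q v) < position v" using right v by blast
      have uv: "p v \<in> vertices n" "q v \<in> vertices n" using v p.p_in q.p_in by auto
      define w where "w = p (q v)"
      define w' where "w' = q (p v)"
      have wv: "w \<in> vertices n" "w' \<in> vertices n" using uv p.p_in q.p_in by (auto simp: w_def w'_def)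
      have pp: "p w = q v" "q w' = p v" "p (p v) = v" "q (q v) = v"
        using p.p_p q.p_p uv v by (auto simp: w_def w'_def)
      have ne: "w \<noteq> v" "w' \<noteq> v" using pp neq by auto
      have "position (p v) < position (p (p v))" using v pp by simp
      then have "position (q w') < position w'" using left uv pp unfolding w'_def by metis
      have "position (q v) < position (q (q v))" using qv pp by simp
      then have "position (p w) < position w" using left uv pp unfolding w_def by metis
      \<comment> \<open>If \<open>w\<close> lay to the left of \<open>v\<close>, the induction
        hypothesis would give \<open>q w = p w = q v\<close> and hence \<open>w = v\<close>.\<close>
      have w: "position v \<le> position w"
        using less.hyps[of w] wv \<open>position (p w) < position w\<close> pp ne
        by (metis q.p_p not_le)
      have w': "position v \<le> position w'"
        using less.hyps[of w'] wv \<open>position (q w') < position w'\<close> pp ne right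
        by (metis p.p_p not_le)
      have "separates (line v) (line (p v)) (line w) = separates (line v) (line (p v)) (line (p w))"
        using nc(1)[unfolded noncrossing_def, rule_format, of v w] v wv ne pp qv by (metis less_irrefl)
      moreover have "separates (line v) (line (q v)) (line w') = separates (line v) (line (q v)) (line (q w'))"
        using nc(2)[unfolded noncrossing_def, rule_format, of v w'] v wv ne pp by (metis less_irrefl)
      moreover have "line v \<noteq> line w" "line v \<noteq> line w'" "line (p v) \<noteq> line (q v)"
        using wv uv v ne neq line_inj by metis+
      moreover have "\<bar>line v\<bar> = int (position v)" "\<bar>line w\<bar> \<ge> int (position v)"
        "\<bar>line w'\<bar> \<ge> int (position v)" "\<bar>line (p v)\<bar> < int (position v)" "\<bar>line (q v)\<bar> < int (position v)"
        using v qv w w' p.abs_line by auto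
      \<comment> \<open>On \<open>line\<close>, \<open>p v\<close> and \<open>q v\<close> lie
        strictly within distance \<open>position v\<close> of 0, while \<open>w\<close> and
        \<open>w'\<close> do not. Hence noncrossing of \<open>p\<close> forces \<open>p v\<close> to
        be nearer to \<open>v\<close> than \<open>q v\<close> is, and noncrossing of
        \<open>q\<close> forces the opposite.\<close>
      ultimately show False
        unfolding separates_def min_def max_def pp by (smt (verit))
    qed
  qed
  consider "position (p x) < position x" | "position x < position (p x)" | "position (p x) = position x" by linarith
  then show ?thesis
  proof cases
    case 1 then show ?thesis using * x by blast
  next
    case 2
    then have "p (p x) = q (p x)" using *[of "p x"] x p.p_p p.p_in by simp
    then show ?thesis using x p.p_p p.p_in q.p_p by metis
  next
    case 3
    then have "position (q x) = position x" using left right x by (metis nat_neq_iff)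
    then show ?thesis using 3 p.p_neq[OF x] q.p_neq[OF x] position_eq_iff_vertex
      by metis
  qed
qed

section \<open>Planarity\<close>

text \<open>This is \<open>fashoda_interlace\<close> carried from \<open>real^2\<close> to the
  complex plane. Compactness of the two images supplies the box, whose lower side lies on the real
  axis.\<close>

lemma arcs_interlacing_meet:
  fixes f g :: "real \<Rightarrow> complex"
  assumes "path f" "path g"
    and up: "\<And>z. z \<in> path_image f \<union> path_image g \<Longrightarrow> 0 \<le> Im z"
    and ends: "pathstart f = complex_of_real a" "pathfinish f = complex_of_real b"
      "pathstart g = complex_of_real c" "pathfinish g = complex_of_real d"
    and "a < c" "c < b" "b < d"
  shows "path_image f \<inter> path_image g \<noteq> {}"
proof -
  define \<phi> :: "complex \<Rightarrow> real^2" where "\<phi> z = Re z *\<^sub>R axis 1 1 + Im z *\<^sub>R axis 2 1" for z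
  have \<phi>: "\<phi> z $ 1 = Re z" "\<phi> z $ 2 = Im z" for z
    by (simp_all add: \<phi>_def axis_def)
  have inj: "inj \<phi>" by (metis \<phi> complex_eqI injI)
  have cont: "continuous_on S \<phi>" for S
    unfolding \<phi>_def by (intro continuous_intros)
  have "bounded (path_image f \<union> path_image g)"
    using assms by (simp add: bounded_path_image)
  then obtain M where M: "\<And>z. z \<in> path_image f \<union> path_image g \<Longrightarrow> norm z \<le> M"
    unfolding bounded_iff by auto
  have box: "\<phi> ` (path_image f \<union> path_image g) \<subseteq> cbox (vector [-M, 0]) (vector [M, M])"
  proof clarify
    fix z assume z: "z \<in> path_image f \<union> path_image g"
    have "\<bar>Re z\<bar> \<le> M" "\<bar>Im z\<bar> \<le> M"
      using M[OF z] abs_Re_le_cmod[of z] abs_Im_le_cmod[of z] by auto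
    then show "\<phi> z \<in> cbox (vector [-M, 0]) (vector [M, M])"
      using up[OF z] by (auto simp: mem_box_cart forall_2 \<phi>)
  qed
  obtain w where "w \<in> path_image (\<phi> \<circ> f)" "w \<in> path_image (\<phi> \<circ> g)"
  proof (rule fashoda_interlace[of "\<phi> \<circ> f" "\<phi> \<circ> g" "vector [-M, 0]" "vector [M, M]"])
    show "path (\<phi> \<circ> f)" "path (\<phi> \<circ> g)"
      using assms cont by (auto intro: path_continuous_image)
    show "path_image (\<phi> \<circ> f) \<subseteq> cbox (vector [-M, 0]) (vector [M, M])"
      "path_image (\<phi> \<circ> g) \<subseteq> cbox (vector [-M, 0]) (vector [M, M])"
      using box by (auto simp: path_image_compose)
  qed (use assms in \<open>auto simp: pathstart_compose pathfinish_compose \<phi>\<close>)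
  then show ?thesis using inj by (auto simp: path_image_compose dest: injD)
qed

definition strip :: "complex set" where
  "strip = {z. 0 \<le> Im z \<and> Im z \<le> 1}"

definition strip_exp :: "complex \<Rightarrow> complex" where
  "strip_exp z = exp (complex_of_real pi * z)"

fun boundary_point :: "vertex \<Rightarrow> real" where
  "boundary_point (Northern k) = - exp (pi * real k)"
| "boundary_point (Southern k) = exp (pi * real k)"

text \<open>The reason for the definition of \<open>line\<close>: it is the order in which the
  exponential places the vertices on the real axis.\<close>

lemma boundary_point_less_iff:
  assumes "x \<in> vertices n" "y \<in> vertices n"
  shows "boundary_point x < boundary_point y \<longleftrightarrow> line x < line y"
proof -
  have "- exp a < exp b" "\<not> exp b < - exp a" for a b :: real
    using exp_gt_zero[of a] exp_gt_zero[of b] by linarith+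
  then show ?thesis using assms by (auto simp: vertices_def)
qed

lemma boundary_point_inj: "x \<in> vertices n \<Longrightarrow> y \<in> vertices n \<Longrightarrow> boundary_point x = boundary_point y \<longleftrightarrow> x = y"
  by (metis boundary_point_less_iff line_inj linorder_neq_iff)

lemma boundary_point_nonzero: "boundary_point x \<noteq> 0"
  by (cases x) auto

lemma strip_exp_vertex_point: "strip_exp (vertex_point v) = complex_of_real (boundary_point v)"
proof (cases v)
  case (Northern k)
  have "of_real pi * Complex (real k) 1 = complex_of_real (pi * real k) + \<i> * of_real pi"
    by (simp add: complex_eq_iff)
  then show ?thesis using Northern by (simp add: strip_exp_def exp_add exp_pi_i' flip: exp_of_real)
next
  case (Southern k)
  have "of_real pi * Complex (real k) 0 = complex_of_real (pi * real k)"
    by (simp add: complex_eq_iff)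
  then show ?thesis using Southern by (simp add: strip_exp_def flip: exp_of_real)
qed

lemma vertex_point_in_strip: "vertex_point v \<in> strip"
  by (cases v) (auto simp: strip_def)

text \<open>The strip has height 1, so after scaling by \<open>pi\<close> imaginary parts differ by
  at most \<open>pi\<close>, less than the period \<open>2 * pi\<close>.\<close>

lemma inj_on_strip_exp: "inj_on strip_exp strip"
proof (rule inj_onI)
  fix z w assume zw: "z \<in> strip" "w \<in> strip" "strip_exp z = strip_exp w"
  have "\<bar>Im z - Im w\<bar> \<le> 1" using zw by (auto simp: strip_def)
  then have "pi * \<bar>Im z - Im w\<bar> < 2 * pi"
    using pi_gt_zero by (smt (verit) mult_left_le)
  then have "\<bar>Im (of_real pi * z) - Im (of_real pi * w)\<bar> < 2 * pi"
    by (simp add: abs_mult flip: right_diff_distrib)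
  then have "of_real pi * z = of_real pi * w"
    using zw(3) exp_complex_eqI unfolding strip_exp_def by blast
  then show "z = w" by simp
qed

lemma Im_strip_exp:
  assumes "z \<in> strip" shows "0 \<le> Im (strip_exp z)"
proof -
  have "0 \<le> pi * Im z" "pi * Im z \<le> pi" using assms by (auto simp: strip_def)
  then show ?thesis by (simp add: strip_exp_def Im_exp sin_ge_zero)
qed

lemma planar_not_interlaced:
  assumes d: "d \<in> matchings n" "planar d" and ab: "{a, b} \<in> d" and ce: "{c, e} \<in> d"
    and "line a < line c" "line c < line b" "line b < line e"
  shows False
proof -
  have v: "a \<in> vertices n" "b \<in> vertices n" "c \<in> vertices n" "e \<in> vertices n"
    using edge_iff_partner[OF d(1)] partner_in_vertices[OF d(1)] ab ce by auto
  obtain \<gamma> :: "vertex set \<Rightarrow> real \<Rightarrow> complex" where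
    \<gamma>: "\<forall>e\<in>d. arc (\<gamma> e) \<and> {pathstart (\<gamma> e), pathfinish (\<gamma> e)} = vertex_point ` e \<and>
            path_image (\<gamma> e) \<subseteq> strip"
    and disj: "\<forall>e\<in>d. \<forall>e'\<in>d. e \<noteq> e' \<longrightarrow> path_image (\<gamma> e) \<inter> path_image (\<gamma> e') = {}"
    using d(2) unfolding planar_def strip_def[symmetric] by (elim exE conjE) (rule that)
  note \<gamma> = \<gamma>[rule_format]
  have oriented: "\<exists>f. path f \<and> path_image f = strip_exp ` path_image (\<gamma> {x, y}) \<and>
      pathstart f = complex_of_real (boundary_point x) \<and> pathfinish f = complex_of_real (boundary_point y)"
    if "{x, y} \<in> d" for x y
  proof -
    \<comment> \<open>\<open>planar\<close> prescribes only the set of the two ends of an arc, so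
      the arc may have to be reversed to start at \<open>x\<close>.\<close>
    define g where "g = (if pathstart (\<gamma> {x, y}) = vertex_point x \<and> pathfinish (\<gamma> {x, y}) = vertex_point y
      then \<gamma> {x, y} else reversepath (\<gamma> {x, y}))"
    have "{pathstart (\<gamma> {x, y}), pathfinish (\<gamma> {x, y})} = {vertex_point x, vertex_point y}"
      using \<gamma>[OF that] by simp
    then have g: "pathstart g = vertex_point x" "pathfinish g = vertex_point y"
      by (auto simp: g_def doubleton_eq_iff)
    have g': "path g" "path_image g = path_image (\<gamma> {x, y})"
      using \<gamma>[OF that] by (auto simp: g_def arc_imp_path)
    have "path (strip_exp \<circ> g)"
      by (rule path_continuous_image[OF g'(1)]) (auto simp: strip_exp_def intro!: continuous_intros)
    then show ?thesis
      using g g' by (intro exI[of _ "strip_exp \<circ> g"])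
        (simp add: path_image_compose pathstart_compose pathfinish_compose strip_exp_vertex_point)
  qed
  obtain f where f: "path f" "path_image f = strip_exp ` path_image (\<gamma> {a, b})"
      "pathstart f = complex_of_real (boundary_point a)" "pathfinish f = complex_of_real (boundary_point b)"
    using oriented[OF ab] by blast
  obtain g where g: "path g" "path_image g = strip_exp ` path_image (\<gamma> {c, e})"
      "pathstart g = complex_of_real (boundary_point c)" "pathfinish g = complex_of_real (boundary_point e)"
    using oriented[OF ce] by blast
  have sub: "path_image f \<subseteq> strip_exp ` strip" "path_image g \<subseteq> strip_exp ` strip"
    unfolding f(2) g(2) using \<gamma>[OF ab] \<gamma>[OF ce] by (simp_all add: image_mono)
  have "path_image f \<inter> path_image g \<noteq> {}"
  proof (rule arcs_interlacing_meet[OF f(1) g(1) _ f(3,4) g(3,4)])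
    show "0 \<le> Im z" if "z \<in> path_image f \<union> path_image g" for z
      using that sub Im_strip_exp by blast
  qed (simp_all add: assms v boundary_point_less_iff[of _ n])
  then obtain z w where "z \<in> path_image (\<gamma> {a, b})" "w \<in> path_image (\<gamma> {c, e})" "strip_exp z = strip_exp w"
    unfolding f(2) g(2) by auto
  moreover from this have "z = w"
    using \<gamma>[OF ab] \<gamma>[OF ce] inj_onD[OF inj_on_strip_exp, of z w] by (simp add: subset_iff)
  ultimately have "path_image (\<gamma> {a, b}) \<inter> path_image (\<gamma> {c, e}) \<noteq> {}" by blast
  then have "{a, b} = {c, e}" using disj[rule_format, OF ab ce] by argo
  then show False using assms by (auto simp: doubleton_eq_iff)
qed

lemma planar_imp_noncrossing:
  assumes d: "d \<in> matchings n" "planar d"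
  shows "noncrossing n (partner d)"
  unfolding noncrossing_def
proof (intro ballI impI)
  fix x y assume x: "x \<in> vertices n" and y: "y \<in> vertices n" and "y \<noteq> x" "y \<noteq> partner d x"
  define x' where "x' = partner d x"
  define y' where "y' = partner d y"
  have e: "{x, x'} \<in> d" "{x', x} \<in> d" "{y, y'} \<in> d" "{y', y} \<in> d"
    using partner_edge[OF d(1)] x y by (auto simp: x'_def y'_def insert_commute)
  note no = planar_not_interlaced[OF d]
  have "y' \<noteq> x" "y' \<noteq> x'" "x' \<in> vertices n" "y' \<in> vertices n"
    using \<open>y \<noteq> x\<close> \<open>y \<noteq> partner d x\<close> x y d partner_partner partner_in_vertices unfolding x'_def y'_def by metis+
  then have ne: "line y' \<noteq> line x" "line y' \<noteq> line x'" "line y \<noteq> line x" "line y \<noteq> line x'"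
    using x y \<open>y \<noteq> x\<close> \<open>y \<noteq> partner d x\<close> line_inj unfolding x'_def by metis+
  \<comment> \<open>Should \<open>w\<close> fall outside the interval spanned by the edge of
    \<open>x\<close>, the edges \<open>{l, h}\<close> and \<open>{z, w}\<close> would interlace in
    one of two orders.\<close>
  have step: "separates (line x) (line x') (line w)"
    if sep: "separates (line x) (line x') (line z)" and zw: "{z, w} \<in> d" "{w, z} \<in> d"
      and w: "line w \<noteq> line x" "line w \<noteq> line x'" for z w
  proof -
    obtain l h where lh: "{l, h} \<in> d" "line l = min (line x) (line x')" "line h = max (line x) (line x')"
      using e by (metis max_def min_def)
    have "line l < line z" "line z < line h" using sep lh unfolding separates_def by auto
    moreover have "\<not> line w < line l" using no[OF zw(2) lh(1)] calculation by blast
    moreover have "\<not> line h < line w" using no[OF lh(1) zw(1)] calculation by blast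
    moreover have "line w \<noteq> line l" "line w \<noteq> line h" using w lh by (auto simp: min_def max_def)
    ultimately show ?thesis using lh unfolding separates_def by linarith
  qed
  show "separates (line x) (line (partner d x)) (line y) = separates (line x) (line (partner d x)) (line (partner d y))"
    using step[of y y'] step[of y' y] e ne unfolding x'_def y'_def by blast
qed

section \<open>Explicit disjoint arcs for a noncrossing matching\<close>

definition semicircle :: "real \<Rightarrow> real \<Rightarrow> real \<Rightarrow> complex" where
  "semicircle a b t = Complex ((a + b) / 2 - (b - a) / 2 * cos (pi * t)) ((b - a) / 2 * sin (pi * t))"

text \<open>The altitude theorem in the half disc over the diameter from \<open>a\<close> to
  \<open>b\<close>. It turns the comparison of two semicircles at the same abscissa into a
  comparison of products.\<close>

lemma semicircle_equation:
  "(Im (semicircle a b t))\<^sup>2 = (Re (semicircle a b t) - a) * (b - Re (semicircle a b t))"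
  unfolding semicircle_def complex.sel power_mult_distrib sin_squared_eq
  by (simp add: field_simps power2_eq_square)

lemma Re_semicircle:
  assumes "a < b"
  shows "a \<le> Re (semicircle a b t)" "Re (semicircle a b t) \<le> b"
proof -
  have "(b - a) / 2 * cos (pi * t) \<le> (b - a) / 2 * 1" "(b - a) / 2 * (-1) \<le> (b - a) / 2 * cos (pi * t)"
    using assms by (intro mult_left_mono; simp)+
  then show "a \<le> Re (semicircle a b t)" "Re (semicircle a b t) \<le> b"
    unfolding semicircle_def by (simp_all add: field_simps)
qed

lemma Im_semicircle:
  assumes "a < b" "t \<in> {0..1}"
  shows "0 \<le> Im (semicircle a b t)"
proof -
  have "0 \<le> sin (pi * t)" using assms by (intro sin_ge_zero) (auto simp: mult_left_le)
  then show ?thesis using assms by (simp add: semicircle_def)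
qed

lemma semicircle_nonzero:
  assumes "a \<noteq> 0" "b \<noteq> 0"
  shows "semicircle a b t \<noteq> 0"
proof
  assume "semicircle a b t = 0"
  then show False using semicircle_equation[of a b t] assms by simp
qed

lemma semicircle_inj:
  assumes "a < b"
  shows "inj_on (semicircle a b) {0..1}"
proof (rule inj_onI)
  fix s t :: real assume st: "s \<in> {0..1}" "t \<in> {0..1}" "semicircle a b s = semicircle a b t"
  then have "cos (pi * s) = cos (pi * t)" using assms by (simp add: semicircle_def)
  moreover have "pi * s \<in> {0..pi}" "pi * t \<in> {0..pi}" using st by (auto simp: mult_left_le)
  ultimately have "pi * s = pi * t" using cos_inj_pi[of "pi * s" "pi * t"] by (simp only: atLeastAtMost_iff)
  then show "s = t" by simp
qed

text \<open>A right inverse of \<open>strip_exp\<close>. Multiplication by \<open>- \<i>\<close>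
  turns the closed upper half plane into the closed right half plane, whose only point on the branch
  cut of \<open>Ln\<close> is 0; the angle then lies between \<open>- pi / 2\<close> and
  \<open>pi / 2\<close>, and the summand \<open>\<i> / 2\<close> moves the result into the
  strip.\<close>

definition strip_log :: "complex \<Rightarrow> complex" where
  "strip_log w = Ln (- \<i> * w) / of_real pi + \<i> / 2"

lemma strip_exp_log: "w \<noteq> 0 \<Longrightarrow> strip_exp (strip_log w) = w"
proof -
  assume w: "w \<noteq> 0"
  have "complex_of_real pi * strip_log w = Ln (- \<i> * w) + \<i> * (of_real pi / 2)"
    unfolding strip_log_def by (simp add: field_simps)
  moreover have "exp (\<i> * (complex_of_real pi / 2)) = \<i>"
    by (metis exp_pi_i' cis_conv_exp cis_pi_half of_real_divide of_real_numeral)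
  ultimately have "strip_exp (strip_log w) = exp (Ln (- \<i> * w)) * \<i>"
    unfolding strip_exp_def by (simp only: exp_add)
  moreover have "exp (Ln (- \<i> * w)) = - \<i> * w" using w by (intro exp_Ln) simp
  ultimately show ?thesis by (simp add: complex_eq_iff)
qed

lemma strip_log_in_strip:
  assumes "w \<noteq> 0" "0 \<le> Im w"
  shows "strip_log w \<in> strip"
proof -
  have "\<bar>Im (Ln (- \<i> * w))\<bar> \<le> pi / 2"
    using Re_Ln_pos_le[of "- \<i> * w"] assms by simp
  then have "\<bar>Im (Ln (- \<i> * w)) / pi\<bar> \<le> 1 / 2"
    by (simp add: abs_divide field_simps)
  moreover have "Im (strip_log w) = Im (Ln (- \<i> * w)) / pi + 1 / 2"
    by (simp add: strip_log_def)
  ultimately show ?thesis unfolding strip_def mem_Collect_eq by linarith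
qed

definition strip_arc :: "real \<Rightarrow> real \<Rightarrow> real \<Rightarrow> complex" where
  "strip_arc a b = strip_log \<circ> semicircle a b"

lemma strip_arc:
  assumes "a < b" "a \<noteq> 0" "b \<noteq> 0"
  shows "arc (strip_arc a b)"
    and "path_image (strip_arc a b) \<subseteq> strip"
    and "strip_exp (strip_arc a b t) = semicircle a b t"
proof -
  note nz = semicircle_nonzero[OF assms(2,3)]
  show e: "strip_exp (strip_arc a b t) = semicircle a b t" for t
    using strip_exp_log nz by (simp add: strip_arc_def)
  show "path_image (strip_arc a b) \<subseteq> strip"
    using strip_log_in_strip nz Im_semicircle[OF assms(1)] by (auto simp: path_image_def strip_arc_def)
  \<comment> \<open>The real part of \<open>- \<i> * w\<close> is \<open>Im w\<close>, which is
    nonnegative here, so only \<open>w = 0\<close> could meet the branch cut.\<close>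
  have "- \<i> * semicircle a b t \<notin> \<real>\<^sub>\<le>\<^sub>0" if "t \<in> {0..1}" for t
  proof
    assume h: "- \<i> * semicircle a b t \<in> \<real>\<^sub>\<le>\<^sub>0"
    then have "Re (- \<i> * semicircle a b t) \<le> 0" "Im (- \<i> * semicircle a b t) = 0"
      by (auto simp: complex_nonpos_Reals_iff)
    then have "semicircle a b t = 0" using Im_semicircle[OF assms(1) that] by (simp add: complex_eq_iff)
    then show False using nz by blast
  qed
  then have "continuous_on {0..1} (strip_arc a b)"
    unfolding strip_arc_def comp_def strip_log_def semicircle_def Complex_eq
    by (intro continuous_intros) (auto simp: semicircle_def Complex_eq)
  moreover have "inj_on (strip_arc a b) {0..1}"
    using semicircle_inj[OF assms(1)] e unfolding inj_on_def by metis
  ultimately show "arc (strip_arc a b)" by (simp add: arc_def path_def)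
qed

lemma strip_arc_ends:
  assumes "x \<in> vertices n" "y \<in> vertices n" "boundary_point x < boundary_point y"
  shows "pathstart (strip_arc (boundary_point x) (boundary_point y)) = vertex_point x"
    and "pathfinish (strip_arc (boundary_point x) (boundary_point y)) = vertex_point y"
proof -
  let ?g = "strip_arc (boundary_point x) (boundary_point y)"
  note g = strip_arc[OF assms(3) boundary_point_nonzero boundary_point_nonzero]
  have "strip_exp (pathstart ?g) = strip_exp (vertex_point x)" "strip_exp (pathfinish ?g) = strip_exp (vertex_point y)"
    unfolding pathstart_def pathfinish_def g(3) strip_exp_vertex_point
    by (auto simp: semicircle_def complex_eq_iff field_simps)
  then show "pathstart ?g = vertex_point x" "pathfinish ?g = vertex_point y"
    using inj_onD[OF inj_on_strip_exp] vertex_point_in_strip g(2) pathstart_in_path_image pathfinish_in_path_image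
    by blast+
qed

text \<open>At a common point the abscissa lies over both diameters. This is impossible for disjoint
  diameters; for nested ones both factors of the inner product are strictly smaller than those of
  the outer one.\<close>

lemma semicircles_disjoint:
  assumes "a < b" "c < d" "b < c \<or> d < a \<or> a < c \<and> d < b \<or> c < a \<and> b < d"
  shows "semicircle a b s \<noteq> semicircle c d t"
proof
  assume eq: "semicircle a b s = semicircle c d t"
  define x where "x = Re (semicircle a b s)"
  have x: "a \<le> x" "x \<le> b" "c \<le> x" "x \<le> d"
    using Re_semicircle[OF assms(1), of s] Re_semicircle[OF assms(2), of t] eq by (auto simp: x_def)
  have "(x - a) * (b - x) = (x - c) * (d - x)"
    using semicircle_equation[of a b s] semicircle_equation[of c d t] eq by (simp add: x_def)
  moreover have "(x - c) * (d - x) < (x - a) * (b - x)" if "a < c" "d < b"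
    using that x by (intro mult_strict_mono') auto
  moreover have "(x - a) * (b - x) < (x - c) * (d - x)" if "c < a" "b < d"
    using that x by (intro mult_strict_mono') auto
  ultimately show False using assms x by linarith
qed

lemma noncrossing_imp_planar:
  assumes d: "d \<in> matchings n" and nc: "noncrossing n (partner d)"
  shows "planar d"
proof -
  \<comment> \<open>An edge is an unordered set; \<open>Min\<close> and \<open>Max\<close> choose
    the left and right foot of its semicircle.\<close>
  define \<gamma> where "\<gamma> e = strip_arc (Min (boundary_point ` e)) (Max (boundary_point ` e))" for e
  have edge: "\<exists>x y. e = {x, y} \<and> x \<in> vertices n \<and> partner d x = y \<and> y \<in> vertices n \<and> partner d y = x \<and>
      boundary_point x < boundary_point y \<and> line x < line y \<and>
      \<gamma> e = strip_arc (boundary_point x) (boundary_point y)" if ed: "e \<in> d" for e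
  proof -
    have "e \<noteq> {}" using d ed by (auto simp: matchings_def)
    then obtain x0 where "x0 \<in> e" by auto
    then obtain y0 where xy0: "e = {x0, y0}" "x0 \<noteq> y0" "x0 \<in> vertices n" "y0 \<in> vertices n"
      using matchings_edge[OF d ed] by metis
    then obtain x y where xy: "e = {x, y}" "x \<in> vertices n" "y \<in> vertices n" "boundary_point x < boundary_point y"
      using boundary_point_inj[OF xy0(3,4)] by (metis insert_commute linorder_neq_iff)
    moreover have "partner d x = y" "partner d y = x"
      using ed xy edge_iff_partner[OF d] partner_partner[OF d] by auto
    moreover have "line x < line y" using xy boundary_point_less_iff by blast
    ultimately show ?thesis by (intro exI[of _ x] exI[of _ y]) (simp add: \<gamma>_def)
  qed
  have arcs: "arc (\<gamma> e) \<and> {pathstart (\<gamma> e), pathfinish (\<gamma> e)} = vertex_point ` e \<and> path_image (\<gamma> e) \<subseteq> strip"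
    if ed: "e \<in> d" for e
  proof -
    obtain x y where "e = {x, y}" "x \<in> vertices n" "y \<in> vertices n" "boundary_point x < boundary_point y"
      "\<gamma> e = strip_arc (boundary_point x) (boundary_point y)"
      using edge[OF ed] by blast
    then show ?thesis
      using strip_arc(1,2)[OF _ boundary_point_nonzero boundary_point_nonzero, of x y] strip_arc_ends[of x n y]
      by simp
  qed
  have disj: "path_image (\<gamma> e) \<inter> path_image (\<gamma> e') = {}" if ed: "e \<in> d" "e' \<in> d" "e \<noteq> e'" for e e'
  proof -
    obtain x y where e: "e = {x, y}" "x \<in> vertices n" "partner d x = y" "y \<in> vertices n" "partner d y = x"
      "boundary_point x < boundary_point y" "line x < line y" "\<gamma> e = strip_arc (boundary_point x) (boundary_point y)"
      using edge[OF ed(1)] by blast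
    obtain z w where e': "e' = {z, w}" "z \<in> vertices n" "partner d z = w" "w \<in> vertices n" "partner d w = z"
      "boundary_point z < boundary_point w" "line z < line w" "\<gamma> e' = strip_arc (boundary_point z) (boundary_point w)"
      using edge[OF ed(2)] by blast
    have ne: "x \<noteq> z" "x \<noteq> w" "y \<noteq> z" "y \<noteq> w" using ed(3) e(3,5) e'(3,5) unfolding e(1) e'(1) by (metis doubleton_eq_iff)+
    have "separates (line x) (line y) (line z) = separates (line x) (line y) (line w)"
      using nc[unfolded noncrossing_def, rule_format, OF e(2) e'(2)] ne e(3) e'(3) by simp
    moreover have "line x \<noteq> line z" "line x \<noteq> line w" "line y \<noteq> line z" "line y \<noteq> line w"
      using ne line_inj[of _ n] e(2,4) e'(2,4) by simp_all
    \<comment> \<open>Noncrossing edges span intervals that are disjoint or nested, which is the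
      hypothesis of \<open>semicircles_disjoint\<close>.\<close>
    ultimately have "line y < line z \<or> line w < line x \<or> line x < line z \<and> line w < line y \<or> line z < line x \<and> line y < line w"
      using e(7) e'(7) unfolding separates_def by auto
    then have "boundary_point y < boundary_point z \<or> boundary_point w < boundary_point x \<or>
        boundary_point x < boundary_point z \<and> boundary_point w < boundary_point y \<or>
        boundary_point z < boundary_point x \<and> boundary_point y < boundary_point w"
      using boundary_point_less_iff[of _ n] e(2,4) e'(2,4) by simp
    then have *: "semicircle (boundary_point x) (boundary_point y) s \<noteq> semicircle (boundary_point z) (boundary_point w) t" for s t
      using semicircles_disjoint[OF e(6) e'(6)] by simp
    have "\<gamma> e s \<noteq> \<gamma> e' t" for s t
      using strip_arc(3)[OF e(6) boundary_point_nonzero boundary_point_nonzero, of s]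
        strip_arc(3)[OF e'(6) boundary_point_nonzero boundary_point_nonzero, of t] *[of s t] e(8) e'(8) by auto
    then show ?thesis unfolding path_image_def by blast
  qed
  show ?thesis
    unfolding planar_def strip_def[symmetric]
  proof (intro exI[of _ \<gamma>] conjI[of "Ball d _"] ballI impI)
    show "path_image (\<gamma> e) \<inter> path_image (\<gamma> e') = {}" if "e \<in> d" "e' \<in> d" "e \<noteq> e'" for e e'
      using disj[OF that] .
  qed (fact arcs)
qed

lemma diagrams_iff: "d \<in> diagrams n \<longleftrightarrow> d \<in> matchings n \<and> noncrossing n (partner d)"
proof -
  have "d \<in> diagrams n \<longleftrightarrow> d \<in> matchings n \<and> planar d"
    unfolding diagrams_def matchings_def by simp
  then show ?thesis using planar_imp_noncrossing noncrossing_imp_planar by metis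
qed

section \<open>Products with a generator\<close>

lemma outer_in_stacked_iff:
  "outer v \<in> upper_copy ` vertices n \<union> lower_copy ` vertices n \<longleftrightarrow> v \<in> vertices n"
  by (cases v) (auto simp: vertices_def image_Un image_image)

text \<open>\<open>h\<close> sends every vertex of the stacked diagram to an outer vertex of the same component.\<close>

lemma stack_by_retraction:
  fixes h :: "stacked_vertex \<Rightarrow> vertex" and D1 D2 :: "vertex set set" and n :: nat
  defines "r \<equiv> {(x, y). {x, y} \<in> stacked_edges D1 D2}"
    and "V \<equiv> upper_copy ` vertices n \<union> lower_copy ` vertices n"
  assumes d: "pairing n q"
    and h_in: "\<And>x. x \<in> V \<Longrightarrow> h x \<in> vertices n"
    and h_outer: "\<And>v. v \<in> vertices n \<Longrightarrow> h (outer v) = v"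
    and edges: "\<And>x y. (x, y) \<in> r \<Longrightarrow> y \<in> V \<and> (h y = h x \<or> h y = q (h x))"
    and conn: "\<And>x. x \<in> V \<Longrightarrow> (outer (h x), x) \<in> r\<^sup>*"
    and conn': "\<And>v. v \<in> vertices n \<Longrightarrow> (outer v, outer (q v)) \<in> r\<^sup>*"
  shows "stack n D1 D2 = matching_of n q" "loops n D1 D2 = 0"
proof -
  interpret pairing n q by fact
  have "sym r" by (auto simp: r_def sym_def insert_commute)
  then have sym: "(x, y) \<in> r\<^sup>* \<Longrightarrow> (y, x) \<in> r\<^sup>*" for x y by (meson symD sym_rtrancl)
  have outer_V: "outer v \<in> V \<longleftrightarrow> v \<in> vertices n" for v
    unfolding V_def by (rule outer_in_stacked_iff)
  \<comment> \<open>A component is the preimage under \<open>h\<close> of one edge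
    \<open>{h x, q (h x)}\<close>: \<open>edges\<close> keeps a walk inside this preimage, while
    \<open>conn\<close> and \<open>conn'\<close> link any two of its elements through outer
    vertices.\<close>
  have comp: "r\<^sup>* `` {x} = {y \<in> V. h y = h x \<or> h y = q (h x)}" if x: "x \<in> V" for x
  proof
    have "y \<in> V \<and> (h y = h x \<or> h y = q (h x))" if "(x, y) \<in> r\<^sup>*" for y
      using that
    proof induction
      case base then show ?case using x by simp
    next
      case (step y z)
      then show ?case using edges[OF step.hyps(2)] p_p h_in x by metis
    qed
    then show "r\<^sup>* `` {x} \<subseteq> {y \<in> V. h y = h x \<or> h y = q (h x)}" by auto
    have "(x, y) \<in> r\<^sup>*" if y: "y \<in> V" "h y = h x \<or> h y = q (h x)" for y
    proof -
      have "(outer (h x), outer (h y)) \<in> r\<^sup>*" using y conn'[OF h_in[OF x]] by auto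
      then show ?thesis using sym[OF conn[OF x]] conn[OF y(1)] by (meson rtrancl_trans)
    qed
    then show "{y \<in> V. h y = h x \<or> h y = q (h x)} \<subseteq> r\<^sup>* `` {x}" by auto
  qed
  have quot: "stacked_components n D1 D2 = (\<lambda>x. r\<^sup>* `` {x}) ` V"
    unfolding stacked_components_def V_def[symmetric] r_def[symmetric] quotient_def by auto
  \<comment> \<open>Every component contains the outer vertex chosen by \<open>h\<close>, so no
    closed loop arises.\<close>
  have not_middle: "\<not> r\<^sup>* `` {x} \<subseteq> range Middle" if "x \<in> V" for x
  proof -
    have "outer (h x) \<in> r\<^sup>* `` {x}" using sym[OF conn[OF that]] by simp
    moreover have "outer (h x) \<notin> range Middle" by (cases "h x") auto
    ultimately show ?thesis by blast
  qed
  have "{C \<in> stacked_components n D1 D2. C \<subseteq> range Middle} = {}"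
    unfolding quot using not_middle by blast
  then show "loops n D1 D2 = 0" unfolding loops_def by (simp only: card.empty)
  have vim: "outer -` (r\<^sup>* `` {x}) = {h x, q (h x)}" if x: "x \<in> V" for x
    unfolding comp[OF x] using h_in[OF x] p_in[OF h_in[OF x]] outer_V h_outer by auto
  have "{C \<in> stacked_components n D1 D2. \<not> C \<subseteq> range Middle} = (\<lambda>x. r\<^sup>* `` {x}) ` V"
    unfolding quot using not_middle by blast
  then have "stack n D1 D2 = (\<lambda>x. {h x, q (h x)}) ` V"
    unfolding stack_def using vim by (simp add: image_image cong: image_cong)
  also have "\<dots> = (\<lambda>v. {v, q v}) ` h ` V" by (simp add: image_image)
  also have "h ` V = vertices n"
    using h_in h_outer outer_V by (force simp: image_iff)
  finally show "stack n D1 D2 = matching_of n q" by (simp add: matching_of_def)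
qed

fun reflection :: "vertex \<Rightarrow> vertex" where
  "reflection (Northern k) = Southern k"
| "reflection (Southern k) = Northern k"

lemma pairing_reflection: "pairing n reflection"
proof
  fix v show "v \<in> vertices n \<Longrightarrow> reflection v \<in> vertices n" "reflection (reflection v) = v" "reflection v \<noteq> v"
    by (cases v; simp)+
qed

lemma noncrossing_reflection: "noncrossing n reflection"
  unfolding noncrossing_def
proof (intro ballI impI)
  have line: "line (reflection v) = - line v" for v by (cases v) auto
  show "separates (line x) (line (reflection x)) (line y) = separates (line x) (line (reflection x)) (line (reflection y))" for x y
    unfolding line separates_def by (auto simp: min_def max_def)
qed

lemma identity_diagram_eq: "identity_diagram n = matching_of n reflection"
  by (auto simp: identity_diagram_def matching_of_def vertices_def insert_commute image_iff)

lemma generator_site: "1 \<le> i \<Longrightarrow> i < n \<Longrightarrow> surgery_site n reflection i"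
  by (simp add: surgery_site_def pairing_reflection surgery_site_axioms_def)

text \<open>This reads \<open>e\<^sub>i\<close> as \<open>e\<^sub>i\<close> times the identity
  diagram, so that planarity of the generators is an instance of
  \<open>noncrossing_surgery\<close>.\<close>

lemma generator_eq:
  assumes "1 \<le> i" "i < n"
  shows "generator n i = matching_of n (surgery i reflection)"
proof -
  interpret surgery_site n reflection i using assms by (rule generator_site)
  let ?g = "surgery i reflection"
  note g = surgery_simps[unfolded reflection.simps]
  show ?thesis
  proof
    show "generator n i \<subseteq> matching_of n ?g"
    proof
      fix e assume "e \<in> generator n i"
      then consider "e = {Northern i, Northern (Suc i)}" | "e = {Southern i, Southern (Suc i)}"
        | j where "1 \<le> j" "j \<le> n" "j \<noteq> i" "j \<noteq> Suc i" "e = {Northern j, Southern j}"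
        by (auto simp: generator_def)
      then have "\<exists>v\<in>vertices n. e = {v, ?g v}"
      proof cases
        case 1 then show ?thesis using g site by metis
      next
        case 2 then show ?thesis using g site by (metis reflection.simps(1))
      next
        case 3
        then have "?g (Northern j) = Southern j" using g(5)[of "Northern j"] by simp
        then show ?thesis using 3 by (metis Northern_in_vertices)
      qed
      then show "e \<in> matching_of n ?g" by (auto simp: matching_of_def)
    qed
    have "{v, ?g v} \<in> generator n i" if v: "v \<in> vertices n" for v
    proof (rule surgery_cases[of v, unfolded reflection.simps])
      assume o: "v \<noteq> Northern i" "v \<noteq> Northern (Suc i)" "v \<noteq> Southern i" "v \<noteq> Southern (Suc i)"
      then show ?thesis
        using g(5)[OF o] v by (cases v) (auto simp: generator_def insert_commute)
    qed (simp_all add: g generator_def insert_commute)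
    then show "matching_of n ?g \<subseteq> generator n i" by (auto simp: matching_of_def)
  qed
qed

lemma noncrossing_cong:
  assumes "pairing n p" "\<And>v. v \<in> vertices n \<Longrightarrow> p v = q v"
  shows "noncrossing n p \<longleftrightarrow> noncrossing n q"
  using assms(2) unfolding noncrossing_def by auto

lemma matching_of_diagram:
  assumes "pairing n p" "noncrossing n p"
  shows "matching_of n p \<in> diagrams n"
  using assms pairing.matching_of_in pairing.partner_matching_of noncrossing_cong[of n p "partner (matching_of n p)"]
  by (simp add: diagrams_iff)

context surgery_site
begin

lemma stack_surgery:
  "stack n (generator n i) (matching_of n p) = matching_of n (surgery i p)"
  "loops n (generator n i) (matching_of n p) = 0"
proof -
  define E where "E = stacked_edges (generator n i) (matching_of n p)"
  define r where "r = {(x, y). {x, y} \<in> E}"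
  define V where "V = upper_copy ` vertices n \<union> lower_copy ` vertices n"
  \<comment> \<open>A middle vertex other than \<open>i\<close> and \<open>Suc i\<close> hangs
    directly below its upper vertex. The remaining two are joined to each other by the lower arc of
    the generator, and leave through the lower diagram towards \<open>u\<close> and
    \<open>v\<close>.\<close>
  define h where "h x = (case x of Upper k \<Rightarrow> Northern k | Lower k \<Rightarrow> Southern k
    | Middle k \<Rightarrow> if k = i then u else if k = Suc i then v else Northern k)" for x
  have E: "e \<in> E \<longleftrightarrow> e = {Upper i, Upper (Suc i)} \<or> e = {Middle i, Middle (Suc i)} \<or>
      (\<exists>j. 1 \<le> j \<and> j \<le> n \<and> j \<noteq> i \<and> j \<noteq> Suc i \<and> e = {Upper j, Middle j}) \<or>
      (\<exists>a\<in>vertices n. e = {lower_copy a, lower_copy (p a)})" for e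
  proof -
    have "generator n i = {{Northern i, Northern (Suc i)}, {Southern i, Southern (Suc i)}} \<union>
        (\<lambda>j. {Northern j, Southern j}) ` {j. 1 \<le> j \<and> j \<le> n \<and> j \<noteq> i \<and> j \<noteq> Suc i}"
      by (auto simp: generator_def)
    then have "E = {{Upper i, Upper (Suc i)}, {Middle i, Middle (Suc i)}} \<union>
        (\<lambda>j. {Upper j, Middle j}) ` {j. 1 \<le> j \<and> j \<le> n \<and> j \<noteq> i \<and> j \<noteq> Suc i} \<union>
        (\<lambda>a. {lower_copy a, lower_copy (p a)}) ` vertices n"
      by (simp add: E_def stacked_edges_def matching_of_def image_Un image_image insert_commute)
    then show ?thesis by (simp add: image_iff Bex_def)
  qed
  have rsym: "(x, y) \<in> r \<Longrightarrow> (y, x) \<in> r" for x y by (simp add: r_def insert_commute)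
  have s1: "(Upper i, Upper (Suc i)) \<in> r" and s2: "(Middle i, Middle (Suc i)) \<in> r"
    and s3: "\<And>j. 1 \<le> j \<Longrightarrow> j \<le> n \<Longrightarrow> j \<noteq> i \<Longrightarrow> j \<noteq> Suc i \<Longrightarrow> (Upper j, Middle j) \<in> r"
    and s4: "\<And>a. a \<in> vertices n \<Longrightarrow> (lower_copy a, lower_copy (p a)) \<in> r"
    by (auto simp: r_def E)
  have h_lower: "h (lower_copy w) = w" if "w \<noteq> Northern i" "w \<noteq> Northern (Suc i)" for w
    using that by (cases w) (auto simp: h_def)
  have h_cup: "h (Middle i) = u" "h (Middle (Suc i)) = v"
    by (auto simp: h_def)
  have h_up: "h (Upper k) = Northern k" for k by (simp add: h_def)
  have lower_V: "lower_copy a \<in> V" if "a \<in> vertices n" for a using that by (simp add: V_def)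
  have V_iff: "Upper k \<in> V \<longleftrightarrow> 1 \<le> k \<and> k \<le> n" "Middle k \<in> V \<longleftrightarrow> 1 \<le> k \<and> k \<le> n" for k
    by (auto simp: V_def vertices_def image_Un image_image)
  have V_cases: "(\<exists>k. 1 \<le> k \<and> k \<le> n \<and> x \<in> {Upper k, Middle k, Lower k})" if "x \<in> V" for x
    using that by (auto simp: V_def vertices_def)
  have outer_lower: "(outer w, lower_copy w) \<in> r\<^sup>*"
    if "w \<in> vertices n" "w \<noteq> Northern i" "w \<noteq> Northern (Suc i)" for w
    using that s3 by (cases w) auto
  have lower_outer: "(lower_copy w, outer w) \<in> r\<^sup>*"
    if "w \<in> vertices n" "w \<noteq> Northern i" "w \<noteq> Northern (Suc i)" for w
    using that s3 rsym by (cases w) auto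
  have "(lower_copy u, Middle i) \<in> r" "(lower_copy v, Middle (Suc i)) \<in> r"
    using s4[of u] s4[of v] site site_distinct by simp_all
  then have um: "(outer u, Middle i) \<in> r\<^sup>*" "(Middle i, outer u) \<in> r\<^sup>*"
    and vm: "(outer v, Middle (Suc i)) \<in> r\<^sup>*" "(Middle (Suc i), outer v) \<in> r\<^sup>*"
    using outer_lower[of u] lower_outer[of u] outer_lower[of v] lower_outer[of v] site site_distinct rsym
    by (meson rtrancl_into_rtrancl converse_rtrancl_into_rtrancl)+
  have h_in: "h x \<in> vertices n" if "x \<in> V" for x
    using V_cases[OF that] site by (auto simp: h_def)
  have h_outer: "h (outer w) = w" for w
    by (cases w) (auto simp: h_def)
  \<comment> \<open>Each edge is treated in one orientation only. The third alternative, together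
    with the involution property of the surgery, serves the reverse orientation.\<close>
  have half: "h y = surgery i p (h x) \<or> h y = h x \<or> h x = surgery i p (h y)"
    "x \<in> V" "y \<in> V" if xy: "(x, y) \<in> {(Upper i, Upper (Suc i)), (Middle i, Middle (Suc i))} \<or>
      (\<exists>j. 1 \<le> j \<and> j \<le> n \<and> j \<noteq> i \<and> j \<noteq> Suc i \<and> x = Upper j \<and> y = Middle j) \<or>
      (\<exists>a\<in>vertices n. x = lower_copy a \<and> y = lower_copy (p a))" for x y
  proof -
    show "x \<in> V" "y \<in> V"
      using xy
      by (elim disjE exE bexE conjE; use i in \<open>auto simp: V_iff intro!: lower_V p_in\<close>)+
    show "h y = surgery i p (h x) \<or> h y = h x \<or> h x = surgery i p (h y)"
      using xy
    proof (elim disjE exE bexE conjE)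
      fix a assume a: "a \<in> vertices n" "x = lower_copy a" "y = lower_copy (p a)"
      show ?thesis
      proof (rule surgery_cases[of a])
        assume "a \<noteq> Northern i" "a \<noteq> Northern (Suc i)" "a \<noteq> u" "a \<noteq> v"
        then show ?thesis using a p_avoids[OF a(1)] h_lower surgery_simps(5) by metis
      qed (use a h_cup h_lower site_distinct in auto)
    qed (use h_cup h_up surgery_simps in \<open>auto simp: h_def\<close>)
  qed
  have edges: "y \<in> V \<and> (h y = h x \<or> h y = surgery i p (h x))" if "(x, y) \<in> r" for x y
  proof -
    have inv: "surgery i p (surgery i p w) = w" if "w \<in> vertices n" for w
      using pairing_surgery pairing.p_p that by blast
    let ?P = "\<lambda>x y. (x, y) \<in> {(Upper i, Upper (Suc i)), (Middle i, Middle (Suc i))} \<or>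
      (\<exists>j. 1 \<le> j \<and> j \<le> n \<and> j \<noteq> i \<and> j \<noteq> Suc i \<and> x = Upper j \<and> y = Middle j) \<or>
      (\<exists>a\<in>vertices n. x = lower_copy a \<and> y = lower_copy (p a))"
    have "{x, y} \<in> E" using that by (simp add: r_def)
    then have "?P x y \<or> ?P y x"
      unfolding E by (auto simp: doubleton_eq_iff)
    then show ?thesis
    proof
      assume P: "?P x y"
      show ?thesis using half[OF P] inv[OF h_in[OF half(3)[OF P]]] by metis
    next
      assume P: "?P y x"
      show ?thesis using half[OF P] inv[OF h_in[OF half(2)[OF P]]] by metis
    qed
  qed
  have conn: "(outer (h x), x) \<in> r\<^sup>*" if "x \<in> V" for x
    using V_cases[OF that] um vm r_into_rtrancl[OF s3] by (auto simp: h_def)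
  have conn': "(outer w, outer (surgery i p w)) \<in> r\<^sup>*" if w: "w \<in> vertices n" for w
  proof (rule surgery_cases[of w])
    assume o: "w \<noteq> Northern i" "w \<noteq> Northern (Suc i)" "w \<noteq> u" "w \<noteq> v"
    have "(outer w, lower_copy w) \<in> r\<^sup>*" using outer_lower[OF w o(1,2)] .
    also have "(lower_copy w, lower_copy (p w)) \<in> r\<^sup>*" using s4[OF w] by simp
    also have "(lower_copy (p w), outer (p w)) \<in> r\<^sup>*"
      using lower_outer[OF p_in[OF w] p_avoids(1,2)[OF w o]] .
    finally show ?thesis using surgery_simps(5)[OF o] by simp
  next
    assume w: "w = u"
    have "(outer u, Middle (Suc i)) \<in> r\<^sup>*" using um s2 by simp
    then show ?thesis using w vm surgery_simps by (metis rtrancl_trans)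
  next
    assume w: "w = v"
    have "(outer v, Middle i) \<in> r\<^sup>*" using vm rsym[OF s2] by simp
    then show ?thesis using w um surgery_simps by (metis rtrancl_trans)
  qed (use s1 rsym[OF s1] surgery_simps in auto)
  show "stack n (generator n i) (matching_of n p) = matching_of n (surgery i p)"
    "loops n (generator n i) (matching_of n p) = 0"
    using stack_by_retraction[of n "surgery i p" h "generator n i" "matching_of n p",
        folded E_def, folded r_def V_def, OF pairing_surgery h_in h_outer edges conn conn'] by blast+
qed

end

lemma finite_diagrams: "finite (diagrams n)"
proof (rule finite_subset)
  show "diagrams n \<subseteq> Pow (Pow (vertices n))"
    by (auto simp: diagrams_def partition_on_def)
qed simp

lemma tl_mult_basis:
  assumes "D1 \<in> diagrams n" "D2 \<in> diagrams n" "loops n D1 D2 = 0"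
  shows "tl_mult n (\<delta> :: 'k::comm_ring_1) (tl_basis D1) (tl_basis D2) = tl_basis (stack n D1 D2)"
proof
  fix D
  have inner: "(\<Sum>E2\<in>diagrams n. tl_basis D1 E1 * tl_basis D2 E2 * F E2) = tl_basis D1 E1 * F D2"
    for E1 and F :: "_ \<Rightarrow> 'k"
  proof -
    have "tl_basis D1 E1 * tl_basis D2 E2 * F E2 = (if E2 = D2 then tl_basis D1 E1 * F E2 else 0)" for E2
      by (simp add: tl_basis_def[of D2])
    then show ?thesis using assms(2) finite_diagrams[of n] by (simp add: sum.delta)
  qed
  have outer: "(\<Sum>E1\<in>diagrams n. tl_basis D1 E1 * F E1) = F D1" for F :: "_ \<Rightarrow> 'k"
  proof -
    have "tl_basis D1 E1 * F E1 = (if E1 = D1 then F E1 else 0)" for E1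
      by (simp add: tl_basis_def[of D1])
    then show ?thesis using assms(1) finite_diagrams[of n] by (simp add: sum.delta)
  qed
  show "tl_mult n \<delta> (tl_basis D1) (tl_basis D2) D = tl_basis (stack n D1 D2) D"
    unfolding tl_mult_def inner outer using assms(3) by simp
qed

text \<open>Distinct diagrams have distinct basis vectors because \<open>0 \<noteq> 1\<close> in
  \<open>comm_ring_1\<close>.\<close>

lemma tl_basis_inj: "tl_basis d = (tl_basis d' :: _ \<Rightarrow> 'k::comm_ring_1) \<longleftrightarrow> d = d'"
proof
  assume "tl_basis d = (tl_basis d' :: _ \<Rightarrow> 'k)"
  then have "tl_basis d d = (tl_basis d' d :: 'k)" by simp
  then show "d = d'" by (simp add: tl_basis_def split: if_splits)
qed simp

section \<open>Effect of a generator on the endpoint sets\<close>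

context surgery_site
begin

text \<open>Only positions are recorded, since the endpoint sets depend on nothing else about a
  partner.\<close>

lemma surgery_positions:
  obtains "x = Northern i" "position (surgery i p x) = Suc i" "position (p x) = position u"
  | "x = Northern (Suc i)" "position (surgery i p x) = i" "position (p x) = position v"
  | "x \<noteq> Northern i" "x \<noteq> Northern (Suc i)" "position x = position u"
    "position (surgery i p x) = position v" "position (p x) = i"
  | "x \<noteq> Northern i" "x \<noteq> Northern (Suc i)" "position x = position v"
    "position (surgery i p x) = position u" "position (p x) = Suc i"
  | "x \<noteq> Northern i" "x \<noteq> Northern (Suc i)" "x \<noteq> u" "x \<noteq> v" "position (surgery i p x) = position (p x)"
proof (rule surgery_cases[of x])
  assume x: "x = Northern i" then show ?thesis using that(1) surgery_simps(1) by simp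
next
  assume x: "x = Northern (Suc i)" then show ?thesis using that(2) surgery_simps(2) by simp
next
  assume x: "x = u" then show ?thesis using that(3) surgery_simps(3) site_distinct by simp
next
  assume x: "x = v" then show ?thesis using that(4) surgery_simps(4) site_distinct by simp
next
  assume x: "x \<noteq> Northern i" "x \<noteq> Northern (Suc i)" "x \<noteq> u" "x \<noteq> v"
  then show ?thesis using that(5) surgery_simps(5) by simp
qed

text \<open>The northern right endpoint at \<open>i\<close> moves to \<open>Suc i\<close>, and the
  left end \<open>u\<close> of its edge stays a left end, now joined to \<open>v\<close>. If
  \<open>Suc i\<close> was vertical, \<open>v\<close> becomes a southern right endpoint; this is why
  northern right and southern left endpoints are tracked here.\<close>

lemma surgery_types_shift:
  assumes "i \<in> northern_right n p" "Suc i \<notin> northern_right n p"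
  shows "northern_right n (surgery i p) = insert (Suc i) (northern_right n p - {i})"
    and "southern_left n (surgery i p) = southern_left n p"
proof -
  have u: "position u < i" and v: "Suc i \<le> position v"
    using assms i by (auto simp: northern_right_def)
  have "k \<in> northern_right n (surgery i p) \<longleftrightarrow> k \<in> insert (Suc i) (northern_right n p - {i})" for k
    by (rule surgery_positions[of "Northern k"])
      (use u v i in \<open>auto simp: northern_right_def\<close>)
  then show "northern_right n (surgery i p) = insert (Suc i) (northern_right n p - {i})" by blast
  have "k \<in> southern_left n (surgery i p) \<longleftrightarrow> k \<in> southern_left n p" for k
    by (rule surgery_positions[of "Southern k"])
      (use u v i in \<open>auto simp: southern_left_def\<close>)
  then show "southern_left n (surgery i p) = southern_left n p" by blast
qed

text \<open>Cutting the vertical edge at \<open>i\<close> makes \<open>Southern i\<close> a left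
  endpoint, because \<open>v\<close> does not lie to its left. In the shape this corresponds to a
  new row consisting of one box labeled \<open>i\<close>.\<close>

lemma surgery_types_new:
  assumes "u = Southern i" "Suc i \<notin> northern_right n p"
  shows "northern_right n (surgery i p) = insert (Suc i) (northern_right n p)"
    and "southern_left n (surgery i p) = insert i (southern_left n p)"
proof -
  have v: "Suc i \<le> position v" using assms(2) i by (auto simp: northern_right_def)
  have "k \<in> northern_right n (surgery i p) \<longleftrightarrow> k \<in> insert (Suc i) (northern_right n p)" for k
    by (rule surgery_positions[of "Northern k"])
      (use assms(1) v i in \<open>auto simp: northern_right_def\<close>)
  then show "northern_right n (surgery i p) = insert (Suc i) (northern_right n p)" by blast
  have "k \<in> southern_left n (surgery i p) \<longleftrightarrow> k \<in> insert i (southern_left n p)" for k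
    by (rule surgery_positions[of "Southern k"])
      (use assms(1) v i in \<open>auto simp: southern_left_def\<close>)
  then show "southern_left n (surgery i p) = insert i (southern_left n p)" by blast
qed

lemma surgery_dual_types_shift:
  assumes "Suc i \<in> northern_left n p" "i \<notin> northern_left n p"
  shows "northern_left n (surgery i p) = insert i (northern_left n p - {Suc i})"
    and "southern_right n (surgery i p) = southern_right n p"
proof -
  have u: "position u \<le> i" and v: "Suc i < position v"
    using assms i by (auto simp: northern_left_def)
  have "k \<in> northern_left n (surgery i p) \<longleftrightarrow> k \<in> insert i (northern_left n p - {Suc i})" for k
    by (rule surgery_positions[of "Northern k"])
      (use u v i in \<open>auto simp: northern_left_def\<close>)
  then show "northern_left n (surgery i p) = insert i (northern_left n p - {Suc i})" by blast
  have "k \<in> southern_right n (surgery i p) \<longleftrightarrow> k \<in> southern_right n p" for k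
    by (rule surgery_positions[of "Southern k"])
      (use u v i in \<open>auto simp: southern_right_def\<close>)
  then show "southern_right n (surgery i p) = southern_right n p" by blast
qed

lemma surgery_dual_types_new:
  assumes "v = Southern (Suc i)" "i \<notin> northern_left n p"
  shows "northern_left n (surgery i p) = insert i (northern_left n p)"
    and "southern_right n (surgery i p) = insert (Suc i) (southern_right n p)"
proof -
  have u: "position u \<le> i" using assms(2) i by (auto simp: northern_left_def)
  have "k \<in> northern_left n (surgery i p) \<longleftrightarrow> k \<in> insert i (northern_left n p)" for k
    by (rule surgery_positions[of "Northern k"])
      (use assms(1) u i in \<open>auto simp: northern_left_def\<close>)
  then show "northern_left n (surgery i p) = insert i (northern_left n p)" by blast
  have "k \<in> southern_right n (surgery i p) \<longleftrightarrow> k \<in> insert (Suc i) (southern_right n p)" for k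
    by (rule surgery_positions[of "Southern k"])
      (use assms(1) u i in \<open>auto simp: southern_right_def\<close>)
  then show "southern_right n (surgery i p) = insert (Suc i) (southern_right n p)" by blast
qed

end

context pairing
begin

text \<open>From left to right, a southern vertex cannot be joined to the left, where all vertices
  are already matched vertically, and is not a left endpoint. So the part of the diagram up to
  \<open>m\<close> is still the identity.\<close>

lemma vertical_left_end:
  assumes "\<And>l. l \<le> m \<Longrightarrow> l \<notin> northern_right n p \<and> l \<notin> southern_left n p"
    and "1 \<le> k" "k \<le> m" "m \<le> n"
  shows "p (Northern k) = Southern k"
  using assms(2,3)
proof (induction k rule: less_induct)
  case (less k)
  have k: "k \<in> {1..n}" using less.prems assms by auto
  then have Sk: "Southern k \<in> vertices n" by simp
  have "\<not> position (p (Southern k)) < k"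
  proof
    assume lt: "position (p (Southern k)) < k"
    define l where "l = position (p (Southern k))"
    have l: "1 \<le> l" using position_p[OF Sk] by (simp add: l_def)
    then have "p (Northern l) = Southern l" using less.IH lt less.prems l_def by simp
    moreover from this have "p (Southern l) = Northern l"
      using p_p[of "Northern l"] l lt k by (simp add: l_def)
    moreover have "p (Southern k) = Northern l \<or> p (Southern k) = Southern l"
      unfolding l_def by (cases "p (Southern k)") auto
    ultimately show False using p_p[OF Sk] lt l_def by auto
  qed
  moreover have "\<not> k < position (p (Southern k))"
    using assms(1)[of k] less.prems k by (auto simp: southern_left_def)
  ultimately show ?case using vertical_iff(2)[OF k] by simp
qed

lemma vertical_right_end:
  assumes "\<And>l. m \<le> l \<Longrightarrow> l \<notin> northern_left n p \<and> l \<notin> southern_right n p"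
    and "1 \<le> m" "m \<le> k" "k \<le> n"
  shows "p (Northern k) = Southern k"
  using assms(3,4)
proof (induction "n - k" arbitrary: k rule: less_induct)
  case (less k)
  have k: "k \<in> {1..n}" using less.prems assms by auto
  then have Sk: "Southern k \<in> vertices n" by simp
  have "\<not> k < position (p (Southern k))"
  proof
    assume lt: "k < position (p (Southern k))"
    define l where "l = position (p (Southern k))"
    have l: "l \<le> n" using position_p[OF Sk] by (simp add: l_def)
    then have "p (Northern l) = Southern l" using less.hyps[of l] lt less.prems l_def by simp
    moreover from this have "p (Southern l) = Northern l"
      using p_p[of "Northern l"] l lt k by (simp add: l_def)
    moreover have "p (Southern k) = Northern l \<or> p (Southern k) = Southern l"
      unfolding l_def by (cases "p (Southern k)") auto
    ultimately show False using p_p[OF Sk] lt l_def by auto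
  qed
  moreover have "\<not> position (p (Southern k)) < k"
    using assms(1)[of k] less.prems k by (auto simp: southern_right_def)
  ultimately show ?case using vertical_iff(2)[OF k] by simp
qed

end

section \<open>Evaluation of Jones words and dual Jones words\<close>

lemma types_cong:
  assumes "\<And>v. v \<in> vertices n \<Longrightarrow> p v = q v"
  shows "northern_left n p = northern_left n q" "northern_right n p = northern_right n q"
    "southern_left n p = southern_left n q" "southern_right n p = southern_right n q"
  unfolding northern_left_def northern_right_def southern_left_def southern_right_def
  using assms by (intro Collect_cong conj_cong refl; simp)+

text \<open>The invariant for multiplying a word out from the right. Demanding a bare basis vector
  records that no power of \<open>\<delta>\<close> has appeared.\<close>

definition evaluates :: "nat \<Rightarrow> 'k::comm_ring_1 \<Rightarrow> nat list \<Rightarrow> (vertex \<Rightarrow> vertex) \<Rightarrow> bool" where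
  "evaluates n \<delta> w p \<longleftrightarrow> pairing n p \<and> noncrossing n p \<and> word_value n \<delta> w = tl_basis (matching_of n p)"

lemma evaluates_Nil: "evaluates n \<delta> [] reflection"
  by (simp add: evaluates_def pairing_reflection noncrossing_reflection word_value_def identity_diagram_eq)

lemma evaluates_Cons:
  assumes "evaluates n \<delta> w p" "surgery_site n p i"
  shows "evaluates n \<delta> (i # w) (surgery i p)"
proof -
  interpret surgery_site n p i by fact
  have nc: "noncrossing n p" and w: "word_value n \<delta> w = tl_basis (matching_of n p)"
    using assms(1) by (auto simp: evaluates_def)
  interpret g: surgery_site n reflection i using i by (rule generator_site)
  have "generator n i \<in> diagrams n"
    unfolding generator_eq[OF i]
    using g.pairing_surgery g.noncrossing_surgery[OF noncrossing_reflection] by (rule matching_of_diagram)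
  moreover have "matching_of n p \<in> diagrams n"
    using pairing_axioms nc by (rule matching_of_diagram)
  ultimately have "word_value n \<delta> (i # w) = tl_basis (matching_of n (surgery i p))"
    using tl_mult_basis[of "generator n i" n "matching_of n p" \<delta>] stack_surgery w
    by (simp add: word_value_def)
  then show ?thesis
    using pairing_surgery noncrossing_surgery[OF nc] by (simp add: evaluates_def)
qed

lemma reflection_types:
  "northern_left n reflection = {}" "northern_right n reflection = {}"
  "southern_left n reflection = {}" "southern_right n reflection = {}"
  by (auto simp: northern_left_def northern_right_def southern_left_def southern_right_def)

text \<open>By \<open>R\<close> and \<open>L\<close> the diagram is untouched up to position
  \<open>k\<close>, so \<open>e\<^sub>k\<close> meets a vertical edge there and no loop can
  form.\<close>

lemma jones_step_new:
  assumes "evaluates n \<delta> w p" "1 \<le> k" "k < n"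
    and R: "\<And>l. l \<in> northern_right n p \<Longrightarrow> Suc k < l" and L: "\<And>l. l \<in> southern_left n p \<Longrightarrow> k < l"
  shows "\<exists>q. evaluates n \<delta> (k # w) q \<and> northern_right n q = insert (Suc k) (northern_right n p) \<and>
    southern_left n q = insert k (southern_left n p)"
proof -
  interpret pairing n p using assms(1) by (simp add: evaluates_def)
  have "p (Northern k) = Southern k"
    by (rule vertical_left_end[of k]) (use R L assms in force)+
  moreover from this interpret surgery_site n p k
    by unfold_locales (use assms in auto)
  have "Suc k \<notin> northern_right n p" using R by blast
  ultimately show ?thesis
    using surgery_types_new evaluates_Cons[OF assms(1) surgery_site_axioms] by blast
qed

lemma jones_step_shift:
  assumes "evaluates n \<delta> w p" "1 \<le> j" "j < n"
    and "j \<in> northern_right n p" "Suc j \<notin> northern_right n p"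
  shows "\<exists>q. evaluates n \<delta> (j # w) q \<and> northern_right n q = insert (Suc j) (northern_right n p - {j}) \<and>
    southern_left n q = southern_left n p"
proof -
  interpret pairing n p using assms(1) by (simp add: evaluates_def)
  interpret surgery_site n p j
    by unfold_locales (use assms in \<open>auto simp: northern_right_def\<close>)
  show ?thesis
    using surgery_types_shift[OF assms(4,5)] evaluates_Cons[OF assms(1) surgery_site_axioms] by blast
qed

lemma dual_jones_step_new:
  assumes "evaluates n \<delta> w p" "1 \<le> k" "k < n"
    and R: "\<And>l. l \<in> northern_left n p \<Longrightarrow> l < k" and L: "\<And>l. l \<in> southern_right n p \<Longrightarrow> l < Suc k"
  shows "\<exists>q. evaluates n \<delta> (k # w) q \<and> northern_left n q = insert k (northern_left n p) \<and>
    southern_right n q = insert (Suc k) (southern_right n p)"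
proof -
  interpret pairing n p using assms(1) by (simp add: evaluates_def)
  have v: "p (Northern (Suc k)) = Southern (Suc k)"
    by (rule vertical_right_end[of "Suc k"]) (use R L assms in force)+
  have "p (Northern k) \<noteq> Northern (Suc k)"
    using p_p[of "Northern k"] v assms by auto
  then interpret surgery_site n p k
    by unfold_locales (use assms in auto)
  have "k \<notin> northern_left n p" using R by blast
  then show ?thesis
    using v surgery_dual_types_new evaluates_Cons[OF assms(1) surgery_site_axioms] by blast
qed

lemma dual_jones_step_shift:
  assumes "evaluates n \<delta> w p" "1 \<le> j" "j < n"
    and "Suc j \<in> northern_left n p" "j \<notin> northern_left n p"
  shows "\<exists>q. evaluates n \<delta> (j # w) q \<and> northern_left n q = insert j (northern_left n p - {Suc j}) \<and>
    southern_right n q = southern_right n p"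
proof -
  interpret pairing n p using assms(1) by (simp add: evaluates_def)
  interpret surgery_site n p j
    by unfold_locales (use assms in \<open>auto simp: northern_left_def\<close>)
  show ?thesis
    using surgery_dual_types_shift[OF assms(4,5)] evaluates_Cons[OF assms(1) surgery_site_axioms] by blast
qed

text \<open>Read from the right, a factor begins with its smallest letter \<open>k\<close>, which
  creates a new pair of endpoints; the letters up to \<open>j\<close> then push the northern one to
  \<open>Suc j\<close> while the southern one stays at \<open>k\<close>.\<close>

lemma jones_run:
  assumes "evaluates n \<delta> w p" "1 \<le> k" "k \<le> j" "j < n"
    and "\<And>l. l \<in> northern_right n p \<Longrightarrow> Suc j < l" and "\<And>l. l \<in> southern_left n p \<Longrightarrow> k < l"
  shows "\<exists>q. evaluates n \<delta> (rev [k..<Suc j] @ w) q \<and> northern_right n q = insert (Suc j) (northern_right n p) \<and>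
    southern_left n q = insert k (southern_left n p)"
  using assms(3-)
proof (induction j rule: dec_induct)
  case base
  then show ?case using jones_step_new[OF assms(1,2)] by force
next
  case (step j)
  have "\<And>l. l \<in> northern_right n p \<Longrightarrow> Suc j < l" using step.prems(2) Suc_lessD by blast
  then obtain q where q: "evaluates n \<delta> (rev [k..<Suc j] @ w) q"
      "northern_right n q = insert (Suc j) (northern_right n p)" "southern_left n q = insert k (southern_left n p)"
    using step.IH step.prems by (metis Suc_lessD)
  have "Suc (Suc j) \<notin> northern_right n q" using q(2) step.prems(2) by auto
  then obtain q' where q': "evaluates n \<delta> (Suc j # rev [k..<Suc j] @ w) q'"
      "northern_right n q' = insert (Suc (Suc j)) (northern_right n q - {Suc j})" "southern_left n q' = southern_left n q"
    using jones_step_shift[OF q(1), of "Suc j"] step q(2) by auto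
  have "Suc j \<notin> northern_right n p" using step.prems(2) by force
  then have "northern_right n q' = insert (Suc (Suc j)) (northern_right n p)" using q(2) q'(2) by auto
  then show ?case using q' q step.hyps by (intro exI[of _ q']) auto
qed

text \<open>Strict increase of both lists says that each factor, when its turn comes from the right,
  starts and ends to the left of everything built so far. The lists can be recovered from the value,
  so this lemma yields both the value of a normal form and its uniqueness.\<close>

lemma jones_word_evaluates:
  assumes "list_all2 (\<ge>) js ks" "set js \<subseteq> {0<..<n}" "set ks \<subseteq> {0<..<n}"
    "sorted_wrt (<) js" "sorted_wrt (<) ks"
  shows "\<exists>p. evaluates n \<delta> (concat (map2 (\<lambda>j k. rev [k..<Suc j]) js ks)) p \<and>
    northern_right n p = Suc ` set js \<and> southern_left n p = set ks"
  using assms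
proof (induction js ks rule: list_all2_induct)
  case Nil
  then show ?case using evaluates_Nil reflection_types by fastforce
next
  case (Cons j js k ks)
  then obtain p where p: "evaluates n \<delta> (concat (map2 (\<lambda>j k. rev [k..<Suc j]) js ks)) p"
    "northern_right n p = Suc ` set js" "southern_left n p = set ks"
    by auto
  have "\<exists>q. evaluates n \<delta> (rev [k..<Suc j] @ concat (map2 (\<lambda>j k. rev [k..<Suc j]) js ks)) q \<and>
      northern_right n q = insert (Suc j) (northern_right n p) \<and> southern_left n q = insert k (southern_left n p)"
    by (rule jones_run[OF p(1)]) (use Cons.hyps Cons.prems p(2,3) in auto)
  then show ?case using p(2,3) by (simp del: upt_Suc)
qed

text \<open>The mirror image: the largest letter \<open>b\<close> comes first and the northern left
  endpoint moves leftwards to \<open>a\<close>, hence the downward induction on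
  \<open>a\<close>.\<close>

lemma dual_jones_run:
  assumes "evaluates n \<delta> w p" "a \<le> b" "1 \<le> a" "b < n"
    and "\<And>l. l \<in> northern_left n p \<Longrightarrow> l < a" and "\<And>l. l \<in> southern_right n p \<Longrightarrow> l < Suc b"
  shows "\<exists>q. evaluates n \<delta> ([a..<Suc b] @ w) q \<and> northern_left n q = insert a (northern_left n p) \<and>
    southern_right n q = insert (Suc b) (southern_right n p)"
  using assms(2-)
proof (induction a rule: inc_induct)
  case base
  then show ?case using dual_jones_step_new[OF assms(1), of b] by force
next
  case (step a)
  have "\<And>l. l \<in> northern_left n p \<Longrightarrow> l < Suc a" using step.prems(3) less_SucI by blast
  then obtain q where q: "evaluates n \<delta> ([Suc a..<Suc b] @ w) q"
      "northern_left n q = insert (Suc a) (northern_left n p)" "southern_right n q = insert (Suc b) (southern_right n p)"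
    using step.IH step.prems by auto
  have "a \<notin> northern_left n q" using q(2) step.prems(3) by auto
  then obtain q' where q': "evaluates n \<delta> (a # [Suc a..<Suc b] @ w) q'"
      "northern_left n q' = insert a (northern_left n q - {Suc a})" "southern_right n q' = southern_right n q"
    using dual_jones_step_shift[OF q(1), of a] step q(2) by auto
  have "Suc a \<notin> northern_left n p" using step.prems(3) by force
  then have "northern_left n q' = insert a (northern_left n p)" using q(2) q'(2) by auto
  moreover have "[a..<Suc b] = a # [Suc a..<Suc b]" using step.hyps by (simp add: upt_conv_Cons)
  ultimately show ?case using q' q by (intro exI[of _ q']) auto
qed

lemma dual_jones_word_evaluates:
  assumes "list_all2 (\<le>) as bs" "set as \<subseteq> {0<..<n}" "set bs \<subseteq> {0<..<n}"
    "sorted_wrt (>) as" "sorted_wrt (>) bs"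
  shows "\<exists>p. evaluates n \<delta> (concat (map2 (\<lambda>a b. [a..<Suc b]) as bs)) p \<and>
    northern_left n p = set as \<and> southern_right n p = Suc ` set bs"
  using assms
proof (induction as bs rule: list_all2_induct)
  case Nil
  then show ?case using evaluates_Nil reflection_types by fastforce
next
  case (Cons a as b bs)
  then obtain p where p: "evaluates n \<delta> (concat (map2 (\<lambda>a b. [a..<Suc b]) as bs)) p"
    "northern_left n p = set as" "southern_right n p = Suc ` set bs"
    by auto
  have "\<exists>q. evaluates n \<delta> ([a..<Suc b] @ concat (map2 (\<lambda>a b. [a..<Suc b]) as bs)) q \<and>
      northern_left n q = insert a (northern_left n p) \<and> southern_right n q = insert (Suc b) (southern_right n p)"
    by (rule dual_jones_run[OF p(1)]) (use Cons.hyps Cons.prems p(2,3) in auto)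
  then show ?case using p(2,3) by (simp del: upt_Suc)
qed

section \<open>Skew shapes and BJS-equivalence\<close>

definition order_convex :: "(int \<times> int) set \<Rightarrow> bool" where
  "order_convex B \<longleftrightarrow> (\<forall>a\<in>B. \<forall>c\<in>B. \<forall>b. a \<le> b \<longrightarrow> b \<le> c \<longrightarrow> b \<in> B)"

lemma order_convexD:
  assumes "order_convex B" "(i, j) \<in> B" "(i', j') \<in> B" "i \<le> x" "x \<le> i'" "j \<le> y" "y \<le> j'"
  shows "(x, y) \<in> B"
  using assms(1)[unfolded order_convex_def, rule_format, OF assms(2,3), of "(x, y)"] assms(4-) by simp

lemma in_young_diagram_iff:
  "(x, y) \<in> young_diagram p \<longleftrightarrow> 1 \<le> x \<and> 1 \<le> y \<and> x \<le> int (length p) \<and> y \<le> int (p ! nat (x - 1))"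
proof
  assume "(x, y) \<in> young_diagram p"
  then show "1 \<le> x \<and> 1 \<le> y \<and> x \<le> int (length p) \<and> y \<le> int (p ! nat (x - 1))"
    by (auto simp: young_diagram_def)
next
  assume *: "1 \<le> x \<and> 1 \<le> y \<and> x \<le> int (length p) \<and> y \<le> int (p ! nat (x - 1))"
  then show "(x, y) \<in> young_diagram p"
    unfolding young_diagram_def by (intro CollectI exI[of _ "nat (x - 1)"] exI[of _ "nat (y - 1)"]) auto
qed

lemma young_diagram_down:
  assumes "sorted_wrt (\<ge>) p" "(x, y) \<in> young_diagram p" "1 \<le> x'" "1 \<le> y'" "x' \<le> x" "y' \<le> y"
  shows "(x', y') \<in> young_diagram p"
proof -
  have x: "x \<le> int (length p)" "y \<le> int (p ! nat (x - 1))"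
    using assms(2) by (auto simp: in_young_diagram_iff)
  have "p ! nat (x - 1) \<le> p ! nat (x' - 1)"
  proof (cases "x' = x")
    case False
    then show ?thesis
      using assms(1,3,5) x by (intro sorted_wrt_nth_less[of "(\<ge>)" p]) auto
  qed simp
  then show ?thesis using assms x by (auto simp: in_young_diagram_iff)
qed

lemma finite_young_diagram: "finite (young_diagram p)"
proof -
  have "young_diagram p = (\<Union>i<length p. (\<lambda>j. (int i + 1, int j + 1)) ` {..<p ! i})"
    by (auto simp: young_diagram_def)
  then show ?thesis by simp
qed

lemma skew_shape_finite: "skew_shape B \<Longrightarrow> finite B"
  by (auto simp: skew_shape_def finite_young_diagram)

lemma skew_shape_convex:
  assumes "skew_shape B"
  shows "order_convex B"
proof -
  obtain lam mu s t where p: "sorted_wrt (\<ge>) lam" "sorted_wrt (\<ge>) mu"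
    and B: "B = (\<lambda>(i, j). (i + s, j + t)) ` (young_diagram lam - young_diagram mu)"
    using assms by (auto simp: skew_shape_def)
  have mem: "(x, y) \<in> B \<longleftrightarrow> (x - s, y - t) \<in> young_diagram lam \<and> (x - s, y - t) \<notin> young_diagram mu" for x y
  proof
    assume "(x, y) \<in> B"
    then obtain i j where "(i, j) \<in> young_diagram lam - young_diagram mu" "x = i + s" "y = j + t"
      unfolding B by auto
    then show "(x - s, y - t) \<in> young_diagram lam \<and> (x - s, y - t) \<notin> young_diagram mu" by simp
  next
    assume "(x - s, y - t) \<in> young_diagram lam \<and> (x - s, y - t) \<notin> young_diagram mu"
    then show "(x, y) \<in> B" unfolding B by (intro image_eqI[of _ _ "(x - s, y - t)"]) simp_all
  qed
  have "(x, y) \<in> B" if b: "(i, j) \<in> B" "(i', j') \<in> B" "i \<le> x" "x \<le> i'" "j \<le> y" "y \<le> j'" for i j i' j' x y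
  proof -
    have pos: "1 \<le> i - s" "1 \<le> j - t" using b(1) by (auto simp: mem in_young_diagram_iff)
    have "(x - s, y - t) \<in> young_diagram lam"
      using young_diagram_down[OF p(1), of "i' - s" "j' - t" "x - s" "y - t"] b pos by (auto simp: mem)
    moreover have "(x - s, y - t) \<notin> young_diagram mu"
      using young_diagram_down[OF p(2), of "x - s" "y - t" "i - s" "j - t"] b pos by (auto simp: mem)
    ultimately show ?thesis by (simp add: mem)
  qed
  note between = this
  show ?thesis unfolding order_convex_def
  proof clarify
    fix i j i' j' x y
    assume "(i, j) \<in> B" "(i', j') \<in> B" "(i, j) \<le> (x, y)" "(x, y) \<le> (i', j')"
    then show "(x, y) \<in> B" using between[of i j i' j' x y] by simp
  qed
qed

text \<open>Each row of a finite down set is an initial segment, and its cardinalities, taken row by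
  row, form the partition.\<close>

lemma down_set_young_diagram:
  fixes D :: "(int \<times> int) set"
  assumes fin: "finite D" and pos: "\<And>x y. (x, y) \<in> D \<Longrightarrow> 1 \<le> x \<and> 1 \<le> y"
    and down: "\<And>x y x' y'. (x, y) \<in> D \<Longrightarrow> 1 \<le> x' \<Longrightarrow> x' \<le> x \<Longrightarrow> 1 \<le> y' \<Longrightarrow> y' \<le> y \<Longrightarrow> (x', y') \<in> D"
  shows "\<exists>p. sorted_wrt (\<ge>) p \<and> young_diagram p = D"
proof -
  define row where "row x = {y. (x, y) \<in> D}" for x
  have fin_row: "finite (row x)" for x
  proof (rule finite_subset)
    show "row x \<subseteq> snd ` D" by (auto simp: row_def intro: rev_image_eqI)
  qed (use fin in simp)
  have row: "row x = {1..int (card (row x))}" for x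
  proof (cases "row x = {}")
    case False
    define m where "m = Max (row x)"
    have m: "m \<in> row x" "\<And>y. y \<in> row x \<Longrightarrow> y \<le> m"
      using fin_row False by (auto simp: m_def)
    have "1 \<le> x" "1 \<le> m" using m(1) pos by (auto simp: row_def)
    have "row x = {1..m}"
    proof
      show "row x \<subseteq> {1..m}" using m(2) pos by (auto simp: row_def)
      show "{1..m} \<subseteq> row x"
      proof
        fix y assume "y \<in> {1..m}"
        then show "y \<in> row x" using down[of x m x y] m(1) \<open>1 \<le> x\<close> by (simp add: row_def)
      qed
    qed
    then show ?thesis using \<open>1 \<le> m\<close> by simp
  qed simp
  define N where "N = nat (Max (insert 0 (fst ` D)))"
  have N: "x \<le> int N" if "(x, y) \<in> D" for x y
  proof -
    have "x \<le> Max (insert 0 (fst ` D))" using fin that by (intro Max_ge) (auto simp: rev_image_eqI)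
    then show ?thesis unfolding N_def by simp
  qed
  define p where "p = map (\<lambda>i. card (row (int i + 1))) [0..<N]"
  have "row (int j + 1) \<subseteq> row (int i + 1)" if "i < j" for i j
    using down[of "int j + 1" _ "int i + 1"] pos that by (auto simp: row_def)
  then have "sorted_wrt (\<ge>) p"
    unfolding p_def sorted_wrt_iff_nth_less using fin_row by (auto intro!: card_mono)
  moreover have "young_diagram p = D"
  proof -
    have "(x, y) \<in> young_diagram p \<longleftrightarrow> (x, y) \<in> D" for x y
    proof -
      have "y \<in> row x \<longleftrightarrow> 1 \<le> y \<and> y \<le> int (card (row x))"
        using row[of x] by (metis atLeastAtMost_iff)
      then have "(x, y) \<in> young_diagram p \<longleftrightarrow> 1 \<le> x \<and> x \<le> int N \<and> y \<in> row x"
        unfolding in_young_diagram_iff by (auto simp: p_def)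
      also have "\<dots> \<longleftrightarrow> (x, y) \<in> D" using N pos by (auto simp: row_def)
      finally show ?thesis .
    qed
    then show ?thesis by auto
  qed
  ultimately show ?thesis by blast
qed

lemma finite_convex_skew_shape:
  assumes fin: "finite B" and conv: "order_convex B"
  shows "skew_shape B"
proof -
  \<comment> \<open>Inserting 0 keeps \<open>Min\<close> defined for the empty shape; subtracting 1
    makes the translated coordinates at least 1.\<close>
  define s where "s = Min (insert 0 (fst ` B)) - 1"
  define t where "t = Min (insert 0 (snd ` B)) - 1"
  have st: "s < x" "t < y" if "(x, y) \<in> B" for x y
  proof -
    have "Min (insert 0 (fst ` B)) \<le> x" "Min (insert 0 (snd ` B)) \<le> y"
      using fin that by (auto intro!: Min_le simp: rev_image_eqI)
    then show "s < x" "t < y" by (auto simp: s_def t_def)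
  qed
  \<comment> \<open>The outer partition is the down closure of the translated shape. Convexity makes
    the complement of the shape in it a down set again, which is the inner partition.\<close>
  define Lam where "Lam = {(x, y). 1 \<le> x \<and> 1 \<le> y \<and> (\<exists>x' y'. (x', y') \<in> B \<and> x + s \<le> x' \<and> y + t \<le> y')}"
  define Mu where "Mu = Lam - {(x, y). (x + s, y + t) \<in> B}"
  have Lam_I: "(x, y) \<in> Lam" if "1 \<le> x" "1 \<le> y" "(a, b) \<in> B" "x + s \<le> a" "y + t \<le> b" for x y a b
    unfolding Lam_def using that by blast
  have finL: "finite Lam"
  proof (rule finite_subset)
    show "Lam \<subseteq> (\<Union>b\<in>B. {1..fst b - s} \<times> {1..snd b - t})"
    proof clarify
      fix x y assume "(x, y) \<in> Lam"
      then obtain a b where "(a, b) \<in> B" "1 \<le> x" "1 \<le> y" "x + s \<le> a" "y + t \<le> b"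
        by (auto simp: Lam_def)
      then show "(x, y) \<in> (\<Union>b\<in>B. {1..fst b - s} \<times> {1..snd b - t})"
        by (intro UN_I[of "(a, b)"]) auto
    qed
  qed (use fin in auto)
  have downL: "(x', y') \<in> Lam" if L: "(x, y) \<in> Lam" "1 \<le> x'" "x' \<le> x" "1 \<le> y'" "y' \<le> y" for x y x' y'
  proof -
    obtain a b where "(a, b) \<in> B" "x + s \<le> a" "y + t \<le> b" using L(1) by (auto simp: Lam_def)
    then show ?thesis using L by (intro Lam_I[of x' y' a b]) auto
  qed
  have posL: "1 \<le> x \<and> 1 \<le> y" if "(x, y) \<in> Lam" for x y using that by (auto simp: Lam_def)
  obtain lam where lam: "sorted_wrt (\<ge>) lam" "young_diagram lam = Lam"
  proof -
    have "\<exists>p. sorted_wrt (\<ge>) p \<and> young_diagram p = Lam"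
    proof (rule down_set_young_diagram[OF finL])
      show "1 \<le> x \<and> 1 \<le> y" if "(x, y) \<in> Lam" for x y using posL[OF that] .
      show "(x', y') \<in> Lam" if "(x, y) \<in> Lam" "1 \<le> x'" "x' \<le> x" "1 \<le> y'" "y' \<le> y" for x y x' y'
        using downL[OF that] .
    qed
    then show thesis using that by blast
  qed
  have finM: "finite Mu" using finL by (simp add: Mu_def)
  have downM: "(x', y') \<in> Mu" if L: "(x, y) \<in> Mu" "1 \<le> x'" "x' \<le> x" "1 \<le> y'" "y' \<le> y" for x y x' y'
  proof -
    obtain a b where ab: "(a, b) \<in> B" "x + s \<le> a" "y + t \<le> b" and n: "(x + s, y + t) \<notin> B"
      using L(1) by (auto simp: Mu_def Lam_def)
    then have "(x' + s, y' + t) \<notin> B"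
      using order_convexD[OF conv, of "x' + s" "y' + t" a b "x + s" "y + t"] L by auto
    moreover have "(x', y') \<in> Lam" using L ab by (intro Lam_I[of x' y' a b]) auto
    ultimately show ?thesis by (simp add: Mu_def)
  qed
  have posM: "1 \<le> x \<and> 1 \<le> y" if "(x, y) \<in> Mu" for x y using that by (auto simp: Mu_def Lam_def)
  obtain mu where mu: "sorted_wrt (\<ge>) mu" "young_diagram mu = Mu"
  proof -
    have "\<exists>p. sorted_wrt (\<ge>) p \<and> young_diagram p = Mu"
    proof (rule down_set_young_diagram[OF finM])
      show "1 \<le> x \<and> 1 \<le> y" if "(x, y) \<in> Mu" for x y using posM[OF that] .
      show "(x', y') \<in> Mu" if "(x, y) \<in> Mu" "1 \<le> x'" "x' \<le> x" "1 \<le> y'" "y' \<le> y" for x y x' y'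
        using downM[OF that] .
    qed
    then show thesis using that by blast
  qed
  have "B = (\<lambda>(i, j). (i + s, j + t)) ` (Lam - Mu)"
  proof
    show "B \<subseteq> (\<lambda>(i, j). (i + s, j + t)) ` (Lam - Mu)"
    proof clarify
      fix x y assume b: "(x, y) \<in> B"
      then have "(x - s, y - t) \<in> Lam - Mu"
        using st[OF b] Lam_I[of "x - s" "y - t" x y] by (simp add: Mu_def)
      then show "(x, y) \<in> (\<lambda>(i, j). (i + s, j + t)) ` (Lam - Mu)" by (rule rev_image_eqI) simp
    qed
    show "(\<lambda>(i, j). (i + s, j + t)) ` (Lam - Mu) \<subseteq> B" by (auto simp: Mu_def)
  qed
  moreover have "Mu \<subseteq> Lam" by (simp add: Mu_def)
  ultimately show ?thesis
    unfolding skew_shape_def using lam mu by (intro exI[of _ lam] exI[of _ mu] exI[of _ s] exI[of _ t]) simp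
qed

lemma skew_shape_iff: "skew_shape B \<longleftrightarrow> finite B \<and> order_convex B"
  using skew_shape_finite skew_shape_convex finite_convex_skew_shape by blast

section \<open>Invariants of BJS-equivalence\<close>

lemma label_comparable:
  assumes "\<bar>label b - label c\<bar> \<le> 1"
  shows "b \<le> c \<or> c \<le> b"
  using assms by (cases b; cases c) (auto simp: label_def)

text \<open>In an order-convex shape, \<open>lower_ends 1\<close>, \<open>lower_ends (- 1)\<close>, \<open>upper_ends (- 1)\<close> and \<open>upper_ends 1\<close>
  collect the labels of the boxes without western, northern, eastern and southern neighbour. Stated in
  terms of the order, they are visibly invariant under BJS-equivalence.\<close>

definition lower_ends :: "int \<Rightarrow> (int \<times> int) set \<Rightarrow> int set" where
  "lower_ends \<epsilon> B = label ` {b \<in> B. \<not> (\<exists>c\<in>B. c \<le> b \<and> label c = label b + \<epsilon>)}"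

definition upper_ends :: "int \<Rightarrow> (int \<times> int) set \<Rightarrow> int set" where
  "upper_ends \<epsilon> B = label ` {b \<in> B. \<not> (\<exists>c\<in>B. b \<le> c \<and> label c = label b + \<epsilon>)}"

text \<open>Whether a box has a neighbour in a given direction is a question about comparable boxes
  on adjacent diagonals, and on those the bijection reflects the order as well.\<close>

lemma BJS_ends:
  assumes "(A, B) \<in> BJS" "\<bar>\<epsilon>\<bar> = 1"
  shows "lower_ends \<epsilon> A = lower_ends \<epsilon> B" "upper_ends \<epsilon> A = upper_ends \<epsilon> B"
proof -
  obtain f where f: "bij_betw f A B" "mono_on A f" "\<And>b. b \<in> A \<Longrightarrow> label (f b) = label b"
    using assms by (auto simp: BJS_def)
  have fA: "B = f ` A" and inj: "inj_on f A" using f(1) by (auto simp: bij_betw_def)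
  have mono: "f b \<le> f c" if "b \<in> A" "c \<in> A" "b \<le> c" for b c
    using monotone_onD[OF f(2) that] .
  \<comment> \<open>Monotonicity of the inverse is not part of \<open>BJS\<close>. On equal or
    adjacent labels it follows: the boxes are comparable, and the wrong order would be preserved
    too, forcing equality by injectivity.\<close>
  have le: "b \<le> c \<longleftrightarrow> f b \<le> f c" if "b \<in> A" "c \<in> A" "\<bar>label b - label c\<bar> \<le> 1" for b c
  proof
    show "b \<le> c \<Longrightarrow> f b \<le> f c" using mono that by blast
    assume le: "f b \<le> f c"
    show "b \<le> c"
    proof (rule ccontr)
      assume n: "\<not> b \<le> c"
      then have "c \<le> b" using label_comparable[OF that(3)] by blast
      then have "f c \<le> f b" using mono that by blast
      then have "f b = f c" using le by (rule antisym[rotated])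
      then have "b = c" using inj that by (auto dest: inj_onD)
      then show False using n by simp
    qed
  qed
  have low: "(\<exists>c\<in>A. c \<le> b \<and> label c = label b + \<epsilon>) \<longleftrightarrow> (\<exists>c\<in>B. c \<le> f b \<and> label c = label (f b) + \<epsilon>)"
    and up: "(\<exists>c\<in>A. b \<le> c \<and> label c = label b + \<epsilon>) \<longleftrightarrow> (\<exists>c\<in>B. f b \<le> c \<and> label c = label (f b) + \<epsilon>)"
    if "b \<in> A" for b
  proof -
    have near: "label c = label b + \<epsilon> \<Longrightarrow> \<bar>label c - label b\<bar> \<le> 1 \<and> \<bar>label b - label c\<bar> \<le> 1" for c
      using assms(2) by auto
    show "(\<exists>c\<in>A. c \<le> b \<and> label c = label b + \<epsilon>) \<longleftrightarrow> (\<exists>c\<in>B. c \<le> f b \<and> label c = label (f b) + \<epsilon>)"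
      unfolding fA bex_simps
    proof (rule bex_cong[OF refl])
      fix c assume "c \<in> A"
      then show "c \<le> b \<and> label c = label b + \<epsilon> \<longleftrightarrow> f c \<le> f b \<and> label (f c) = label (f b) + \<epsilon>"
        using f(3) le[of c b] near[of c] that by metis
    qed
    show "(\<exists>c\<in>A. b \<le> c \<and> label c = label b + \<epsilon>) \<longleftrightarrow> (\<exists>c\<in>B. f b \<le> c \<and> label c = label (f b) + \<epsilon>)"
      unfolding fA bex_simps
    proof (rule bex_cong[OF refl])
      fix c assume "c \<in> A"
      then show "b \<le> c \<and> label c = label b + \<epsilon> \<longleftrightarrow> f b \<le> f c \<and> label (f c) = label (f b) + \<epsilon>"
        using f(3) le[of b c] near[of c] that by metis
    qed
  qed
  have "lower_ends \<epsilon> B = (label \<circ> f) ` {b \<in> A. \<not> (\<exists>c\<in>B. c \<le> f b \<and> label c = label (f b) + \<epsilon>)}"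
    unfolding lower_ends_def by (subst (1) fA) auto
  also have "\<dots> = lower_ends \<epsilon> A"
  proof -
    have "{b \<in> A. \<not> (\<exists>c\<in>B. c \<le> f b \<and> label c = label (f b) + \<epsilon>)} =
        {b \<in> A. \<not> (\<exists>c\<in>A. c \<le> b \<and> label c = label b + \<epsilon>)}"
      by (intro Collect_cong conj_cong refl arg_cong[where f = Not] low[symmetric])
    then show ?thesis unfolding lower_ends_def by (intro image_cong) (simp_all add: f(3))
  qed
  finally show "lower_ends \<epsilon> A = lower_ends \<epsilon> B" ..
  have "upper_ends \<epsilon> B = (label \<circ> f) ` {b \<in> A. \<not> (\<exists>c\<in>B. f b \<le> c \<and> label c = label (f b) + \<epsilon>)}"
    unfolding upper_ends_def by (subst (1) fA) auto
  also have "\<dots> = upper_ends \<epsilon> A"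
  proof -
    have "{b \<in> A. \<not> (\<exists>c\<in>B. f b \<le> c \<and> label c = label (f b) + \<epsilon>)} =
        {b \<in> A. \<not> (\<exists>c\<in>A. b \<le> c \<and> label c = label b + \<epsilon>)}"
      by (intro Collect_cong conj_cong refl arg_cong[where f = Not] up[symmetric])
    then show ?thesis unfolding upper_ends_def by (intro image_cong) (simp_all add: f(3))
  qed
  finally show "upper_ends \<epsilon> A = upper_ends \<epsilon> B" ..
qed

text \<open>A box below or above \<open>(x, y)\<close> in the order, on the adjacent diagonal, has
  the neighbour of \<open>(x, y)\<close> on that diagonal weakly between itself and
  \<open>(x, y)\<close>; convexity puts this neighbour into the shape.\<close>

lemma lower_neighbour_iff:
  assumes "order_convex B" "(x, y) \<in> B"
  shows "(\<exists>c\<in>B. c \<le> (x, y) \<and> label c = label (x, y) + 1) \<longleftrightarrow> (x, y - 1) \<in> B"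
    and "(\<exists>c\<in>B. c \<le> (x, y) \<and> label c = label (x, y) + - 1) \<longleftrightarrow> (x - 1, y) \<in> B"
    and "(\<exists>c\<in>B. (x, y) \<le> c \<and> label c = label (x, y) + - 1) \<longleftrightarrow> (x, y + 1) \<in> B"
    and "(\<exists>c\<in>B. (x, y) \<le> c \<and> label c = label (x, y) + 1) \<longleftrightarrow> (x + 1, y) \<in> B"
proof -
  have w: "(x, y - 1) \<in> B" if "(a, b) \<in> B" "(a, b) \<le> (x, y)" "label (a, b) = label (x, y) + 1" for a b
    using that by (intro order_convexD[OF assms(1) that(1) assms(2)]) (auto simp: label_def)
  have n: "(x - 1, y) \<in> B" if "(a, b) \<in> B" "(a, b) \<le> (x, y)" "label (a, b) = label (x, y) + - 1" for a b
    using that by (intro order_convexD[OF assms(1) that(1) assms(2)]) (auto simp: label_def)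
  have e: "(x, y + 1) \<in> B" if "(a, b) \<in> B" "(x, y) \<le> (a, b)" "label (a, b) = label (x, y) + - 1" for a b
    using that by (intro order_convexD[OF assms(1) assms(2) that(1)]) (auto simp: label_def)
  have s: "(x + 1, y) \<in> B" if "(a, b) \<in> B" "(x, y) \<le> (a, b)" "label (a, b) = label (x, y) + 1" for a b
    using that by (intro order_convexD[OF assms(1) assms(2) that(1)]) (auto simp: label_def)
  show "(\<exists>c\<in>B. c \<le> (x, y) \<and> label c = label (x, y) + 1) \<longleftrightarrow> (x, y - 1) \<in> B"
    using w by (auto simp: label_def intro!: bexI[of _ "(x, y - 1)"])
  show "(\<exists>c\<in>B. c \<le> (x, y) \<and> label c = label (x, y) + - 1) \<longleftrightarrow> (x - 1, y) \<in> B"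
    using n by (auto simp: label_def intro!: bexI[of _ "(x - 1, y)"])
  show "(\<exists>c\<in>B. (x, y) \<le> c \<and> label c = label (x, y) + - 1) \<longleftrightarrow> (x, y + 1) \<in> B"
    using e by (auto simp: label_def intro!: bexI[of _ "(x, y + 1)"])
  show "(\<exists>c\<in>B. (x, y) \<le> c \<and> label c = label (x, y) + 1) \<longleftrightarrow> (x + 1, y) \<in> B"
    using s by (auto simp: label_def intro!: bexI[of _ "(x + 1, y)"])
qed

lemma in_ends_iff:
  assumes "order_convex B"
  shows "k \<in> lower_ends 1 B \<longleftrightarrow> (\<exists>x y. k = x - y \<and> (x, y) \<in> B \<and> (x, y - 1) \<notin> B)"
    and "k \<in> lower_ends (- 1) B \<longleftrightarrow> (\<exists>x y. k = x - y \<and> (x, y) \<in> B \<and> (x - 1, y) \<notin> B)"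
    and "k \<in> upper_ends (- 1) B \<longleftrightarrow> (\<exists>x y. k = x - y \<and> (x, y) \<in> B \<and> (x, y + 1) \<notin> B)"
    and "k \<in> upper_ends 1 B \<longleftrightarrow> (\<exists>x y. k = x - y \<and> (x, y) \<in> B \<and> (x + 1, y) \<notin> B)"
proof -
  have *: "k \<in> label ` {b \<in> B. \<not> P b} \<longleftrightarrow> (\<exists>x y. k = x - y \<and> (x, y) \<in> B \<and> \<not> P (x, y))" for P
    by (auto simp: label_def image_iff) 
  show "k \<in> lower_ends 1 B \<longleftrightarrow> (\<exists>x y. k = x - y \<and> (x, y) \<in> B \<and> (x, y - 1) \<notin> B)"
    unfolding lower_ends_def * using lower_neighbour_iff(1)[OF assms] by blast
  show "k \<in> lower_ends (- 1) B \<longleftrightarrow> (\<exists>x y. k = x - y \<and> (x, y) \<in> B \<and> (x - 1, y) \<notin> B)"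
    unfolding lower_ends_def * using lower_neighbour_iff(2)[OF assms] by blast
  show "k \<in> upper_ends (- 1) B \<longleftrightarrow> (\<exists>x y. k = x - y \<and> (x, y) \<in> B \<and> (x, y + 1) \<notin> B)"
    unfolding upper_ends_def * using lower_neighbour_iff(3)[OF assms] by blast
  show "k \<in> upper_ends 1 B \<longleftrightarrow> (\<exists>x y. k = x - y \<and> (x, y) \<in> B \<and> (x + 1, y) \<notin> B)"
    unfolding upper_ends_def * using lower_neighbour_iff(4)[OF assms] by blast
qed

lemma sorted_list_of_set_int_interval: "sorted_list_of_set {l..r::int} = [l..r]"
  by (metis distinct_upto set_upto sorted_list_of_set.idem_if_sorted_distinct sorted_upto)

text \<open>By convexity rows are intervals whose two ends move weakly west from one row to a lower
  one. The labels of western ends and of eastern ends therefore both increase strictly, so the two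
  sets of end labels determine all label intervals in order. Empty rows between nonempty ones are
  allowed.\<close>

lemma row_structure:
  assumes fin: "finite B" and conv: "order_convex B"
  obtains xs l r where "set xs = fst ` B" "sorted_wrt (<) xs"
    "\<And>x. x \<in> set xs \<Longrightarrow> l x \<le> r x" "\<And>x y. (x, y) \<in> B \<longleftrightarrow> x \<in> set xs \<and> l x \<le> y \<and> y \<le> r x"
    "row_reading_sequence B = concat (map (\<lambda>x. map (\<lambda>y. x - y) [l x..r x]) xs)"
    "sorted_wrt (<) (map (\<lambda>x. x - l x) xs)" "sorted_wrt (<) (map (\<lambda>x. x - r x) xs)"
    "(\<lambda>x. x - l x) ` set xs = lower_ends 1 B" "(\<lambda>x. x - r x) ` set xs = upper_ends (- 1) B"
proof -
  define xs where "xs = sorted_list_of_set (fst ` B)"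
  define row where "row x = {y. (x, y) \<in> B}" for x
  define l where "l x = Min (row x)" for x
  define r where "r x = Max (row x)" for x
  have xs: "set xs = fst ` B" "sorted_wrt (<) xs" using fin by (simp_all add: xs_def)
  have fin_row: "finite (row x)" for x
  proof (rule finite_subset)
    show "row x \<subseteq> snd ` B" by (auto simp: row_def intro: rev_image_eqI)
  qed (use fin in simp)
  have row: "l x \<in> row x" "r x \<in> row x" "row x = {l x..r x}" if "x \<in> set xs" for x
  proof -
    have ne: "row x \<noteq> {}" using that xs(1) by (auto simp: row_def)
    then show m: "l x \<in> row x" "r x \<in> row x" using fin_row by (auto simp: l_def r_def)
    have "row x \<subseteq> {l x..r x}" using fin_row by (auto simp: l_def r_def)
    moreover have "{l x..r x} \<subseteq> row x"
      using order_convexD[OF conv, of x "l x" x "r x" x] m by (auto simp: row_def)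
    ultimately show "row x = {l x..r x}" by blast
  qed
  have lr: "l x \<le> r x" if "x \<in> set xs" for x
    using row[OF that] by auto
  have mem: "(x, y) \<in> B \<longleftrightarrow> x \<in> set xs \<and> l x \<le> y \<and> y \<le> r x" for x y
  proof (cases "x \<in> set xs")
    case True
    then show ?thesis using row(3)[OF True] by (auto simp: row_def)
  next
    case False
    then show ?thesis using xs(1) by (auto simp: rev_image_eqI)
  qed
  have mono: "l x' \<le> l x \<and> r x' \<le> r x" if "x \<in> set xs" "x' \<in> set xs" "x < x'" for x x'
  proof
    have in_B: "(x, l x) \<in> B" "(x, r x) \<in> B" "(x', l x') \<in> B" "(x', r x') \<in> B"
      using mem lr that by auto
    show "l x' \<le> l x"
    proof (rule ccontr)
      assume "\<not> l x' \<le> l x"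
      then have "(x', l x) \<in> B" using order_convexD[OF conv in_B(1,3), of x' "l x"] that by simp
      then show False using mem \<open>\<not> l x' \<le> l x\<close> by auto
    qed
    show "r x' \<le> r x"
    proof (rule ccontr)
      assume "\<not> r x' \<le> r x"
      then have "(x, r x') \<in> B" using order_convexD[OF conv in_B(2,4), of x "r x'"] that by simp
      then show False using mem \<open>\<not> r x' \<le> r x\<close> by auto
    qed
  qed
  have "sorted_list_of_set {y. (x, y) \<in> B} = [l x..r x]" if "x \<in> set xs" for x
    using row(3)[OF that] by (simp add: row_def sorted_list_of_set_int_interval)
  then have seq: "row_reading_sequence B = concat (map (\<lambda>x. map (\<lambda>y. x - y) [l x..r x]) xs)"
    unfolding row_reading_sequence_def xs_def[symmetric] by (simp add: label_def cong: map_cong)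
  have sorted: "sorted_wrt (<) (map (\<lambda>x. x - l x) xs)" "sorted_wrt (<) (map (\<lambda>x. x - r x) xs)"
    unfolding sorted_wrt_map by (rule sorted_wrt_mono_rel[OF _ xs(2)]; use mono in force)+
  have "(\<exists>x\<in>set xs. k = x - l x) \<longleftrightarrow> (\<exists>x y. k = x - y \<and> (x, y) \<in> B \<and> (x, y - 1) \<notin> B)" for k
  proof
    assume "\<exists>x\<in>set xs. k = x - l x"
    then obtain x where "x \<in> set xs" "k = x - l x" by blast
    then have "k = x - l x \<and> (x, l x) \<in> B \<and> (x, l x - 1) \<notin> B" using lr by (simp add: mem)
    then show "\<exists>x y. k = x - y \<and> (x, y) \<in> B \<and> (x, y - 1) \<notin> B" by blast
  next
    assume "\<exists>x y. k = x - y \<and> (x, y) \<in> B \<and> (x, y - 1) \<notin> B"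
    then obtain x y where xy: "k = x - y" "(x, y) \<in> B" "(x, y - 1) \<notin> B" by blast
    then have "x \<in> set xs" "y = l x" unfolding mem by auto
    then show "\<exists>x\<in>set xs. k = x - l x" using xy(1) by blast
  qed
  then have L: "(\<lambda>x. x - l x) ` set xs = lower_ends 1 B"
    unfolding set_eq_iff in_ends_iff(1)[OF conv] image_iff by blast
  have "(\<exists>x\<in>set xs. k = x - r x) \<longleftrightarrow> (\<exists>x y. k = x - y \<and> (x, y) \<in> B \<and> (x, y + 1) \<notin> B)" for k
  proof
    assume "\<exists>x\<in>set xs. k = x - r x"
    then obtain x where "x \<in> set xs" "k = x - r x" by blast
    then have "k = x - r x \<and> (x, r x) \<in> B \<and> (x, r x + 1) \<notin> B" using lr by (simp add: mem)
    then show "\<exists>x y. k = x - y \<and> (x, y) \<in> B \<and> (x, y + 1) \<notin> B" by blast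
  next
    assume "\<exists>x y. k = x - y \<and> (x, y) \<in> B \<and> (x, y + 1) \<notin> B"
    then obtain x y where xy: "k = x - y" "(x, y) \<in> B" "(x, y + 1) \<notin> B" by blast
    then have "x \<in> set xs" "y = r x" unfolding mem by auto
    then show "\<exists>x\<in>set xs. k = x - r x" using xy(1) by blast
  qed
  then have R: "(\<lambda>x. x - r x) ` set xs = upper_ends (- 1) B"
    unfolding set_eq_iff in_ends_iff(3)[OF conv] image_iff by blast
  show thesis
    using that[OF xs lr mem seq sorted L R] .
qed

lemma strict_mono_on_int_gap:
  fixes g :: "int \<Rightarrow> int"
  assumes "\<And>x y. x \<in> S \<Longrightarrow> y \<in> S \<Longrightarrow> x < y \<Longrightarrow> g x < g y" "a \<le> b" "{a..b} \<subseteq> S"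
  shows "b - a \<le> g b - g a"
  using assms(2,3)
proof (induction b rule: int_ge_induct)
  case (step b)
  have "g b < g (b + 1)" using step.hyps step.prems by (intro assms(1)) (auto simp: subset_iff)
  then show ?case using step by force
qed simp

text \<open>Equal end labels match the nonempty rows of \<open>A\<close> and \<open>B\<close> one
  after the other with equal label intervals; each row is moved to its counterpart by a diagonal
  translation.\<close>

lemma ends_imp_BJS:
  assumes A: "skew_shape A" and B: "skew_shape B"
    and eq: "lower_ends 1 A = lower_ends 1 B" "upper_ends (- 1) A = upper_ends (- 1) B"
  shows "(A, B) \<in> BJS"
proof -
  have A': "finite A" "order_convex A" and B': "finite B" "order_convex B"
    using A B by (simp_all add: skew_shape_iff)
  obtain xs l r where xs: "set xs = fst ` A" "sorted_wrt (<) xs"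
    "\<And>x. x \<in> set xs \<Longrightarrow> l x \<le> r x" "\<And>x y. (x, y) \<in> A \<longleftrightarrow> x \<in> set xs \<and> l x \<le> y \<and> y \<le> r x"
    "sorted_wrt (<) (map (\<lambda>x. x - l x) xs)" "sorted_wrt (<) (map (\<lambda>x. x - r x) xs)"
    "(\<lambda>x. x - l x) ` set xs = lower_ends 1 A" "(\<lambda>x. x - r x) ` set xs = upper_ends (- 1) A"
    by (rule row_structure[OF A']) (rule that; assumption)
  obtain xs' l' r' where xs': "set xs' = fst ` B" "sorted_wrt (<) xs'"
    "\<And>x. x \<in> set xs' \<Longrightarrow> l' x \<le> r' x" "\<And>x y. (x, y) \<in> B \<longleftrightarrow> x \<in> set xs' \<and> l' x \<le> y \<and> y \<le> r' x"
    "sorted_wrt (<) (map (\<lambda>x. x - l' x) xs')" "sorted_wrt (<) (map (\<lambda>x. x - r' x) xs')"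
    "(\<lambda>x. x - l' x) ` set xs' = lower_ends 1 B" "(\<lambda>x. x - r' x) ` set xs' = upper_ends (- 1) B"
    by (rule row_structure[OF B']) (rule that; assumption)
  have L: "map (\<lambda>x. x - l x) xs = map (\<lambda>x. x - l' x) xs'"
    by (rule strict_sorted_equal) (use xs xs' eq in simp_all)
  have R: "map (\<lambda>x. x - r x) xs = map (\<lambda>x. x - r' x) xs'"
    by (rule strict_sorted_equal) (use xs xs' eq in simp_all)
  have len: "length xs = length xs'" using L by (rule map_eq_imp_length_eq)
  define g where "g x = xs' ! inv_into {..<length xs} ((!) xs) x" for x
  have "distinct xs" using xs(2) strict_sorted_iff by blast
  then have inj: "inj_on ((!) xs) {..<length xs}" by (simp add: inj_on_def nth_eq_iff_index_eq)
  have g: "g (xs ! i) = xs' ! i" if "i < length xs" for i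
    using inv_into_f_f[OF inj, of i] that by (simp add: g_def)
  have g_lr: "g x \<in> set xs'" "x - l x = g x - l' (g x)" "x - r x = g x - r' (g x)" if x: "x \<in> set xs" for x
  proof -
    obtain i where i: "i < length xs" "x = xs ! i" using x by (auto simp: in_set_conv_nth)
    show "g x \<in> set xs'" using i g len by simp
    show "x - l x = g x - l' (g x)" using arg_cong[OF L, of "\<lambda>zs. zs ! i"] i g len by simp
    show "x - r x = g x - r' (g x)" using arg_cong[OF R, of "\<lambda>zs. zs ! i"] i g len by simp
  qed
  have g_surj: "\<exists>x\<in>set xs. g x = x'" if "x' \<in> set xs'" for x'
    using that g len by (metis in_set_conv_nth)
  have g_mono: "g x < g y" if xy: "x \<in> set xs" "y \<in> set xs" "x < y" for x y
  proof -
    obtain i j where ij: "i < length xs" "x = xs ! i" "j < length xs" "y = xs ! j"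
      using xy by (metis in_set_conv_nth)
    have "i < j"
    proof (rule ccontr)
      assume "\<not> i < j"
      then have "j < i \<or> j = i" by linarith
      then show False using sorted_wrt_nth_less[OF xs(2), of j i] ij xy(3) by auto
    qed
    then show ?thesis using sorted_wrt_nth_less[OF xs'(2), of i j] ij g len by simp
  qed
  \<comment> \<open>The second coordinate is the only one that keeps the label \<open>x - y\<close>
    in row \<open>g x\<close>.\<close>
  define f where "f = (\<lambda>(x, y). (g x, g x - (x - y)))"
  have "inj_on f A"
  proof (rule inj_onI, clarify)
    fix x y x' y' assume a: "(x, y) \<in> A" "(x', y') \<in> A" "f (x, y) = f (x', y')"
    then have "x = x'" using g_mono[of x x'] g_mono[of x' x] xs(4) by (force simp: f_def)
    then show "x = x' \<and> y = y'" using a(3) by (simp add: f_def)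
  qed
  moreover have "f ` A = B"
  proof
    show "f ` A \<subseteq> B" using xs(4) xs'(4) g_lr by (force simp: f_def)
    show "B \<subseteq> f ` A"
    proof clarify
      fix x' y' assume b: "(x', y') \<in> B"
      then obtain x where x: "x \<in> set xs" "g x = x'" using g_surj xs'(4) by blast
      then have "(x, x - (x' - y')) \<in> A" using b g_lr[OF x(1)] xs(4) xs'(4) by auto
      moreover have "f (x, x - (x' - y')) = (x', y')" using x by (simp add: f_def)
      ultimately show "(x', y') \<in> f ` A" by (metis imageI)
    qed
  qed
  moreover have "mono_on A f"
  proof (rule monotone_onI, clarify)
    fix x y x' y' assume a: "(x, y) \<in> A" "(x', y') \<in> A" "(x, y) \<le> (x', y')"
    \<comment> \<open>Comparable boxes lie in a block without empty rows. There \<open>g\<close>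
      grows at least as fast as the row number, which also makes the second coordinate of
      \<open>f\<close> monotone.\<close>
    have "{x..x'} \<subseteq> set xs"
    proof
      fix z assume "z \<in> {x..x'}"
      then have "(z, y) \<in> A" using order_convexD[OF A'(2) a(1,2), of z y] a(3) by simp
      then show "z \<in> set xs" using xs(4) by blast
    qed
    then have "x' - x \<le> g x' - g x" using strict_mono_on_int_gap[of "set xs" g x x'] g_mono a(3) by simp
    then show "f (x, y) \<le> f (x', y')" using a(3) by (simp add: f_def)
  qed
  moreover have "\<forall>b\<in>A. label (f b) = label b" by (auto simp: f_def label_def)
  ultimately show ?thesis using A B unfolding BJS_def bij_betw_def by blast
qed

text \<open>Equality of two sets on the right-hand side makes it evident that \<open>BJS\<close> is
  an equivalence relation on skew shapes.\<close>

lemma BJS_iff: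
  assumes "skew_shape A"
  shows "(A, B) \<in> BJS \<longleftrightarrow> skew_shape B \<and> lower_ends 1 A = lower_ends 1 B \<and> upper_ends (- 1) A = upper_ends (- 1) B"
proof
  assume "(A, B) \<in> BJS"
  then show "skew_shape B \<and> lower_ends 1 A = lower_ends 1 B \<and> upper_ends (- 1) A = upper_ends (- 1) B"
    using BJS_ends[of A B 1] BJS_ends[of A B "- 1"] by (simp add: BJS_def)
qed (use ends_imp_BJS assms in blast)

section \<open>Reading words\<close>

lemma rev_labels_eq:
  assumes "l \<le> r" "r < x"
  shows "map (\<lambda>y. nat (x - y)) [l..r] = rev [nat (x - r)..<Suc (nat (x - l))]"
proof (rule nth_equalityI)
  fix i assume "i < length (map (\<lambda>y. nat (x - y)) [l..r])"
  then show "map (\<lambda>y. nat (x - y)) [l..r] ! i = rev [nat (x - r)..<Suc (nat (x - l))] ! i"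
    using assms by (simp add: rev_nth nth_upto del: upt_Suc)
qed (use assms in \<open>simp del: upt_Suc\<close>)

lemma labels_eq:
  assumes "l \<le> r" "x < l"
  shows "map (\<lambda>y. nat (y - x)) [l..r] = [nat (l - x)..<Suc (nat (r - x))]"
proof (rule nth_equalityI)
  fix i assume "i < length (map (\<lambda>y. nat (y - x)) [l..r])"
  then show "map (\<lambda>y. nat (y - x)) [l..r] ! i = [nat (l - x)..<Suc (nat (r - x))] ! i"
    using assms by (simp add: nth_upto del: upt_Suc)
qed (use assms in \<open>simp del: upt_Suc\<close>)

lemma map2_map_map: "map2 f (map g xs) (map h xs) = map (\<lambda>x. f (g x) (h x)) xs"
  by (induction xs) auto

lemma sorted_wrt_less_map_nat:
  assumes "sorted_wrt (<) (map f xs)" "\<And>x. x \<in> set xs \<Longrightarrow> 0 < (f x :: int)"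
  shows "sorted_wrt (<) (map (\<lambda>x. nat (f x)) xs)"
  using assms by (induction xs) auto

lemma row_reading_word_jones:
  assumes fin: "finite B" and conv: "order_convex B" and labels: "label ` B \<subseteq> {0<..<int n}"
  obtains js ks where "list_all2 (\<ge>) js ks" "set js \<subseteq> {0<..<n}" "set ks \<subseteq> {0<..<n}"
    "sorted_wrt (<) js" "sorted_wrt (<) ks"
    "row_reading_word B = concat (map2 (\<lambda>j k. rev [k..<Suc j]) js ks)"
    "int ` set js = lower_ends 1 B" "int ` set ks = upper_ends (- 1) B"
proof -
  obtain xs l r where xs: "set xs = fst ` B" "sorted_wrt (<) xs"
    and lr: "\<And>x. x \<in> set xs \<Longrightarrow> l x \<le> r x" and mem: "\<And>x y. (x, y) \<in> B \<longleftrightarrow> x \<in> set xs \<and> l x \<le> y \<and> y \<le> r x"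
    and seq: "row_reading_sequence B = concat (map (\<lambda>x. map (\<lambda>y. x - y) [l x..r x]) xs)"
    and sorted: "sorted_wrt (<) (map (\<lambda>x. x - l x) xs)" "sorted_wrt (<) (map (\<lambda>x. x - r x) xs)"
    and ends: "(\<lambda>x. x - l x) ` set xs = lower_ends 1 B" "(\<lambda>x. x - r x) ` set xs = upper_ends (- 1) B"
    by (rule row_structure[OF fin conv]) (rule that; assumption)
  define js where "js = map (\<lambda>x. nat (x - l x)) xs"
  define ks where "ks = map (\<lambda>x. nat (x - r x)) xs"
  have range: "0 < x - y" "x - y < int n" if "(x, y) \<in> B" for x y
    using subsetD[OF labels imageI[OF that]] by (simp_all add: label_def)
  have rl: "0 < x - l x" "x - l x < int n" "0 < x - r x" "x - r x < int n" if "x \<in> set xs" for x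
    using range[of x "l x"] range[of x "r x"] mem lr that by auto
  have int_nat: "int (nat (x - l x)) = x - l x" "int (nat (x - r x)) = x - r x" if "x \<in> set xs" for x
    using rl[OF that] by simp_all
  have rl': "nat (x - l x) < n" "nat (x - r x) < n" if "x \<in> set xs" for x
    using rl[OF that] by linarith+
  show thesis
  proof (rule that[of js ks])
    show "list_all2 (\<ge>) js ks"
      unfolding js_def ks_def list_all2_conv_all_nth using lr by (auto simp: nat_mono)
    show "set js \<subseteq> {0<..<n}" "set ks \<subseteq> {0<..<n}"
      using rl(1,3) rl' by (auto simp: js_def ks_def)
    show "sorted_wrt (<) js" "sorted_wrt (<) ks"
      unfolding js_def ks_def using sorted rl by (auto intro!: sorted_wrt_less_map_nat)
    have "row_reading_word B = concat (map (\<lambda>x. map (\<lambda>y. nat (x - y)) [l x..r x]) xs)"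
      unfolding row_reading_word_def seq by (simp add: map_concat comp_def)
    also have "\<dots> = concat (map (\<lambda>x. rev [nat (x - r x)..<Suc (nat (x - l x))]) xs)"
      using rev_labels_eq lr rl(3) by (intro arg_cong[where f = concat] map_cong) (auto simp del: upt_Suc)
    finally show "row_reading_word B = concat (map2 (\<lambda>j k. rev [k..<Suc j]) js ks)"
      unfolding js_def ks_def map2_map_map .
    have "int ` set js = (\<lambda>x. x - l x) ` set xs" "int ` set ks = (\<lambda>x. x - r x) ` set xs"
      unfolding js_def ks_def set_map image_image by (auto intro!: image_cong simp only: int_nat)
    then show "int ` set js = lower_ends 1 B" "int ` set ks = upper_ends (- 1) B"
      using ends by auto
  qed
qed

text \<open>The transposed set \<open>T\<close> turns columns into rows and changes the sign of all
  labels, so \<open>row_structure\<close> applies to it. The sign change explains why both lists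
  decrease and why northern ends of \<open>B\<close> appear as western ends of
  \<open>T\<close>.\<close>

lemma column_reading_word_dual_jones:
  assumes fin: "finite B" and conv: "order_convex B" and labels: "label ` B \<subseteq> {0<..<int n}"
  obtains as bs where "list_all2 (\<le>) as bs" "set as \<subseteq> {0<..<n}" "set bs \<subseteq> {0<..<n}"
    "sorted_wrt (>) as" "sorted_wrt (>) bs"
    "column_reading_word B = concat (map2 (\<lambda>a b. [a..<Suc b]) as bs)"
    "int ` set as = lower_ends (- 1) B" "int ` set bs = upper_ends 1 B"
proof -
  define T where "T = prod.swap ` B"
  have T: "(y, x) \<in> T \<longleftrightarrow> (x, y) \<in> B" for x y
    unfolding T_def by auto
  have finT: "finite T" using fin by (simp add: T_def)
  have convT: "order_convex T"
    unfolding order_convex_def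
  proof clarify
    fix i j i' j' x y
    assume "(i, j) \<in> T" "(i', j') \<in> T" "(i, j) \<le> (x, y)" "(x, y) \<le> (i', j')"
    then show "(x, y) \<in> T" using order_convexD[OF conv, of j i j' i' y x] by (simp add: T)
  qed
  obtain ys l r where ys: "set ys = fst ` T" "sorted_wrt (<) ys"
    and lr: "\<And>y. y \<in> set ys \<Longrightarrow> l y \<le> r y" and mem: "\<And>y x. (y, x) \<in> T \<longleftrightarrow> y \<in> set ys \<and> l y \<le> x \<and> x \<le> r y"
    and seq: "row_reading_sequence T = concat (map (\<lambda>y. map (\<lambda>x. y - x) [l y..r y]) ys)"
    and sorted: "sorted_wrt (<) (map (\<lambda>y. y - l y) ys)" "sorted_wrt (<) (map (\<lambda>y. y - r y) ys)"
    and ends: "(\<lambda>y. y - l y) ` set ys = lower_ends 1 T" "(\<lambda>y. y - r y) ` set ys = upper_ends (- 1) T"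
    by (rule row_structure[OF finT convT]) (rule that; assumption)
  have "fst ` T = snd ` B" by (simp add: T_def image_image)
  then have seq': "column_reading_sequence B = map uminus (row_reading_sequence T)"
    unfolding column_reading_sequence_def row_reading_sequence_def
    by (simp add: T map_concat comp_def label_def)
  define as where "as = map (\<lambda>y. nat (l y - y)) ys"
  define bs where "bs = map (\<lambda>y. nat (r y - y)) ys"
  have range: "0 < x - y" "x - y < int n" if "(y, x) \<in> T" for x y
    using subsetD[OF labels imageI[OF that[unfolded T]]] by (simp_all add: label_def)
  have rl: "0 < l y - y" "l y - y < int n" "0 < r y - y" "r y - y < int n" if "y \<in> set ys" for y
    using range[of y "l y"] range[of y "r y"] mem lr that by auto
  have lowT: "k \<in> lower_ends 1 T \<longleftrightarrow> - k \<in> lower_ends (- 1) B"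
    and upT: "k \<in> upper_ends (- 1) T \<longleftrightarrow> - k \<in> upper_ends 1 B" for k
  proof -
    have neg: "k = x - y \<longleftrightarrow> - k = y - x" for x y by auto
    show "k \<in> lower_ends 1 T \<longleftrightarrow> - k \<in> lower_ends (- 1) B"
      unfolding in_ends_iff[OF conv] in_ends_iff[OF convT] T neg by blast
    show "k \<in> upper_ends (- 1) T \<longleftrightarrow> - k \<in> upper_ends 1 B"
      unfolding in_ends_iff[OF conv] in_ends_iff[OF convT] T neg by blast
  qed
  have int_nat: "int (nat (l y - y)) = - (y - l y)" "int (nat (r y - y)) = - (y - r y)" if "y \<in> set ys" for y
    using rl[OF that] by simp_all
  have rl': "nat (l y - y) < n" "nat (r y - y) < n" if "y \<in> set ys" for y
    using rl[OF that] by linarith+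
  show thesis
  proof (rule that[of as bs])
    show "list_all2 (\<le>) as bs"
      unfolding as_def bs_def list_all2_conv_all_nth using lr by (auto simp: nat_mono)
    show "set as \<subseteq> {0<..<n}" "set bs \<subseteq> {0<..<n}"
      using rl(1,3) rl' by (auto simp: as_def bs_def)
    show "sorted_wrt (>) as" "sorted_wrt (>) bs"
      unfolding as_def bs_def sorted_wrt_map
      by (rule sorted_wrt_mono_rel[OF _ sorted(1)[unfolded sorted_wrt_map]], use rl in force,
          rule sorted_wrt_mono_rel[OF _ sorted(2)[unfolded sorted_wrt_map]], use rl in force)
    have "column_reading_word B = concat (map (\<lambda>y. map (\<lambda>x. nat (x - y)) [l y..r y]) ys)"
      unfolding column_reading_word_def seq' seq by (simp add: map_concat comp_def)
    also have "\<dots> = concat (map (\<lambda>y. [nat (l y - y)..<Suc (nat (r y - y))]) ys)"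
      using labels_eq lr rl(1) by (intro arg_cong[where f = concat] map_cong) (auto simp del: upt_Suc)
    finally show "column_reading_word B = concat (map2 (\<lambda>a b. [a..<Suc b]) as bs)"
      unfolding as_def bs_def map2_map_map .
    have "int ` set as = (\<lambda>y. - (y - l y)) ` set ys" "int ` set bs = (\<lambda>y. - (y - r y)) ` set ys"
      unfolding as_def bs_def set_map image_image by (auto intro!: image_cong simp only: int_nat)
    then have *: "int ` set as = uminus ` lower_ends 1 T" "int ` set bs = uminus ` upper_ends (- 1) T"
      unfolding ends[symmetric] image_image by auto
    show "int ` set as = lower_ends (- 1) B" "int ` set bs = upper_ends 1 B"
      unfolding * using lowT upT by (auto simp: image_iff intro!: bexI[of _ "- _"])
  qed
qed

section \<open>The shape of a diagram\<close>

lemma vertical_segment_side: "{(x - 1, y), (x, y)} \<in> sides b \<longleftrightarrow> b = (x, y) \<or> b = (x, y + 1)"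
proof (cases b)
  case (Pair i j) show ?thesis unfolding Pair by (simp add: doubleton_eq_iff) presburger
qed

lemma horizontal_segment_side: "{(x, y - 1), (x, y)} \<in> sides b \<longleftrightarrow> b = (x, y) \<or> b = (x + 1, y)"
proof (cases b)
  case (Pair i j) show ?thesis unfolding Pair by (simp add: doubleton_eq_iff) presburger
qed

lemma side_cases:
  assumes "s \<in> sides b"
  obtains x y where "s = {(x - 1, y), (x, y)}" | x y where "s = {(x, y - 1), (x, y)}"
proof (cases b)
  case (Pair i j)
  then consider "s = {(i - 1, j - 1), (i - 1, j)}" | "s = {(i, j - 1), (i, j)}"
    | "s = {(i - 1, j - 1), (i, j - 1)}" | "s = {(i - 1, j), (i, j)}"
    using assms by auto
  then show thesis by cases (use that in blast)+
qed

text \<open>Every unit segment is a side of exactly two boxes, so being a side of a unique member is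
  an exclusive or.\<close>

lemma boundary_iff:
  "{(x - 1, y), (x, y)} \<in> boundary B \<longleftrightarrow> ((x, y) \<in> B) \<noteq> ((x, y + 1) \<in> B)"
  "{(x, y - 1), (x, y)} \<in> boundary B \<longleftrightarrow> ((x, y) \<in> B) \<noteq> ((x + 1, y) \<in> B)"
proof -
  have "(\<exists>!b. b \<in> B \<and> (b = c \<or> b = d)) \<longleftrightarrow> (c \<in> B) \<noteq> (d \<in> B)" if "c \<noteq> d" for c d :: "int \<times> int"
    using that by metis
  note xor = this
  show "{(x - 1, y), (x, y)} \<in> boundary B \<longleftrightarrow> ((x, y) \<in> B) \<noteq> ((x, y + 1) \<in> B)"
    unfolding boundary_def mem_Collect_eq vertical_segment_side by (rule xor) simp
  show "{(x, y - 1), (x, y)} \<in> boundary B \<longleftrightarrow> ((x, y) \<in> B) \<noteq> ((x + 1, y) \<in> B)"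
    unfolding boundary_def mem_Collect_eq horizontal_segment_side by (rule xor) simp
qed

text \<open>Stepping east across a vertical segment changes membership in \<open>B\<close> and in
  \<open>C\<close> simultaneously. Far to the east a box is in neither, so membership agrees
  everywhere.\<close>

lemma boundary_inj:
  assumes "finite B" "finite C" "boundary B = boundary C"
  shows "B = C"
proof -
  have step: "((x, y) \<in> B \<longleftrightarrow> (x, y) \<in> C) \<longleftrightarrow> ((x, y + 1) \<in> B \<longleftrightarrow> (x, y + 1) \<in> C)" for x y
    using boundary_iff(1)[of x y B] boundary_iff(1)[of x y C] assms(3) by blast
  have steps: "((x, y) \<in> B \<longleftrightarrow> (x, y) \<in> C) \<longleftrightarrow> ((x, y + int m) \<in> B \<longleftrightarrow> (x, y + int m) \<in> C)" for x y m
  proof (induction m)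
    case (Suc m)
    then show ?case using step[of x "y + int m"] by (simp add: algebra_simps)
  qed simp
  have "(x, y) \<in> B \<longleftrightarrow> (x, y) \<in> C" for x y
  proof -
    define M where "M = Max (insert y (snd ` (B \<union> C)))"
    have M: "y \<le> M" "\<And>a b. (a, b) \<in> B \<union> C \<Longrightarrow> b \<le> M"
      unfolding M_def using assms by (auto intro!: Max_ge simp: rev_image_eqI)
    then have "(x, M + 1) \<notin> B" "(x, M + 1) \<notin> C" by force+
    moreover have "M + 1 = y + int (nat (M + 1 - y))" using M(1) by simp
    ultimately show ?thesis using steps[of x y "nat (M + 1 - y)"] by metis
  qed
  then show ?thesis by auto
qed

lemma segments_eq_map:
  assumes "\<And>k. k < length cs \<Longrightarrow> f (Suc k) = move (cs ! k) (f k)"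
  shows "segments (f 0) cs = map (\<lambda>k. {f k, f (Suc k)}) [0..<length cs]"
  using assms
proof (induction cs arbitrary: f)
  case (Cons c cs)
  have "segments (f (Suc 0)) cs = map (\<lambda>k. {f (Suc k), f (Suc (Suc k))}) [0..<length cs]"
    using Cons.IH[of "\<lambda>k. f (Suc k)"] Cons.prems by fastforce
  then show ?case
    using Cons.prems[of 0] by (simp add: upt_conv_Cons map_Suc_upt[symmetric] comp_def del: upt_Suc)
qed simp

lemma count_list_distinct: "distinct xs \<Longrightarrow> count_list xs s = (if s \<in> set xs then 1 else 0)"
  by (induction xs) auto

text \<open>Pure arithmetic behind \<open>boundary_shape\<close>. The letters \<open>A\<close>,
  \<open>A'\<close> stand for the northern count at an index and its predecessor, \<open>C\<close>,
  \<open>C'\<close> for the southern one; \<open>T\<close> says that the index lies in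
  \<open>{1..int n}\<close>. The left sides compare boxes on two adjacent diagonals, the right sides
  the segments of the two paths.\<close>

lemma segment_xor:
  fixes A A' C C' y :: int
  assumes T and "A = A' \<or> A = A' + 1" "C = C' \<or> C = C' + 1" "C \<le> A" "C' \<le> A'"
  shows "(- A < y \<and> y \<le> - C) \<noteq> (- A' < y + 1 \<and> y + 1 \<le> - C') \<longleftrightarrow>
      (T \<and> A = A' \<and> y = - A) \<noteq> (T \<and> C = C' \<and> y = - C)"
    and "(- A' < y \<and> y \<le> - C') \<noteq> (- A < y \<and> y \<le> - C) \<longleftrightarrow>
      (T \<and> A = A' + 1 \<and> y = - A') \<noteq> (T \<and> C = C' + 1 \<and> y = - C')"
  using assms by (smt (z3))+

lemma segment_xor_outside:
  fixes A A' C C' y :: int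
  assumes "\<not> T" and "A = C \<and> A' = C'"
  shows "(- A < y \<and> y \<le> - C) \<noteq> (- A' < y + 1 \<and> y + 1 \<le> - C') \<longleftrightarrow>
      (T \<and> A = A' \<and> y = - A) \<noteq> (T \<and> C = C' \<and> y = - C)"
    and "(- A' < y \<and> y \<le> - C') \<noteq> (- A < y \<and> y \<le> - C) \<longleftrightarrow>
      (T \<and> A = A' + 1 \<and> y = - A') \<noteq> (T \<and> C = C' + 1 \<and> y = - C')"
  using assms by auto

section \<open>The region between the two counting paths\<close>

context pairing
begin

lemma ca_step: "ca k = ca (k - 1) \<or> ca k = ca (k - 1) + 1"
  and cb_step: "cb k = cb (k - 1) \<or> cb k = cb (k - 1) + 1"
  using count_upto_pred[of "northern_left n p" k] count_upto_pred[of "southern_right n p" k] by auto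

lemma count_growth:
  assumes "j \<le> k"
  shows "ca j \<le> ca k" "ca k \<le> ca j + (k - j)" "cb j \<le> cb k" "cb k \<le> cb j + (k - j)"
proof -
  have "ca j \<le> ca k \<and> ca k \<le> ca j + (k - j) \<and> cb j \<le> cb k \<and> cb k \<le> cb j + (k - j)"
    using assms
  proof (induction k rule: int_ge_induct)
    case (step k)
    then show ?case using ca_step[of "k + 1"] cb_step[of "k + 1"] by auto
  qed simp
  then show "ca j \<le> ca k" "ca k \<le> ca j + (k - j)" "cb j \<le> cb k" "cb k \<le> cb j + (k - j)" by auto
qed

text \<open>The closed form of \<open>\<Theta>\<close>: on each diagonal, the boxes between the
  points where it meets the two boundary paths.\<close>

definition shape :: "(int \<times> int) set" where
  "shape = {(x, y). - ca (x - y) < y \<and> y \<le> - cb (x - y)}"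

lemma in_shape: "(x, y) \<in> shape \<longleftrightarrow> - ca (x - y) < y \<and> y \<le> - cb (x - y)"
  by (simp add: shape_def)

lemma shape_range: "(x, y) \<in> shape \<Longrightarrow> 0 < x - y \<and> x - y < int n"
  using cb_less_ca_range[of "x - y"] by (auto simp: in_shape)

lemma shape_labels: "label ` shape \<subseteq> {0<..<int n}"
  using shape_range by (auto simp: label_def)

lemma finite_shape: "finite shape"
proof (rule finite_subset)
  show "shape \<subseteq> {- int n..int n} \<times> {- int n..int n}"
  proof clarify
    fix x y assume xy: "(x, y) \<in> shape"
    have "card {l \<in> northern_left n p. int l \<le> x - y} \<le> card {1..n}"
      by (rule card_mono) (auto simp: northern_left_def)
    then have "ca (x - y) \<le> int n" by (simp add: count_upto_def)
    moreover have "0 \<le> cb (x - y)" by (simp add: count_upto_def)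
    ultimately have "- int n < y" "y \<le> 0" using xy by (auto simp: in_shape)
    then show "x \<in> {- int n..int n} \<and> y \<in> {- int n..int n}" using shape_range[OF xy] by auto
  qed
qed simp

text \<open>Both counts are monotone with slope at most 1. Going south and east from the smaller
  box, the label can drop only by as much as \<open>y\<close> grows, so the bound from
  \<open>ca\<close> survives; the bound from \<open>cb\<close> is carried back from the larger box
  in the same way.\<close>

lemma convex_shape: "order_convex shape"
  unfolding order_convex_def
proof clarify
  fix i j i' j' x y
  assume a: "(i, j) \<in> shape" "(i', j') \<in> shape" "(i, j) \<le> (x, y)" "(x, y) \<le> (i', j')"
  have "- ca (x - y) < y"
    using a count_growth(1)[of "i - j" "x - y"] count_growth(2)[of "x - y" "i - j"]
    by (cases "i - j \<le> x - y") (auto simp: in_shape)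
  moreover have "y \<le> - cb (x - y)"
    using a count_growth(3)[of "x - y" "i' - j'"] count_growth(4)[of "i' - j'" "x - y"]
    by (cases "x - y \<le> i' - j'") (auto simp: in_shape)
  ultimately show "(x, y) \<in> shape" by (simp add: in_shape)
qed

lemma skew_shape_shape: "skew_shape shape"
  by (simp add: skew_shape_iff finite_shape convex_shape)

text \<open>The western neighbour of a box lies on the diagonal \<open>k + 1\<close>, hence the
  shift by one. It is missing on a nonempty diagonal \<open>k\<close> iff \<open>k + 1\<close> is no
  northern left endpoint; that vertex is not vertical either, as this would make the counts at
  \<open>k\<close> agree, so it is a right endpoint.\<close>

lemma lower_ends_shape:
  assumes nc: "noncrossing n p"
  shows "lower_ends 1 shape = (\<lambda>m. int m - 1) ` northern_right n p"
    and "lower_ends (- 1) shape = int ` northern_left n p"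
proof -
  have "k \<in> lower_ends 1 shape \<longleftrightarrow> cb k < ca k \<and> ca (k + 1) = ca k" for k
  proof
    assume "k \<in> lower_ends 1 shape"
    then obtain x y where "k = x - y" "(x, y) \<in> shape" "(x, y - 1) \<notin> shape"
      unfolding in_ends_iff[OF convex_shape] by blast
    then have "- ca k < y" "y \<le> - cb k" "\<not> (- ca (k + 1) < y - 1 \<and> y - 1 \<le> - cb (k + 1))"
      by (auto simp: in_shape algebra_simps)
    then show "cb k < ca k \<and> ca (k + 1) = ca k"
      using ca_step[of "k + 1"] cb_step[of "k + 1"] by auto
  next
    assume a: "cb k < ca k \<and> ca (k + 1) = ca k"
    \<comment> \<open>The northwesternmost box on diagonal \<open>k\<close>.\<close>
    then have "(k + 1 - ca k, 1 - ca k) \<in> shape" "(k + 1 - ca k, 1 - ca k - 1) \<notin> shape"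
      by (auto simp: in_shape algebra_simps)
    then show "k \<in> lower_ends 1 shape"
      unfolding in_ends_iff[OF convex_shape] by (intro exI[of _ "k + 1 - ca k"] exI[of _ "1 - ca k"]) auto
  qed
  moreover have "cb k < ca k \<and> ca (k + 1) = ca k \<longleftrightarrow> (\<exists>m\<in>northern_right n p. k = int m - 1)" for k
  proof
    assume a: "cb k < ca k \<and> ca (k + 1) = ca k"
    then have k: "0 < k" "k < int n" using cb_less_ca_range by auto
    define m where "m = nat (k + 1)"
    have m: "int m = k + 1" "m \<in> {1..n}" using k by (auto simp: m_def)
    have "m \<notin> northern_left n p"
    proof
      assume "m \<in> northern_left n p"
      then have "k + 1 \<in> int ` northern_left n p" using m(1) by (metis imageI)
      then show False using a count_upto_pred[of "northern_left n p" "k + 1"] by simp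
    qed
    moreover have "p (Northern m) \<noteq> Southern m"
      using vertical_crossing(2)[OF nc m(2)] a m(1) by auto
    ultimately have "m \<in> northern_right n p"
      using m(2) vertical_iff(1)[OF m(2)] by (auto simp: northern_left_def northern_right_def)
    then show "\<exists>m\<in>northern_right n p. k = int m - 1" using m(1) by (intro bexI[of _ m]) auto
  next
    assume "\<exists>m\<in>northern_right n p. k = int m - 1"
    then obtain m where m: "m \<in> northern_right n p" "k = int m - 1" by blast
    then have "m \<notin> northern_left n p" by (auto simp: northern_left_def northern_right_def)
    then have "ca (int m) = ca (int m - 1)"
      using count_upto_pred[of "northern_left n p" "int m"] by auto
    then show "cb k < ca k \<and> ca (k + 1) = ca k" using northern_right_less[OF m(1)] m(2) by simp
  qed
  ultimately show "lower_ends 1 shape = (\<lambda>m. int m - 1) ` northern_right n p"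
    by (simp add: set_eq_iff image_iff)
  have "k \<in> lower_ends (- 1) shape \<longleftrightarrow> cb k < ca k \<and> ca k = ca (k - 1) + 1" for k
  proof
    assume "k \<in> lower_ends (- 1) shape"
    then obtain x y where "k = x - y" "(x, y) \<in> shape" "(x - 1, y) \<notin> shape"
      unfolding in_ends_iff[OF convex_shape] by blast
    then have "- ca k < y" "y \<le> - cb k" "\<not> (- ca (k - 1) < y \<and> y \<le> - cb (k - 1))"
      by (auto simp: in_shape algebra_simps)
    then show "cb k < ca k \<and> ca k = ca (k - 1) + 1"
      using ca_step[of k] cb_step[of k] by auto
  next
    assume a: "cb k < ca k \<and> ca k = ca (k - 1) + 1"
    then have "(k + 1 - ca k, 1 - ca k) \<in> shape" "(k + 1 - ca k - 1, 1 - ca k) \<notin> shape"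
      by (auto simp: in_shape algebra_simps)
    then show "k \<in> lower_ends (- 1) shape"
      unfolding in_ends_iff[OF convex_shape] by (intro exI[of _ "k + 1 - ca k"] exI[of _ "1 - ca k"]) auto
  qed
  moreover have "cb k < ca k \<and> ca k = ca (k - 1) + 1 \<longleftrightarrow> k \<in> int ` northern_left n p" for k
  proof
    show "cb k < ca k \<and> ca k = ca (k - 1) + 1 \<Longrightarrow> k \<in> int ` northern_left n p"
      using count_upto_pred[of "northern_left n p" k] by (auto split: if_splits)
    assume k: "k \<in> int ` northern_left n p"
    then have "cb k < ca k" using northern_left_less by blast
    then show "cb k < ca k \<and> ca k = ca (k - 1) + 1"
      using count_upto_pred[of "northern_left n p" k] k by simp
  qed
  ultimately show "lower_ends (- 1) shape = int ` northern_left n p" by blast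
qed

lemma upper_ends_shape:
  assumes nc: "noncrossing n p"
  shows "upper_ends (- 1) shape = int ` southern_left n p"
    and "upper_ends 1 shape = (\<lambda>m. int m - 1) ` southern_right n p"
proof -
  have "k \<in> upper_ends (- 1) shape \<longleftrightarrow> cb k < ca k \<and> cb k = cb (k - 1)" for k
  proof
    assume "k \<in> upper_ends (- 1) shape"
    then obtain x y where "k = x - y" "(x, y) \<in> shape" "(x, y + 1) \<notin> shape"
      unfolding in_ends_iff[OF convex_shape] by blast
    then have "- ca k < y" "y \<le> - cb k" "\<not> (- ca (k - 1) < y + 1 \<and> y + 1 \<le> - cb (k - 1))"
      by (auto simp: in_shape algebra_simps)
    then show "cb k < ca k \<and> cb k = cb (k - 1)"
      using ca_step[of k] cb_step[of k] by auto
  next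
    assume a: "cb k < ca k \<and> cb k = cb (k - 1)"
    \<comment> \<open>The southeasternmost box on diagonal \<open>k\<close>.\<close>
    then have "(k - cb k, - cb k) \<in> shape" "(k - cb k, - cb k + 1) \<notin> shape"
      by (auto simp: in_shape algebra_simps)
    then show "k \<in> upper_ends (- 1) shape"
      unfolding in_ends_iff[OF convex_shape] by (intro exI[of _ "k - cb k"] exI[of _ "- cb k"]) auto
  qed
  moreover have "cb k < ca k \<and> cb k = cb (k - 1) \<longleftrightarrow> (\<exists>m\<in>southern_left n p. k = int m)" for k
  proof
    assume a: "cb k < ca k \<and> cb k = cb (k - 1)"
    then have k: "0 < k" "k < int n" using cb_less_ca_range by auto
    define m where "m = nat k"
    have m: "int m = k" "m \<in> {1..n}" using k by (auto simp: m_def)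
    have "m \<notin> southern_right n p"
    proof
      assume "m \<in> southern_right n p"
      then have "k \<in> int ` southern_right n p" using m(1) by (metis imageI)
      then show False using a count_upto_pred[of "southern_right n p" k] by simp
    qed
    moreover have "p (Northern m) \<noteq> Southern m"
      using vertical_crossing(1)[OF nc m(2)] a m(1) by auto
    ultimately have "m \<in> southern_left n p"
      using m(2) vertical_iff(2)[OF m(2)] by (auto simp: southern_left_def southern_right_def)
    then show "\<exists>m\<in>southern_left n p. k = int m" using m(1) by (intro bexI[of _ m]) auto
  next
    assume "\<exists>m\<in>southern_left n p. k = int m"
    then obtain m where m: "m \<in> southern_left n p" "k = int m" by blast
    then have "m \<notin> southern_right n p" by (auto simp: southern_left_def southern_right_def)
    then have "cb (int m) = cb (int m - 1)"
      using count_upto_pred[of "southern_right n p" "int m"] by auto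
    then show "cb k < ca k \<and> cb k = cb (k - 1)" using southern_left_less[OF m(1)] m(2) by simp
  qed
  ultimately show "upper_ends (- 1) shape = int ` southern_left n p"
    by (simp add: set_eq_iff image_iff)
  have "k \<in> upper_ends 1 shape \<longleftrightarrow> cb k < ca k \<and> cb (k + 1) = cb k + 1" for k
  proof
    assume "k \<in> upper_ends 1 shape"
    then obtain x y where "k = x - y" "(x, y) \<in> shape" "(x + 1, y) \<notin> shape"
      unfolding in_ends_iff[OF convex_shape] by blast
    then have "- ca k < y" "y \<le> - cb k" "\<not> (- ca (k + 1) < y \<and> y \<le> - cb (k + 1))"
      by (auto simp: in_shape algebra_simps)
    then show "cb k < ca k \<and> cb (k + 1) = cb k + 1"
      using ca_step[of "k + 1"] cb_step[of "k + 1"] by auto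
  next
    assume a: "cb k < ca k \<and> cb (k + 1) = cb k + 1"
    then have "(k - cb k, - cb k) \<in> shape" "(k - cb k + 1, - cb k) \<notin> shape"
      by (auto simp: in_shape algebra_simps)
    then show "k \<in> upper_ends 1 shape"
      unfolding in_ends_iff[OF convex_shape] by (intro exI[of _ "k - cb k"] exI[of _ "- cb k"]) auto
  qed
  moreover have "cb k < ca k \<and> cb (k + 1) = cb k + 1 \<longleftrightarrow> (\<exists>m\<in>southern_right n p. k = int m - 1)" for k
  proof
    assume "cb k < ca k \<and> cb (k + 1) = cb k + 1"
    then have "k + 1 \<in> int ` southern_right n p"
      using count_upto_pred[of "southern_right n p" "k + 1"] by (auto split: if_splits)
    then obtain m where "m \<in> southern_right n p" "k + 1 = int m" by blast
    then show "\<exists>m\<in>southern_right n p. k = int m - 1" by (intro bexI[of _ m]) auto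
  next
    assume "\<exists>m\<in>southern_right n p. k = int m - 1"
    then obtain m where m: "m \<in> southern_right n p" "k = int m - 1" by blast
    then show "cb k < ca k \<and> cb (k + 1) = cb k + 1"
      using count_upto_pred[of "southern_right n p" "int m"] southern_right_less[OF m(1)] by auto
  qed
  ultimately show "upper_ends 1 shape = (\<lambda>m. int m - 1) ` southern_right n p"
    by (simp add: set_eq_iff image_iff)
qed

section \<open>The boundary of the region as a union of path segments\<close>

definition upper_path :: "int \<Rightarrow> int \<times> int" where
  "upper_path k = (k - ca k, - ca k)"

definition lower_path :: "int \<Rightarrow> int \<times> int" where
  "lower_path k = (k - cb k, - cb k)"

definition upper_segments :: "(int \<times> int) set set" where
  "upper_segments = (\<lambda>k. {upper_path (k - 1), upper_path k}) ` {1..int n}"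

definition lower_segments :: "(int \<times> int) set set" where
  "lower_segments = (\<lambda>k. {lower_path (k - 1), lower_path k}) ` {1..int n}"

text \<open>Stated for any count \<open>c\<close> so that it serves both paths: a step goes south
  where \<open>c\<close> stays constant and west where it grows. Since \<open>x - y\<close> grows by
  1 along every step, the segment determines its index.\<close>

lemma path_segment_iff:
  fixes c :: "int \<Rightarrow> int"
  assumes "\<And>k. c k = c (k - 1) \<or> c k = c (k - 1) + 1"
  defines "S \<equiv> (\<lambda>k. {(k - 1 - c (k - 1), - c (k - 1)), (k - c k, - c k)}) ` {1..int n}"
  shows "{(x - 1, y), (x, y)} \<in> S \<longleftrightarrow> x - y \<in> {1..int n} \<and> c (x - y) = c (x - y - 1) \<and> y = - c (x - y)"
    and "{(x, y - 1), (x, y)} \<in> S \<longleftrightarrow> x - y + 1 \<in> {1..int n} \<and> c (x - y + 1) = c (x - y) + 1 \<and> y = - c (x - y)"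
    and "s \<in> S \<Longrightarrow> \<exists>x y. s = {(x - 1, y), (x, y)} \<or> s = {(x, y - 1), (x, y)}"
proof -
  show "{(x - 1, y), (x, y)} \<in> S \<longleftrightarrow> x - y \<in> {1..int n} \<and> c (x - y) = c (x - y - 1) \<and> y = - c (x - y)"
  proof
    assume "{(x - 1, y), (x, y)} \<in> S"
    then obtain k where k: "{(x - 1, y), (x, y)} = {(k - 1 - c (k - 1), - c (k - 1)), (k - c k, - c k)}" "k \<in> {1..int n}"
      unfolding S_def by (rule imageE)
    have "x - y = k \<and> c k = c (k - 1) \<and> y = - c k"
      using k(1) assms(1)[of k] by (simp only: doubleton_eq_iff prod.inject) linarith
    moreover from this have "x - y = k" by linarith
    ultimately show "x - y \<in> {1..int n} \<and> c (x - y) = c (x - y - 1) \<and> y = - c (x - y)"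
      using k(2) by simp
  next
    assume a: "x - y \<in> {1..int n} \<and> c (x - y) = c (x - y - 1) \<and> y = - c (x - y)"
    then have c: "c (x - y - 1) = - y" "c (x - y) = - y" by linarith+
    have "{(x - 1, y), (x, y)} =
        {(x - y - 1 - c (x - y - 1), - c (x - y - 1)), (x - y - c (x - y), - c (x - y))}"
      unfolding c by simp
    then show "{(x - 1, y), (x, y)} \<in> S" unfolding S_def using a by blast
  qed
  show "{(x, y - 1), (x, y)} \<in> S \<longleftrightarrow> x - y + 1 \<in> {1..int n} \<and> c (x - y + 1) = c (x - y) + 1 \<and> y = - c (x - y)"
  proof
    assume "{(x, y - 1), (x, y)} \<in> S"
    then obtain k where k: "{(x, y - 1), (x, y)} = {(k - 1 - c (k - 1), - c (k - 1)), (k - c k, - c k)}" "k \<in> {1..int n}"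
      unfolding S_def by (rule imageE)
    have "x - y + 1 = k \<and> c k = c (k - 1) + 1 \<and> y = - c (k - 1)"
      using k(1) assms(1)[of k] by (simp only: doubleton_eq_iff prod.inject) linarith
    moreover from this have "x - y = k - 1" by linarith
    ultimately show "x - y + 1 \<in> {1..int n} \<and> c (x - y + 1) = c (x - y) + 1 \<and> y = - c (x - y)"
      using k(2) by simp
  next
    assume a: "x - y + 1 \<in> {1..int n} \<and> c (x - y + 1) = c (x - y) + 1 \<and> y = - c (x - y)"
    then have c: "c (x - y + 1 - 1) = - y" "c (x - y + 1) = - y + 1" by simp_all
    have "{(x, y - 1), (x, y)} = {(x - y + 1 - 1 - c (x - y + 1 - 1), - c (x - y + 1 - 1)),
        (x - y + 1 - c (x - y + 1), - c (x - y + 1))}"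
      unfolding c by (simp add: insert_commute)
    then show "{(x, y - 1), (x, y)} \<in> S" unfolding S_def using a by blast
  qed
  assume "s \<in> S"
  then obtain k where k: "s = {(k - 1 - c (k - 1), - c (k - 1)), (k - c k, - c k)}" unfolding S_def by (rule imageE)
  consider "c k = c (k - 1)" | "c k = c (k - 1) + 1" using assms(1) by blast
  then show "\<exists>x y. s = {(x - 1, y), (x, y)} \<or> s = {(x, y - 1), (x, y)}"
  proof cases
    case 1
    then have "s = {(k - c k - 1, - c k), (k - c k, - c k)}" using k by (simp add: algebra_simps)
    then show ?thesis by blast
  next
    case 2
    then have "k - 1 - c (k - 1) = k - c k" "- c k = - c (k - 1) - 1" by linarith+
    then have "s = {(k - c k, - c (k - 1) - 1), (k - c k, - c (k - 1))}" unfolding k by (simp only: insert_commute)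
    then show ?thesis by blast
  qed
qed

lemmas upper_segment_iff = path_segment_iff[of ca, OF ca_step, folded upper_path_def, folded upper_segments_def]
lemmas lower_segment_iff = path_segment_iff[of cb, OF cb_step, folded lower_path_def, folded lower_segments_def]

text \<open>A segment separates a box of the region from its complement iff it lies on exactly one
  of the two paths; segments common to both have no box of the region on either side.\<close>

lemma boundary_shape: "boundary shape = {s. (s \<in> upper_segments) \<noteq> (s \<in> lower_segments)}"
proof -
  \<comment> \<open>No edge crosses outside the range of the positions, so both paths coincide there
    and the diagonals are empty.\<close>
  have eq: "ca k = cb k \<and> ca (k - 1) = cb (k - 1)" if "k \<notin> {1..int n}" for k
    using that cb_less_ca_range[of k] cb_less_ca_range[of "k - 1"] cb_le_ca[of k] cb_le_ca[of "k - 1"] by force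
  have vert: "{(x - 1, y), (x, y)} \<in> boundary shape \<longleftrightarrow>
      ({(x - 1, y), (x, y)} \<in> upper_segments) \<noteq> ({(x - 1, y), (x, y)} \<in> lower_segments)" for x y
  proof -
    have e: "x - (y + 1) = x - y - 1" by simp
    show ?thesis
    proof (cases "x - y \<in> {1..int n}")
      case True
      show ?thesis
        unfolding boundary_iff(1) upper_segment_iff(1) lower_segment_iff(1) in_shape e
        by (rule segment_xor(1)[OF True ca_step cb_step cb_le_ca cb_le_ca])
    next
      case False
      show ?thesis
        unfolding boundary_iff(1) upper_segment_iff(1) lower_segment_iff(1) in_shape e
        by (rule segment_xor_outside(1)[OF False eq[OF False]])
    qed
  qed
  have hor: "{(x, y - 1), (x, y)} \<in> boundary shape \<longleftrightarrow>
      ({(x, y - 1), (x, y)} \<in> upper_segments) \<noteq> ({(x, y - 1), (x, y)} \<in> lower_segments)" for x y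
  proof -
    have e: "x + 1 - y = x - y + 1" "x - y + 1 - 1 = x - y" by simp_all
    note steps = ca_step[of "x - y + 1", unfolded e(2)] cb_step[of "x - y + 1", unfolded e(2)]
    show ?thesis
    proof (cases "x - y + 1 \<in> {1..int n}")
      case True
      show ?thesis
        unfolding boundary_iff(2) upper_segment_iff(2) lower_segment_iff(2) in_shape e
        by (rule segment_xor(2)[OF True steps cb_le_ca cb_le_ca])
    next
      case False
      show ?thesis
        unfolding boundary_iff(2) upper_segment_iff(2) lower_segment_iff(2) in_shape e
        by (rule segment_xor_outside(2)[OF False eq[OF False, unfolded e(2)]])
    qed
  qed
  show ?thesis
  proof (intro set_eqI iffI)
    fix s assume s: "s \<in> boundary shape"
    then obtain b where "s \<in> sides b" unfolding boundary_def by blast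
    then show "s \<in> {s. (s \<in> upper_segments) \<noteq> (s \<in> lower_segments)}"
    proof (rule side_cases)
      fix x y assume "s = {(x - 1, y), (x, y)}"
      then show ?thesis using s vert[of x y] by simp
    next
      fix x y assume "s = {(x, y - 1), (x, y)}"
      then show ?thesis using s hor[of x y] by simp
    qed
  next
    fix s assume s: "s \<in> {s. (s \<in> upper_segments) \<noteq> (s \<in> lower_segments)}"
    then have "s \<in> upper_segments \<or> s \<in> lower_segments" by auto
    then obtain x y where "s = {(x - 1, y), (x, y)} \<or> s = {(x, y - 1), (x, y)}"
      using upper_segment_iff(3)[of s] lower_segment_iff(3)[of s] by metis
    then show "s \<in> boundary shape"
      using s vert[of x y] hor[of x y] by (elim disjE) simp_all
  qed
qed

end

section \<open>The closed walk prescribed by the compass directions\<close>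

context pairing
begin

lemma count_zero: "ca 0 = 0" "cb 0 = 0"
proof -
  have "{l \<in> northern_left n p. int l \<le> 0} = {}" "{l \<in> southern_right n p. int l \<le> 0} = {}"
    by (auto simp: northern_left_def southern_right_def)
  then show "ca 0 = 0" "cb 0 = 0" by (simp_all only: count_upto_def card.empty of_nat_0)
qed

lemma count_end: "ca (int n) = cb (int n)"
  using cb_less_ca_range[of "int n"] cb_le_ca[of "int n"] by force

text \<open>The walk after \<open>k\<close> steps: forward along the upper path up to time
  \<open>n\<close>, then backward along the lower path. Both paths end at the same point by
  \<open>count_end\<close>.\<close>

definition contour :: "nat \<Rightarrow> int \<times> int" where
  "contour k = (if k \<le> n then upper_path (int k) else lower_path (2 * int n - int k))"

definition contour_direction :: "nat \<Rightarrow> compass" where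
  "contour_direction k = (if k < n then (if Suc k \<in> northern_left n p then West else South)
     else (if 2 * n - k \<in> southern_right n p then East else North))"

lemma upper_path_end: "upper_path (int n) = lower_path (int n)"
  by (simp add: upper_path_def lower_path_def count_end)

lemma contour_Suc:
  assumes "k < 2 * n"
  shows "contour (Suc k) = move (contour_direction k) (contour k)"
proof (cases "k < n")
  case True
  have "ca (int k + 1) = ca (int k) + (if Suc k \<in> northern_left n p then 1 else 0)"
    using count_upto_pred[of "northern_left n p" "int (Suc k)"]
    by (simp add: inj_image_mem_iff add.commute del: of_nat_Suc) (simp add: add.commute)
  then show ?thesis using True
    by (auto simp: contour_def contour_direction_def upper_path_def add.commute)
next
  case False
  \<comment> \<open>At time \<open>k\<close> the walk deals with the southern vertex at position
    \<open>m\<close>, from \<open>n\<close> down to 1. As the lower path is run backwards, its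
    southward steps become \<open>North\<close> and its westward steps \<open>East\<close>.\<close>
  define m where "m = 2 * n - k"
  have m: "1 \<le> m" "m \<le> n" "2 * int n - int k = int m" "2 * int n - int (Suc k) = int m - 1"
    using assms False by (auto simp: m_def)
  have c: "contour k = lower_path (int m)" "contour (Suc k) = lower_path (int m - 1)"
    unfolding contour_def m(3,4) using False m(1,2) upper_path_end by (auto simp: le_less m_def)
  have "cb (int m) = cb (int m - 1) + (if m \<in> southern_right n p then 1 else 0)"
    using count_upto_pred[of "southern_right n p" "int m"] by (simp add: inj_image_mem_iff)
  then show ?thesis
    unfolding c using False by (simp add: contour_direction_def m_def[symmetric] lower_path_def)
qed

lemma contour_segments:
  "s \<in> (\<lambda>k. {contour k, contour (Suc k)}) ` {0..<n} \<longleftrightarrow> s \<in> upper_segments"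
  "s \<in> (\<lambda>k. {contour k, contour (Suc k)}) ` {n..<2 * n} \<longleftrightarrow> s \<in> lower_segments"
proof -
  have "(\<lambda>k. {contour k, contour (Suc k)}) ` {0..<n} = (\<lambda>k. {upper_path (int (Suc k) - 1), upper_path (int (Suc k))}) ` {0..<n}"
    by (rule image_cong) (auto simp: contour_def)
  also have "\<dots> = (\<lambda>k. {upper_path (k - 1), upper_path k}) ` (\<lambda>k. int (Suc k)) ` {0..<n}"
    by (simp only: image_image)
  also have "(\<lambda>k. int (Suc k)) ` {0..<n} = {1..int n}"
  proof
    show "{1..int n} \<subseteq> (\<lambda>k. int (Suc k)) ` {0..<n}"
    proof
      fix k assume "k \<in> {1..int n}"
      then show "k \<in> (\<lambda>k. int (Suc k)) ` {0..<n}" by (intro image_eqI[of _ _ "nat (k - 1)"]) auto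
    qed
  qed auto
  finally show "s \<in> (\<lambda>k. {contour k, contour (Suc k)}) ` {0..<n} \<longleftrightarrow> s \<in> upper_segments"
    by (simp only: upper_segments_def)
  have "(\<lambda>k. {contour k, contour (Suc k)}) ` {n..<2 * n} =
      (\<lambda>k. {lower_path (2 * int n - int k - 1), lower_path (2 * int n - int k)}) ` {n..<2 * n}"
  proof (rule image_cong)
    fix k assume "k \<in> {n..<2 * n}"
    then have "contour k = lower_path (2 * int n - int k)" "contour (Suc k) = lower_path (2 * int n - int k - 1)"
      using upper_path_end by (auto simp: contour_def le_less algebra_simps)
    then show "{contour k, contour (Suc k)} = {lower_path (2 * int n - int k - 1), lower_path (2 * int n - int k)}"
      by (simp add: insert_commute)
  qed simp
  also have "\<dots> = (\<lambda>k. {lower_path (k - 1), lower_path k}) ` (\<lambda>k. 2 * int n - int k) ` {n..<2 * n}"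
    by (simp only: image_image)
  also have "(\<lambda>k. 2 * int n - int k) ` {n..<2 * n} = {1..int n}"
  proof
    show "{1..int n} \<subseteq> (\<lambda>k. 2 * int n - int k) ` {n..<2 * n}"
    proof
      fix k assume "k \<in> {1..int n}"
      then show "k \<in> (\<lambda>k. 2 * int n - int k) ` {n..<2 * n}" by (intro image_eqI[of _ _ "nat (2 * int n - k)"]) auto
    qed
  qed auto
  finally show "s \<in> (\<lambda>k. {contour k, contour (Suc k)}) ` {n..<2 * n} \<longleftrightarrow> s \<in> lower_segments"
    by (simp only: lower_segments_def)
qed

text \<open>In each half of the walk the label changes by 1 in a fixed direction, so the pair of
  labels at the ends of a segment identifies the step.\<close>

lemma contour_segment_inj:
  "inj_on (\<lambda>k. {contour k, contour (Suc k)}) {0..<n}"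
  "inj_on (\<lambda>k. {contour k, contour (Suc k)}) {n..<2 * n}"
proof -
  have label: "label (contour k) = (if k \<le> n then int k else 2 * int n - int k)" for k
    by (simp add: contour_def upper_path_def lower_path_def label_def)
  have sum: "label ` {contour k, contour (Suc k)} = {label (contour k), label (contour (Suc k))}" for k
    by simp
  show "inj_on (\<lambda>k. {contour k, contour (Suc k)}) {0..<n}"
  proof (rule inj_onI)
    fix j k assume a: "j \<in> {0..<n}" "k \<in> {0..<n}" "{contour j, contour (Suc j)} = {contour k, contour (Suc k)}"
    then have "{label (contour j), label (contour (Suc j))} = {label (contour k), label (contour (Suc k))}"
      by (metis sum)
    then show "j = k" using a(1,2) by (auto simp: label doubleton_eq_iff)
  qed
  show "inj_on (\<lambda>k. {contour k, contour (Suc k)}) {n..<2 * n}"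
  proof (rule inj_onI)
    fix j k assume a: "j \<in> {n..<2 * n}" "k \<in> {n..<2 * n}" "{contour j, contour (Suc j)} = {contour k, contour (Suc k)}"
    then have "{label (contour j), label (contour (Suc j))} = {label (contour k), label (contour (Suc k))}"
      by (metis sum)
    then show "j = k" using a(1,2) by (auto simp: label doubleton_eq_iff split: if_splits)
  qed
qed

text \<open>Each half contributes a segment at most once, so multiplicity 2 means that the segment
  lies on both paths.\<close>

lemma contour_segment_list:
  "{s \<in> set (map (\<lambda>k. {contour k, contour (Suc k)}) [0..<2 * n]).
      count_list (map (\<lambda>k. {contour k, contour (Suc k)}) [0..<2 * n]) s \<noteq> 2} =
    {s. (s \<in> upper_segments) \<noteq> (s \<in> lower_segments)}"
proof -
  define g where "g k = {contour k, contour (Suc k)}" for k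
  have split: "[0..<2 * n] = [0..<n] @ [n..<2 * n]"
    using upt_add_eq_append[of 0 n n] by (simp add: mult_2)
  have "count_list (map g [0..<n]) s = (if s \<in> upper_segments then 1 else 0)" for s
    using count_list_distinct[of "map g [0..<n]" s] contour_segment_inj(1) contour_segments(1)[of s]
    by (simp add: distinct_map g_def[abs_def])
  moreover have "count_list (map g [n..<2 * n]) s = (if s \<in> lower_segments then 1 else 0)" for s
    using count_list_distinct[of "map g [n..<2 * n]" s] contour_segment_inj(2) contour_segments(2)[of s]
    by (simp add: distinct_map g_def[abs_def])
  ultimately have "count_list (map g [0..<2 * n]) s =
      (if s \<in> upper_segments then 1 else 0) + (if s \<in> lower_segments then 1 else 0)" for s
    by (simp add: split)
  moreover have "s \<in> set (map g [0..<2 * n]) \<longleftrightarrow> s \<in> upper_segments \<or> s \<in> lower_segments" for s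
    unfolding split map_append set_append set_map Un_iff set_upt g_def contour_segments ..
  ultimately have "{s \<in> set (map g [0..<2 * n]). count_list (map g [0..<2 * n]) s \<noteq> 2} =
    {s. (s \<in> upper_segments) \<noteq> (s \<in> lower_segments)}"
    by auto
  then show ?thesis by (simp only: g_def[abs_def])
qed

end

lemma directions_eq:
  assumes d: "d \<in> matchings n"
  shows "directions n d = map (pairing.contour_direction n (partner d)) [0..<2 * n]"
proof -
  interpret pairing n "partner d" using d by (rule pairing_partner)
  have north: "\<xi> d (Northern k) = (if k \<in> northern_left n (partner d) then West else South)" if "k \<in> {1..n}" for k
    using that edge_iff_partner[OF d] by (auto simp: northern_left_def)
  have south: "\<xi> d (Southern k) = (if k \<in> southern_right n (partner d) then East else North)" if "k \<in> {1..n}" for k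
    using that edge_iff_partner[OF d] by (auto simp: southern_right_def)
  show ?thesis
  proof (rule nth_equalityI)
    show "length (directions n d) = length (map contour_direction [0..<2 * n])"
      by (simp add: directions_def)
    fix k assume "k < length (directions n d)"
    then have k: "k < 2 * n" by (simp add: directions_def del: upt_Suc)
    show "directions n d ! k = map contour_direction [0..<2 * n] ! k"
    proof (cases "k < n")
      case True
      then show ?thesis
        using north[of "Suc k"] k by (simp add: directions_def nth_append contour_direction_def del: upt_Suc \<xi>.simps)
    next
      case False
      have "Suc (n + n - Suc k) = 2 * n - k" using k by simp
      then have "rev [1..<Suc n] ! (k - n) = 2 * n - k"
        using k False by (simp add: rev_nth del: upt_Suc)
      moreover have "2 * n - k \<in> {1..n}" using k False by auto
      ultimately show ?thesis
        using south[of "2 * n - k"] k False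
        by (simp add: directions_def nth_append contour_direction_def rev_map del: upt_Suc \<xi>.simps)
    qed
  qed
qed

lemma remaining_segments_eq:
  assumes d: "d \<in> matchings n"
  shows "remaining_segments n d = boundary (pairing.shape n (partner d))"
proof -
  interpret pairing n "partner d" using d by (rule pairing_partner)
  have "contour 0 = (0, 0)" by (simp add: contour_def upper_path_def count_zero)
  moreover have "segments (contour 0) (map contour_direction [0..<2 * n]) =
      map (\<lambda>k. {contour k, contour (Suc k)}) [0..<length (map contour_direction [0..<2 * n])]"
    by (rule segments_eq_map) (simp add: contour_Suc)
  ultimately have "segments (0, 0) (directions n d) = map (\<lambda>k. {contour k, contour (Suc k)}) [0..<2 * n]"
    by (simp add: directions_eq[OF d])
  then show ?thesis
    unfolding remaining_segments_def Let_def boundary_shape by (simp only: contour_segment_list)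
qed

lemma bounded_shape_iff:
  assumes d: "d \<in> matchings n"
  shows "bounded_shape n d B \<longleftrightarrow> B = pairing.shape n (partner d)"
proof -
  interpret pairing n "partner d" using d by (rule pairing_partner)
  show ?thesis
    unfolding bounded_shape_def remaining_segments_eq[OF d]
    using skew_shape_shape boundary_inj skew_shape_finite by blast
qed

lemma \<Theta>_eq:
  assumes "d \<in> matchings n"
  shows "\<Theta> n d = pairing.shape n (partner d)"
  unfolding \<Theta>_def bounded_shape_iff[OF assms] by simp

section \<open>Normal forms and the bijection\<close>

lemma image_pred_eq_iff:
  "(\<lambda>m. int m - 1) ` A = (\<lambda>m. int m - 1) ` B \<longleftrightarrow> A = B"
  by (rule inj_image_eq_iff) (simp add: inj_def)

text \<open>These endpoint sets fix the row ends of the shape, hence its BJS class, hence its column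
  ends, and these encode the sets required by \<open>noncrossing_unique\<close>.\<close>

lemma noncrossing_unique_right_left:
  assumes p: "pairing n p" "noncrossing n p" and q: "pairing n q" "noncrossing n q"
    and eq: "northern_right n p = northern_right n q" "southern_left n p = southern_left n q"
    and x: "x \<in> vertices n"
  shows "p x = q x"
proof -
  interpret p: pairing n p by fact
  interpret q: pairing n q by fact
  have "(p.shape, q.shape) \<in> BJS"
    by (rule ends_imp_BJS)
      (simp_all add: p.skew_shape_shape q.skew_shape_shape p.lower_ends_shape[OF p(2)] q.lower_ends_shape[OF q(2)]
        p.upper_ends_shape[OF p(2)] q.upper_ends_shape[OF q(2)] eq)
  then have "int ` northern_left n p = int ` northern_left n q"
    "(\<lambda>m. int m - 1) ` southern_right n p = (\<lambda>m. int m - 1) ` southern_right n q"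
    using BJS_ends(1)[of p.shape q.shape "- 1"] BJS_ends(2)[of p.shape q.shape 1]
    by (simp_all add: p.lower_ends_shape[OF p(2)] q.lower_ends_shape[OF q(2)]
        p.upper_ends_shape[OF p(2)] q.upper_ends_shape[OF q(2)])
  then have "northern_left n p = northern_left n q" "southern_right n p = southern_right n q"
    by (simp_all add: image_pred_eq_iff inj_image_eq_iff)
  then show ?thesis using noncrossing_unique[OF p(1) q(1) p(2) q(2) _ _ x] by blast
qed

lemma evaluates_diagram:
  assumes "evaluates n \<delta> w p"
  shows "matching_of n p \<in> diagrams n"
    and "\<And>v. v \<in> vertices n \<Longrightarrow> partner (matching_of n p) v = p v"
  using assms matching_of_diagram pairing.partner_matching_of by (auto simp: evaluates_def)

lemma matching_of_eqI:
  assumes "d \<in> matchings n" "\<And>v. v \<in> vertices n \<Longrightarrow> p v = partner d v"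
  shows "matching_of n p = d"
  using matching_of_partner[OF assms(1)] assms(2) by (simp add: matching_of_def cong: image_cong)

lemma jones_normal_form_row_reading_word:
  assumes d: "d \<in> diagrams n"
  shows "is_jones_normal_form_of n (\<delta> :: 'k::comm_ring_1) (row_reading_word (\<Theta> n d)) d"
proof -
  have dm: "d \<in> matchings n" and nc: "noncrossing n (partner d)" using d by (auto simp: diagrams_iff)
  interpret pairing n "partner d" using dm by (rule pairing_partner)
  obtain js ks where w: "list_all2 (\<ge>) js ks" "set js \<subseteq> {0<..<n}" "set ks \<subseteq> {0<..<n}"
      "sorted_wrt (<) js" "sorted_wrt (<) ks"
      "row_reading_word shape = concat (map2 (\<lambda>j k. rev [k..<Suc j]) js ks)"
      "int ` set js = lower_ends 1 shape" "int ` set ks = upper_ends (- 1) shape"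
    by (rule row_reading_word_jones[OF finite_shape convex_shape shape_labels])
  have types: "northern_right n (partner d) = Suc ` set js" "southern_left n (partner d) = set ks"
  proof -
    have "(\<lambda>m. int m - 1) ` northern_right n (partner d) = (\<lambda>m. int m - 1) ` Suc ` set js"
      using w(7) lower_ends_shape[OF nc] by (simp add: image_image)
    then show "northern_right n (partner d) = Suc ` set js" by (simp only: image_pred_eq_iff)
    show "southern_left n (partner d) = set ks"
      using w(8) upper_ends_shape[OF nc] by (simp add: inj_image_eq_iff)
  qed
  have val: "word_value n \<delta> (row_reading_word shape) = tl_basis d"
  proof -
    obtain p where p: "evaluates n \<delta> (row_reading_word shape) p"
      "northern_right n p = Suc ` set js" "southern_left n p = set ks"
      unfolding w(6) using jones_word_evaluates[OF w(1-5)] by metis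
    have "matching_of n p = d"
      using p types nc by (intro matching_of_eqI[OF dm] noncrossing_unique_right_left[OF _ _ pairing_axioms]) (auto simp: evaluates_def)
    then show ?thesis using p(1) by (simp add: evaluates_def)
  qed
  have form: "jones_form n (row_reading_word shape)"
    unfolding jones_form_def using w by blast
  \<comment> \<open>The lists \<open>js'\<close> and \<open>ks'\<close> of any competing word
    reappear as endpoint sets of \<open>d\<close>, and strictly increasing lists are determined by
    their sets.\<close>
  have unique: "v = row_reading_word shape" if v: "jones_form n v" "word_value n \<delta> v = tl_basis d" for v
  proof -
    obtain js' ks' where v': "list_all2 (\<ge>) js' ks'" "set js' \<subseteq> {0<..<n}" "set ks' \<subseteq> {0<..<n}"
      "sorted_wrt (<) js'" "sorted_wrt (<) ks'" "v = concat (map2 (\<lambda>j k. rev [k..<Suc j]) js' ks')"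
      using v(1) unfolding jones_form_def by blast
    obtain p where p: "evaluates n \<delta> v p" "northern_right n p = Suc ` set js'" "southern_left n p = set ks'"
      unfolding v'(6) using jones_word_evaluates[OF v'(1-5)] by metis
    have "tl_basis (matching_of n p) = (tl_basis d :: _ \<Rightarrow> 'k)" using p(1) v(2) by (simp add: evaluates_def)
    then have "matching_of n p = d" by (simp only: tl_basis_inj)
    then have "partner d x = p x" if "x \<in> vertices n" for x
      using evaluates_diagram(2)[OF p(1) that] by simp
    then have "Suc ` set js = Suc ` set js'" "set ks = set ks'"
      using types p types_cong[of n "partner d" p] by simp_all
    then have "js = js'" "ks = ks'"
      using w v' by (simp_all add: inj_image_eq_iff strict_sorted_equal)
    then show ?thesis using w(6) v'(6) by simp
  qed
  show ?thesis
    unfolding is_jones_normal_form_of_def \<Theta>_eq[OF dm] using val form unique by blast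
qed

lemma dual_jones_normal_form_column_reading_word:
  assumes d: "d \<in> diagrams n"
  shows "is_dual_jones_normal_form_of n (\<delta> :: 'k::comm_ring_1) (column_reading_word (\<Theta> n d)) d"
proof -
  have dm: "d \<in> matchings n" and nc: "noncrossing n (partner d)" using d by (auto simp: diagrams_iff)
  interpret pairing n "partner d" using dm by (rule pairing_partner)
  obtain as bs where w: "list_all2 (\<le>) as bs" "set as \<subseteq> {0<..<n}" "set bs \<subseteq> {0<..<n}"
      "sorted_wrt (>) as" "sorted_wrt (>) bs"
      "column_reading_word shape = concat (map2 (\<lambda>a b. [a..<Suc b]) as bs)"
      "int ` set as = lower_ends (- 1) shape" "int ` set bs = upper_ends 1 shape"
    by (rule column_reading_word_dual_jones[OF finite_shape convex_shape shape_labels])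
  have types: "northern_left n (partner d) = set as" "southern_right n (partner d) = Suc ` set bs"
  proof -
    show "northern_left n (partner d) = set as"
      using w(7) lower_ends_shape[OF nc] by (simp add: inj_image_eq_iff)
    have "(\<lambda>m. int m - 1) ` southern_right n (partner d) = (\<lambda>m. int m - 1) ` Suc ` set bs"
      using w(8) upper_ends_shape[OF nc] by (simp add: image_image)
    then show "southern_right n (partner d) = Suc ` set bs" by (simp only: image_pred_eq_iff)
  qed
  have val: "word_value n \<delta> (column_reading_word shape) = tl_basis d"
  proof -
    obtain p where p: "evaluates n \<delta> (column_reading_word shape) p"
      "northern_left n p = set as" "southern_right n p = Suc ` set bs"
      unfolding w(6) using dual_jones_word_evaluates[OF w(1-5)] by metis
    have "matching_of n p = d"
      using p types nc by (intro matching_of_eqI[OF dm] noncrossing_unique[OF _ pairing_axioms]) (auto simp: evaluates_def)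
    then show ?thesis using p(1) by (simp add: evaluates_def)
  qed
  have form: "dual_jones_form n (column_reading_word shape)"
    unfolding dual_jones_form_def using w by blast
  have unique: "v = column_reading_word shape" if v: "dual_jones_form n v" "word_value n \<delta> v = tl_basis d" for v
  proof -
    obtain as' bs' where v': "list_all2 (\<le>) as' bs'" "set as' \<subseteq> {0<..<n}" "set bs' \<subseteq> {0<..<n}"
      "sorted_wrt (>) as'" "sorted_wrt (>) bs'" "v = concat (map2 (\<lambda>a b. [a..<Suc b]) as' bs')"
      using v(1) unfolding dual_jones_form_def by blast
    obtain p where p: "evaluates n \<delta> v p" "northern_left n p = set as'" "southern_right n p = Suc ` set bs'"
      unfolding v'(6) using dual_jones_word_evaluates[OF v'(1-5)] by metis
    have "tl_basis (matching_of n p) = (tl_basis d :: _ \<Rightarrow> 'k)" using p(1) v(2) by (simp add: evaluates_def)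
    then have "matching_of n p = d" by (simp only: tl_basis_inj)
    then have "partner d x = p x" if "x \<in> vertices n" for x
      using evaluates_diagram(2)[OF p(1) that] by simp
    then have sets: "set as = set as'" "set bs = set bs'"
      using types p types_cong[of n "partner d" p] by (simp_all add: inj_image_eq_iff)
    have "rev as = rev as'" "rev bs = rev bs'"
      by (rule strict_sorted_equal; use w(4,5) v'(4,5) sets in \<open>simp add: sorted_wrt_rev\<close>)+
    then show ?thesis using w(6) v'(6) by simp
  qed
  show ?thesis
    unfolding is_dual_jones_normal_form_of_def \<Theta>_eq[OF dm] using val form unique by blast
qed

lemma \<Theta>_skew_shape:
  assumes "d \<in> diagrams n"
  shows "skew_shape (\<Theta> n d)" "label ` \<Theta> n d \<subseteq> {0<..<int n}"
proof -
  have dm: "d \<in> matchings n" using assms by (simp add: diagrams_iff)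
  interpret pairing n "partner d" using dm by (rule pairing_partner)
  show "skew_shape (\<Theta> n d)" "label ` \<Theta> n d \<subseteq> {0<..<int n}"
    using skew_shape_shape shape_labels by (simp_all add: \<Theta>_eq[OF dm])
qed

lemma \<Theta>_inj:
  assumes d: "d \<in> diagrams n" and d': "d' \<in> diagrams n" and eq: "(\<Theta> n d, \<Theta> n d') \<in> BJS"
  shows "d = d'"
proof -
  have m: "d \<in> matchings n" "d' \<in> matchings n" and nc: "noncrossing n (partner d)" "noncrossing n (partner d')"
    using d d' by (auto simp: diagrams_iff)
  interpret p: pairing n "partner d" using m(1) by (rule pairing_partner)
  interpret q: pairing n "partner d'" using m(2) by (rule pairing_partner)
  have B: "(p.shape, q.shape) \<in> BJS" using eq by (simp add: \<Theta>_eq m)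
  have "northern_left n (partner d) = northern_left n (partner d')"
    using BJS_ends(1)[OF B, of "- 1"] p.lower_ends_shape[OF nc(1)] q.lower_ends_shape[OF nc(2)]
    by (simp add: inj_image_eq_iff)
  moreover have "southern_right n (partner d) = southern_right n (partner d')"
    using BJS_ends(2)[OF B, of 1] p.upper_ends_shape[OF nc(1)] q.upper_ends_shape[OF nc(2)]
    by (simp add: image_pred_eq_iff)
  ultimately show ?thesis
    using noncrossing_unique[OF p.pairing_axioms q.pairing_axioms nc] by (intro matching_eqI[OF m]) blast
qed

text \<open>The diagram is the value of the row reading word of \<open>A\<close>. Its endpoint sets
  are read off from the row ends of \<open>A\<close>, so its shape has the same row ends.\<close>

lemma \<Theta>_surj:
  assumes A: "skew_shape A" "label ` A \<subseteq> {0<..<int n}"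
  shows "\<exists>d\<in>diagrams n. (A, \<Theta> n d) \<in> BJS"
proof -
  have A': "finite A" "order_convex A" using A(1) by (simp_all add: skew_shape_iff)
  obtain js ks where w: "list_all2 (\<ge>) js ks" "set js \<subseteq> {0<..<n}" "set ks \<subseteq> {0<..<n}"
      "sorted_wrt (<) js" "sorted_wrt (<) ks"
      "row_reading_word A = concat (map2 (\<lambda>j k. rev [k..<Suc j]) js ks)"
      "int ` set js = lower_ends 1 A" "int ` set ks = upper_ends (- 1) A"
    by (rule row_reading_word_jones[OF A' A(2)])
  \<comment> \<open>The ring and the parameter are arbitrary here; only the partner function
    \<open>q\<close> is kept.\<close>
  obtain q where q: "evaluates n (1::int) (row_reading_word A) q"
      "northern_right n q = Suc ` set js" "southern_left n q = set ks"
    unfolding w(6) using jones_word_evaluates[OF w(1-5)] by metis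
  define d where "d = matching_of n q"
  have d: "d \<in> diagrams n" and pd: "\<And>v. v \<in> vertices n \<Longrightarrow> partner d v = q v"
    unfolding d_def using evaluates_diagram[OF q(1)] by blast+
  have dm: "d \<in> matchings n" and nc: "noncrossing n (partner d)" using d by (auto simp: diagrams_iff)
  interpret pairing n "partner d" using dm by (rule pairing_partner)
  have "lower_ends 1 A = lower_ends 1 shape"
    using w(7) q(2) types_cong(2)[OF pd] lower_ends_shape(1)[OF nc] by (simp add: image_image)
  moreover have "upper_ends (- 1) A = upper_ends (- 1) shape"
    using w(8) q(3) types_cong(3)[OF pd] upper_ends_shape(1)[OF nc] by simp
  ultimately have "(A, \<Theta> n d) \<in> BJS"
    unfolding \<Theta>_eq[OF dm] using ends_imp_BJS[OF A(1) skew_shape_shape] by blast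
  then show ?thesis using d by blast
qed

lemma BJS_class_eq_iff:
  assumes "skew_shape A" "skew_shape B"
  shows "BJS `` {A} = BJS `` {B} \<longleftrightarrow> (A, B) \<in> BJS"
proof
  assume "BJS `` {A} = BJS `` {B}"
  moreover have "(B, B) \<in> BJS" using assms by (simp add: BJS_iff)
  ultimately show "(A, B) \<in> BJS" by blast
next
  assume "(A, B) \<in> BJS"
  then show "BJS `` {A} = BJS `` {B}"
    using assms by (auto simp: BJS_iff)
qed

text \<open>The first conjunct guarantees that the definite description in \<open>\<Theta>\<close>
  denotes the shape bounded by the remaining segments.\<close>

theorem theorem7p5:
  fixes n :: nat and \<delta> :: "'k::comm_ring_1"
  assumes "n \<ge> 1"
  shows "(\<forall>d\<in>diagrams n. \<exists>!B. bounded_shape n d B) \<and>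
    bij_betw (\<lambda>d. BJS `` {\<Theta> n d}) (diagrams n)
      ({A. skew_shape A \<and> label ` A \<subseteq> {0<..<int n}} // BJS) \<and>
    (\<forall>d\<in>diagrams n.
      is_jones_normal_form_of n \<delta> (row_reading_word (\<Theta> n d)) d \<and>
      is_dual_jones_normal_form_of n \<delta> (column_reading_word (\<Theta> n d)) d)"
proof (intro conjI ballI)
  fix d assume "d \<in> diagrams n"
  then show "\<exists>!B. bounded_shape n d B" by (simp add: diagrams_iff bounded_shape_iff)
next
  show "bij_betw (\<lambda>d. BJS `` {\<Theta> n d}) (diagrams n)
      ({A. skew_shape A \<and> label ` A \<subseteq> {0<..<int n}} // BJS)"
    unfolding bij_betw_def
  proof
    show "inj_on (\<lambda>d. BJS `` {\<Theta> n d}) (diagrams n)"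
      by (rule inj_onI) (simp add: BJS_class_eq_iff \<Theta>_skew_shape \<Theta>_inj)
    show "(\<lambda>d. BJS `` {\<Theta> n d}) ` diagrams n = {A. skew_shape A \<and> label ` A \<subseteq> {0<..<int n}} // BJS"
    proof
      show "(\<lambda>d. BJS `` {\<Theta> n d}) ` diagrams n \<subseteq> {A. skew_shape A \<and> label ` A \<subseteq> {0<..<int n}} // BJS"
        using \<Theta>_skew_shape by (intro image_subsetI quotientI) simp
      show "{A. skew_shape A \<and> label ` A \<subseteq> {0<..<int n}} // BJS \<subseteq> (\<lambda>d. BJS `` {\<Theta> n d}) ` diagrams n"
      proof
        fix C assume "C \<in> {A. skew_shape A \<and> label ` A \<subseteq> {0<..<int n}} // BJS"
        then obtain A where A: "C = BJS `` {A}" "skew_shape A" "label ` A \<subseteq> {0<..<int n}"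
          by (auto elim!: quotientE)
        then obtain d where d: "d \<in> diagrams n" "(A, \<Theta> n d) \<in> BJS" using \<Theta>_surj by blast
        then have "C = BJS `` {\<Theta> n d}" using A BJS_class_eq_iff \<Theta>_skew_shape(1) by blast
        then show "C \<in> (\<lambda>d. BJS `` {\<Theta> n d}) ` diagrams n" using d(1) by blast
      qed
    qed
  qed
next
  fix d assume "d \<in> diagrams n"
  then show "is_jones_normal_form_of n \<delta> (row_reading_word (\<Theta> n d)) d"
    and "is_dual_jones_normal_form_of n \<delta> (column_reading_word (\<Theta> n d)) d"
    by (rule jones_normal_form_row_reading_word, rule dual_jones_normal_form_column_reading_word)
qed

end
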